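(* Let $R$ be a Hecke symmetry on a finite dimensional vector space $V$ satisfying the $1$-dimensional source condition. Then the $R$-symmetric algebra $\mathbb S(V,R)$ and the $R$-skewsymmetric algebra $\Lambda(V,R)$ are Koszul, and their Hilbert series satisfy $h_{\mathbb S(V,R)}(t)\,h_{\Lambda(V,R)}(-t)=1$.
   Context: $\Bbbk$ is a field. A Hecke symmetry with parameter $0\neq q\in\Bbbk$ on $V$ is a linear operator $R$ on $V\otimes V$ with $(R+\mathrm{id})(R-q\,\mathrm{id})=0$ and $R_1R_2R_1=R_2R_1R_2$ on $V^{\otimes3}$, where $R_1=R\otimes\mathrm{id}_V$, $R_2=\mathrm{id}_V\otimes R$. It gives a representation of the Hecke algebra $\mathcal H_n(q)$ (generators $T_1,\dots,T_{n-1}$, braid relations, $(T_i-q)(T_i+1)=0$) on $V^{\otimes n}$ with $T_i$ acting by $\mathrm{id}^{\otimes(i-1)}\otimes R\otimes\mathrm{id}^{\otimes(n-i-1)}$. An indecomposable $\mathcal H_n$-module has a $1$-dimensional source if it is a direct summand of a module induced from a $1$-dimensional representation of a parabolic subalgebra $\mathcal H_\lambda$ (generated by $T_j$, $j\notin\{\lambda_1,\lambda_1+\lambda_2,\dots\}$, $\lambda$ a composition of $n$). $R$ satisfies the $1$-dimensional source condition if for every $n>0$ all indecomposable direct summands of the $\mathcal H_n$-module $V^{\otimes n}$ have $1$-dimensional sources. $\mathbb S(V,R)$ and $\Lambda(V,R)$ are the quotients of the tensor algebra $\mathbb T(V)$ by the ideals generated by $\operatorname{Im}(R-q\,\mathrm{id})$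 and $\operatorname{Ker}(R-q\,\mathrm{id})$ respectively. A quadratic graded algebra $A$ is Koszul if its right Koszul complex is a resolution of the trivial module $\Bbbk$ (equivalently, $\Bbbk$ has a linear graded free resolution). The Hilbert series is $h_A(t)=\sum_n(\dim A_n)t^n$. *)

theory Defs
  imports Main
    "HOL-Library.Function_Algebras"
    "HOL-Combinatorics.Permutations"
    "HOL-Combinatorics.Transposition"
    "HOL-Computational_Algebra.Formal_Power_Series"
begin

definition sc :: "'k::field \<Rightarrow> ('a \<Rightarrow> 'k) \<Rightarrow> ('a \<Rightarrow> 'k)" where
  "sc c f = (\<lambda>w. c * f w)"

definition words :: "nat \<Rightarrow> nat \<Rightarrow> nat list set" where
  "words d n = {w. length w = n \<and> set w \<subseteq> {..<d}}"

text \<open>The tensor power V^{\<otimes>n}, V = k^d, in coordinates: coefficient functions on basis words.\<close>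
definition tens :: "nat \<Rightarrow> nat \<Rightarrow> (nat list \<Rightarrow> 'k::field) set" where
  "tens d n = {f. \<forall>w. w \<notin> words d n \<longrightarrow> f w = 0}"

text \<open>Elementary tensor u \<otimes> v of u in V^{\<otimes>a} and v in V^{\<otimes>b}.\<close>
definition etens :: "nat \<Rightarrow> (nat list \<Rightarrow> 'k::field) \<Rightarrow> (nat list \<Rightarrow> 'k) \<Rightarrow> (nat list \<Rightarrow> 'k)" where
  "etens a u v = (\<lambda>w. u (take a w) * v (drop a w))"

definition tensor_sp :: "nat \<Rightarrow> (nat list \<Rightarrow> 'k::field) set \<Rightarrow> (nat list \<Rightarrow> 'k) set \<Rightarrow> (nat list \<Rightarrow> 'k) set" where
  "tensor_sp a U U' = module.span sc {etens a u v | u v. u \<in> U \<and> v \<in> U'}"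

text \<open>The operator R_{i+1} = id^{\<otimes>i} \<otimes> R \<otimes> id on V^{\<otimes>n} (positions i, i+1, 0-indexed),
  where R is given by its matrix: R(e_c \<otimes> e_e) = \<Sum>_{a,b} R a b c e \<cdot> e_a \<otimes> e_b.\<close>
definition Rop :: "nat \<Rightarrow> (nat \<Rightarrow> nat \<Rightarrow> nat \<Rightarrow> nat \<Rightarrow> 'k::field) \<Rightarrow> nat \<Rightarrow> (nat list \<Rightarrow> 'k) \<Rightarrow> (nat list \<Rightarrow> 'k)" where
  "Rop d R i f = (\<lambda>w. if set w \<subseteq> {..<d} \<and> Suc i < length w
       then (\<Sum>c<d. \<Sum>e<d. R (w ! i) (w ! Suc i) c e * f (w[i := c, Suc i := e]))
       else 0)"

definition hecke_symmetry :: "nat \<Rightarrow> 'k::field \<Rightarrow> (nat \<Rightarrow> nat \<Rightarrow> nat \<Rightarrow> nat \<Rightarrow> 'k) \<Rightarrow> bool" where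
  "hecke_symmetry d q R \<longleftrightarrow> q \<noteq> 0
     \<and> (\<forall>f \<in> tens d 2. Rop d R 0 (Rop d R 0 f) = (\<lambda>w. (q - 1) * Rop d R 0 f w + q * f w))
     \<and> (\<forall>f \<in> tens d 3. Rop d R 0 (Rop d R 1 (Rop d R 0 f)) = Rop d R 1 (Rop d R 0 (Rop d R 1 f)))"

text \<open>H_n-submodule of V^{\<otimes>n}: subspace stable under all T_{i+1} (i+1 < n) acting by R_{i+1}.\<close>
definition inv_sub :: "nat \<Rightarrow> (nat \<Rightarrow> nat \<Rightarrow> nat \<Rightarrow> nat \<Rightarrow> 'k::field) \<Rightarrow> nat \<Rightarrow> (nat list \<Rightarrow> 'k) set \<Rightarrow> bool" where
  "inv_sub d R n M \<longleftrightarrow> module.subspace sc M \<and> M \<subseteq> tens d n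
     \<and> (\<forall>i. Suc i < n \<longrightarrow> (\<forall>m \<in> M. Rop d R i m \<in> M))"

definition indec_summand :: "nat \<Rightarrow> (nat \<Rightarrow> nat \<Rightarrow> nat \<Rightarrow> nat \<Rightarrow> 'k::field) \<Rightarrow> nat \<Rightarrow> (nat list \<Rightarrow> 'k) set \<Rightarrow> bool" where
  "indec_summand d R n M \<longleftrightarrow> inv_sub d R n M
     \<and> (\<exists>N. inv_sub d R n N \<and> M \<inter> N = {0} \<and> tens d n = {m + x | m x. m \<in> M \<and> x \<in> N})
     \<and> M \<noteq> {0}
     \<and> (\<forall>M1 M2. inv_sub d R n M1 \<and> inv_sub d R n M2 \<and> M1 \<inter> M2 = {0}
            \<and> M = {a + b | a b. a \<in> M1 \<and> b \<in> M2} \<longrightarrow> M1 = {0} \<or> M2 = {0})"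

definition perms :: "nat \<Rightarrow> (nat \<Rightarrow> nat) set" where
  "perms n = {p. p permutes {..<n}}"

text \<open>Coxeter length = number of inversions.\<close>
definition hlen :: "nat \<Rightarrow> (nat \<Rightarrow> nat) \<Rightarrow> nat" where
  "hlen n p = card {(i, j). i < j \<and> j < n \<and> p j < p i}"

text \<open>Elements of H_n: coefficient functions x with x = \<Sum>_w x(w) T_w.\<close>
definition hecke :: "nat \<Rightarrow> ((nat \<Rightarrow> nat) \<Rightarrow> 'k::field) set" where
  "hecke n = {x. \<forall>p. p \<notin> perms n \<longrightarrow> x p = 0}"

text \<open>Simple transposition s_{s+1} = (s, s+1) (0-indexed positions); T_{s+1} in the paper.\<close>
definition sgen :: "nat \<Rightarrow> nat \<Rightarrow> nat" where
  "sgen s = transpose s (Suc s)"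

text \<open>Left multiplication by T_{s+1}: T_s T_w = T_{sw} if l(sw) > l(w), else q T_{sw} + (q-1) T_w.\<close>
definition hl :: "nat \<Rightarrow> 'k::field \<Rightarrow> nat \<Rightarrow> ((nat \<Rightarrow> nat) \<Rightarrow> 'k) \<Rightarrow> ((nat \<Rightarrow> nat) \<Rightarrow> 'k)" where
  "hl n q s x = (\<lambda>u. if hlen n (sgen s \<circ> u) < hlen n u
       then x (sgen s \<circ> u) + (q - 1) * x u else q * x (sgen s \<circ> u))"

definition hr :: "nat \<Rightarrow> 'k::field \<Rightarrow> ((nat \<Rightarrow> nat) \<Rightarrow> 'k) \<Rightarrow> nat \<Rightarrow> ((nat \<Rightarrow> nat) \<Rightarrow> 'k)" where
  "hr n q x s = (\<lambda>u. if hlen n (u \<circ> sgen s) < hlen n u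
       then x (u \<circ> sgen s) + (q - 1) * x u else q * x (u \<circ> sgen s))"

definition composition :: "nat \<Rightarrow> nat list \<Rightarrow> bool" where
  "composition n lam \<longleftrightarrow> (\<forall>p \<in> set lam. 0 < p) \<and> sum_list lam = n"

definition breaks :: "nat list \<Rightarrow> nat set" where
  "breaks lam = {sum_list (take k lam) | k. 1 \<le> k \<and> k \<le> length lam}"

text \<open>0-indexed generators s of H_lam: T_{s+1} with s+1 \<notin> {lam_1, lam_1+lam_2, ...}.\<close>
definition par_gens :: "nat \<Rightarrow> nat list \<Rightarrow> nat set" where
  "par_gens n lam = {s. Suc s < n \<and> Suc s \<notin> breaks lam}"

text \<open>1-dimensional representation of H_lam: values chi(s) on generators T_{s+1} satisfying
  the defining (quadratic and braid) relations of H_lam (commutation relations are automatic).\<close>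
definition one_dim_rep :: "'k::field \<Rightarrow> nat \<Rightarrow> nat list \<Rightarrow> (nat \<Rightarrow> 'k) \<Rightarrow> bool" where
  "one_dim_rep q n lam chi \<longleftrightarrow>
     (\<forall>s \<in> par_gens n lam. (chi s - q) * (chi s + 1) = 0)
     \<and> (\<forall>s. s \<in> par_gens n lam \<and> Suc s \<in> par_gens n lam \<longrightarrow>
           chi s * chi (Suc s) * chi s = chi (Suc s) * chi s * chi (Suc s))"

text \<open>Ind = H_n \<otimes>_{H_lam} k_chi = H_n / K with K = span { x T_s - chi(s) x }.\<close>
definition ind_kernel :: "nat \<Rightarrow> 'k::field \<Rightarrow> nat list \<Rightarrow> (nat \<Rightarrow> 'k) \<Rightarrow> ((nat \<Rightarrow> nat) \<Rightarrow> 'k) set" where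
  "ind_kernel n q lam chi = module.span sc
     {(\<lambda>u. hr n q x s u - chi s * x u) | x s. x \<in> hecke n \<and> s \<in> par_gens n lam}"

text \<open>M is isomorphic to a direct summand of Ind: there are H_n-module maps
  f : M \<rightarrow> H_n/K and g : H_n/K \<rightarrow> M with g \<circ> f = id_M.\<close>
definition summand_of_induced :: "nat \<Rightarrow> 'k::field \<Rightarrow> (nat \<Rightarrow> nat \<Rightarrow> nat \<Rightarrow> nat \<Rightarrow> 'k) \<Rightarrow> nat
     \<Rightarrow> (nat list \<Rightarrow> 'k) set \<Rightarrow> nat list \<Rightarrow> (nat \<Rightarrow> 'k) \<Rightarrow> bool" where
  "summand_of_induced d q R n M lam chi \<longleftrightarrow>
     (\<exists>f g. (\<forall>m \<in> M. f m \<in> hecke n)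
        \<and> (\<forall>a \<in> M. \<forall>b \<in> M. f (a + b) = f a + f b)
        \<and> (\<forall>c. \<forall>a \<in> M. f (sc c a) = sc c (f a))
        \<and> (\<forall>m \<in> M. \<forall>s. Suc s < n \<longrightarrow> f (Rop d R s m) - hl n q s (f m) \<in> ind_kernel n q lam chi)
        \<and> (\<forall>x \<in> hecke n. g x \<in> M)
        \<and> (\<forall>x \<in> hecke n. \<forall>y \<in> hecke n. g (x + y) = g x + g y)
        \<and> (\<forall>c. \<forall>x \<in> hecke n. g (sc c x) = sc c (g x))
        \<and> (\<forall>x \<in> ind_kernel n q lam chi. g x = 0)
        \<and> (\<forall>x \<in> hecke n. \<forall>s. Suc s < n \<longrightarrow> g (hl n q s x) = Rop d R s (g x))
        \<and> (\<forall>m \<in> M. g (f m) = m))"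

definition one_dim_source_cond :: "nat \<Rightarrow> 'k::field \<Rightarrow> (nat \<Rightarrow> nat \<Rightarrow> nat \<Rightarrow> nat \<Rightarrow> 'k) \<Rightarrow> bool" where
  "one_dim_source_cond d q R \<longleftrightarrow>
     (\<forall>n > 0. \<forall>M. indec_summand d R n M \<longrightarrow>
        (\<exists>lam chi. composition n lam \<and> one_dim_rep q n lam chi
                   \<and> summand_of_induced d q R n M lam chi))"

definition emb :: "nat \<Rightarrow> (nat list \<Rightarrow> 'k::field) set \<Rightarrow> nat \<Rightarrow> nat \<Rightarrow> (nat list \<Rightarrow> 'k) set" where
  "emb d I i j = tensor_sp i (tens d i) (tensor_sp 2 I (tens d j))"

text \<open>Degree-m part of the ideal (I): J_m = \<Sum>_{i+2+j=m} V^i \<otimes> I \<otimes> V^j; A_m = V^{\<otimes>m}/J_m.\<close>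
definition Jsp :: "nat \<Rightarrow> (nat list \<Rightarrow> 'k::field) set \<Rightarrow> nat \<Rightarrow> (nat list \<Rightarrow> 'k) set" where
  "Jsp d I m = (if m < 2 then {0} else module.span sc (\<Union>i \<in> {..m-2}. emb d I i (m - 2 - i)))"

text \<open>W_n = (A^!_n)^* = \<Inter>_{i+2+j=n} V^i \<otimes> I \<otimes> V^j (W_0 = k, W_1 = V).\<close>
definition Wsp :: "nat \<Rightarrow> (nat list \<Rightarrow> 'k::field) set \<Rightarrow> nat \<Rightarrow> (nat list \<Rightarrow> 'k) set" where
  "Wsp d I n = (if n < 2 then tens d n else (\<Inter>i \<in> {..n-2}. emb d I i (n - 2 - i)))"

text \<open>Right Koszul complex K_n = W_n \<otimes> A; its component W_n \<otimes> A_m = Ccx n m / Zcx n m, with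
  differential W_n \<otimes> A_m \<rightarrow> W_{n-1} \<otimes> A_{m+1} induced by the identity of V^{\<otimes>(n+m)}.\<close>
definition Ccx :: "nat \<Rightarrow> (nat list \<Rightarrow> 'k::field) set \<Rightarrow> nat \<Rightarrow> nat \<Rightarrow> (nat list \<Rightarrow> 'k) set" where
  "Ccx d I n m = tensor_sp n (Wsp d I n) (tens d m)"

definition Zcx :: "nat \<Rightarrow> (nat list \<Rightarrow> 'k::field) set \<Rightarrow> nat \<Rightarrow> nat \<Rightarrow> (nat list \<Rightarrow> 'k) set" where
  "Zcx d I n m = tensor_sp n (Wsp d I n) (Jsp d I m)"

text \<open>Koszul: the right Koszul complex \<dots> \<rightarrow> W_2 \<otimes> A \<rightarrow> W_1 \<otimes> A \<rightarrow> A \<rightarrow> k \<rightarrow> 0 is exact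
  (exactness at W_n \<otimes> A_m for n \<ge> 1, and ker(A \<rightarrow> k) = A_+ = image of W_1 \<otimes> A).\<close>
definition koszul :: "nat \<Rightarrow> (nat list \<Rightarrow> 'k::field) set \<Rightarrow> bool" where
  "koszul d I \<longleftrightarrow>
     (\<forall>n m. 1 \<le> n \<longrightarrow> (\<forall>x \<in> Ccx d I n m. x \<in> Zcx d I (n - 1) (Suc m) \<longrightarrow>
         (if m = 0 then x \<in> Zcx d I n 0
          else (\<exists>y \<in> Ccx d I (Suc n) (m - 1). x - y \<in> Zcx d I n m))))
     \<and> (\<forall>m. 1 \<le> m \<longrightarrow> (\<forall>x \<in> Ccx d I 0 m. \<exists>y \<in> Ccx d I 1 (m - 1). x - y \<in> Zcx d I 0 m))"

text \<open>dim A_n = dim V^{\<otimes>n} - dim J_n.\<close>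
definition hdim :: "nat \<Rightarrow> (nat list \<Rightarrow> 'k::field) set \<Rightarrow> nat \<Rightarrow> nat" where
  "hdim d I n = vector_space.dim (sc :: 'k \<Rightarrow> _) (tens d n) - vector_space.dim (sc :: 'k \<Rightarrow> _) (Jsp d I n)"

text \<open>Relations of S(V,R): Im(R - q id); of \<Lambda>(V,R): Ker(R - q id).\<close>
definition IS :: "nat \<Rightarrow> 'k::field \<Rightarrow> (nat \<Rightarrow> nat \<Rightarrow> nat \<Rightarrow> nat \<Rightarrow> 'k) \<Rightarrow> (nat list \<Rightarrow> 'k) set" where
  "IS d q R = {(\<lambda>w. Rop d R 0 f w - q * f w) | f. f \<in> tens d 2}"

definition IL :: "nat \<Rightarrow> 'k::field \<Rightarrow> (nat \<Rightarrow> nat \<Rightarrow> nat \<Rightarrow> nat \<Rightarrow> 'k) \<Rightarrow> (nat list \<Rightarrow> 'k) set" where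
  "IL d q R = {f \<in> tens d 2. Rop d R 0 f = sc q f}"

end

theory Submission
  imports Defs
    "HOL-Library.Set_Algebras"
    "HOL-Combinatorics.Multiset_Permutations"
    "HOL-Computational_Algebra.Polynomial"
begin

text \<open>The components of degree \<open>N\<close> of the Koszul complexes of \<open>S(V,R)\<close> and \<open>\<Lambda>(V,R)\<close> are obtained from the
  \<open>H_N\<close>-module \<open>V^N\<close> by additive functors, so exactness passes to direct summands and it suffices to treat a module
  induced from a character of a parabolic subalgebra. Such a module is a weight space of the tensor power of a standard
  super vector space, where the letters are even or odd according to the character. There both algebras have PBW bases
  and the complex is a cube, contracted by moving the smallest letter of the weight.

  Exactness of the complex of \<open>\<Lambda>\<close> expresses \<open>h_\<Lambda>\<close> through the dimensions of the invariants
  \<open>\<Inter>i. Ker (R_i - q)\<close> of \<open>V^n\<close>, whereas \<open>dim S_n\<close> is the dimension of the coinvariants. For a summand \<open>e X\<close> of an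
  induced module \<open>X\<close> both are 0 or 1 according to the scalars by which \<open>e\<close> acts on the invariants and the coinvariants of
  \<open>X\<close>. These scalars are compared by means of a symmetric form on \<open>X\<close> for which the operators \<open>T_i\<close> are self-adjoint:
  they are sums over minimal coset representatives that differ by \<open>p \<mapsto> p\<inverse>\<close>, which preserves lengths.\<close>

section \<open>Finite dimensional subspaces\<close>

locale subspaces = vector_space scale
  for scale :: "'a::field \<Rightarrow> 'b::ab_group_add \<Rightarrow> 'b" (infixr \<open>*s\<close> 75)
begin

definition fin_dim :: "'b set \<Rightarrow> bool" where
  "fin_dim S \<longleftrightarrow> (\<exists>B. finite B \<and> S \<subseteq> span B)"

lemma fin_dim_subset: "fin_dim T \<Longrightarrow> S \<subseteq> T \<Longrightarrow> fin_dim S"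
  unfolding fin_dim_def by blast

lemma subspace_set_plus: "subspace A \<Longrightarrow> subspace B \<Longrightarrow> subspace (A + B)"
  using subspace_sums[of A B] unfolding set_plus_def by (simp add: conj_ac Bex_def)

lemma span_Un_eq_set_plus: "span (S \<union> T) = span S + span T"
  unfolding span_Un set_plus_def by blast

lemma fin_dim_basis:
  assumes "subspace S" "fin_dim S"
  obtains B where "finite B" "B \<subseteq> S" "independent B" "span B = S" "card B = dim S"
proof -
  obtain B where B: "B \<subseteq> S" "independent B" "S \<subseteq> span B" "card B = dim S"
    using basis_exists[of S] by blast
  obtain G where G: "finite G" "S \<subseteq> span G"
    using assms(2) unfolding fin_dim_def by blast
  have "finite B"
    using independent_span_bound[OF G(1) B(2)] B(1) G(2) by blast
  moreover have "span B = S"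
    using span_subspace[OF B(1,3) assms(1)] .
  ultimately show thesis
    using that B by blast
qed

lemma independent_Un_of_disjoint_spans:
  assumes fin: "finite P" "finite Q" and ind: "independent P" "independent Q"
    and int: "span P \<inter> span Q = {0}"
  shows "independent (P \<union> Q)" "P \<inter> Q = {}"
proof -
  show disjoint: "P \<inter> Q = {}"
  proof (rule ccontr)
    assume "P \<inter> Q \<noteq> {}"
    then obtain x where x: "x \<in> P" "x \<in> Q"
      by blast
    hence "x = 0"
      using int span_base[of x] by blast
    thus False
      using x(1) ind(1) dependent_zero by blast
  qed
  show "independent (P \<union> Q)"
  proof (rule independent_if_scalars_zero)
    fix f x assume sum: "(\<Sum>x\<in>P \<union> Q. f x *s x) = 0" and x: "x \<in> P \<union> Q"
    have sum_P: "(\<Sum>x\<in>P. f x *s x) = - (\<Sum>x\<in>Q. f x *s x)"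
      using sum by (simp add: sum.union_disjoint[OF fin disjoint] eq_neg_iff_add_eq_0)
    moreover have "(\<Sum>x\<in>P. f x *s x) \<in> span P" "- (\<Sum>x\<in>Q. f x *s x) \<in> span Q"
      by (intro span_neg span_sum span_scale span_base, assumption)+
    ultimately have "(\<Sum>x\<in>P. f x *s x) \<in> span P \<inter> span Q"
      by (simp only: Int_iff)
    hence zero_P: "(\<Sum>x\<in>P. f x *s x) = 0"
      using int by simp
    hence "(\<Sum>x\<in>Q. f x *s x) = 0"
      using sum_P by simp
    with zero_P show "f x = 0"
      using x independentD[OF ind(1) fin(1) order_refl] independentD[OF ind(2) fin(2) order_refl]
      by blast
  qed (use fin in simp)
qed

lemma dim_direct_sum:
  assumes A: "subspace A" "fin_dim A" and B: "subspace B" "fin_dim B" and int: "A \<inter> B = {0}"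
  shows "dim (A + B) = dim A + dim B"
proof -
  obtain P where P: "finite P" "P \<subseteq> A" "independent P" "span P = A" "card P = dim A"
    using fin_dim_basis[OF A] .
  obtain Q where Q: "finite Q" "Q \<subseteq> B" "independent Q" "span Q = B" "card Q = dim B"
    using fin_dim_basis[OF B] .
  note PQ = independent_Un_of_disjoint_spans[OF P(1) Q(1) P(3) Q(3)]
  have "dim (A + B) = card (P \<union> Q)"
    using dim_span_eq_card_independent[OF PQ(1)] int P(4) Q(4) by (simp add: span_Un_eq_set_plus)
  thus ?thesis
    using card_Un_disjoint[OF P(1) Q(1) PQ(2)] int P(4,5) Q(4,5) by simp
qed

lemma subspace_complement:
  assumes C: "subspace C" and B: "subspace B" and CB: "C \<subseteq> B"
  obtains D where "subspace D" "D \<subseteq> B" "C \<inter> D = {0}" "C + D = B"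
proof -
  interpret vector_space_pair "(*s)" "(*s)" ..
  obtain g where g: "range g \<subseteq> C" "Vector_Spaces.linear (*s) (*s) g" "\<And>v. v \<in> C \<Longrightarrow> g v = v"
    using linear_exists_left_inverse_on[of "\<lambda>x. x" C] C linear_ident by auto
  interpret g: Vector_Spaces.linear "(*s)" "(*s)" g by (fact g(2))
  let ?D = "B \<inter> {x. g x = 0}"
  have "subspace ?D"
    by (intro subspace_inter B g.subspace_kernel)
  moreover have "C \<inter> ?D = {0}"
    using g(3) subspace_0[OF C] subspace_0[OF B] by auto
  moreover have "C + ?D = B"
  proof (intro equalityI subsetI)
    fix x assume "x \<in> C + ?D"
    then show "x \<in> B"
      using CB subspace_add[OF B] by (auto elim!: set_plus_elim)
  next
    fix x assume x: "x \<in> B"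
    have "g x \<in> C"
      using g(1) by blast
    moreover from this have "x - g x \<in> ?D"
      using x CB g(3) subspace_diff[OF B] by (auto simp: g.diff)
    ultimately have "g x + (x - g x) \<in> C + ?D"
      by (rule set_plus_intro)
    thus "x \<in> C + ?D"
      by simp
  qed
  ultimately show thesis
    using that by blast
qed

lemma dim_set_plus_Int:
  assumes A: "subspace A" "fin_dim A" and B: "subspace B" "fin_dim B"
  shows "dim (A + B) + dim (A \<inter> B) = dim A + dim B"
proof -
  obtain D where D: "subspace D" "D \<subseteq> B" "A \<inter> B \<inter> D = {0}" "A \<inter> B + D = B"
    using subspace_complement[OF subspace_inter[OF A(1) B(1)] B(1)] by blast
  note fin = fin_dim_subset[OF B(2) D(2)] fin_dim_subset[OF A(2), of "A \<inter> B"]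
  have "A + (A \<inter> B) = A"
    using subspace_add[OF A(1)] set_zero_plus2[of "A \<inter> B" A] subspace_0 A(1) B(1)
    by (auto elim!: set_plus_elim simp: add.commute[of A])
  hence "A + B = A + D"
    using D(4) by (metis add.assoc)
  moreover have "A \<inter> D = {0}"
    using D(2,3) by blast
  ultimately have "dim (A + B) = dim A + dim D"
    using dim_direct_sum[OF A D(1) fin(1)] by simp
  moreover have "dim B = dim (A \<inter> B) + dim D"
    using dim_direct_sum[OF subspace_inter[OF A(1) B(1)] fin(2) D(1) fin(1) D(3)] D(4) by simp
  ultimately show ?thesis
    by simp
qed

lemma fin_dim_dim_mono:
  assumes "A \<subseteq> B" "subspace B" "fin_dim B"
  shows "dim A \<le> dim B"
proof -
  obtain P where "finite P" "span P = B" "card P = dim B"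
    using fin_dim_basis[OF assms(2,3)] .
  thus ?thesis
    using dim_le_card[of A P] assms(1) by simp
qed

lemma dim_zero_subspace [simp]: "dim {0} = 0"
  using dim_span_eq_card_independent[OF independent_empty] by simp

lemma fin_dim_dim_pos:
  assumes "subspace A" "fin_dim A" "A \<noteq> {0}"
  shows "dim A > 0"
proof -
  obtain P where "finite P" "span P = A" "card P = dim A"
    using fin_dim_basis[OF assms(1,2)] .
  thus ?thesis
    using assms(3) by (cases "P = {}") (auto simp flip: card_gt_0_iff)
qed

lemma dim_span_singleton: "x \<noteq> 0 \<Longrightarrow> dim (span {x}) = 1"
  using dim_span_eq_card_independent[of "{x}"] by simp

lemma functional_kernel_complement:
  assumes M: "subspace M" and m: "m \<in> M" "\<phi> m \<noteq> 0"
    and \<phi>: "\<And>x y c. x \<in> M \<Longrightarrow> y \<in> M \<Longrightarrow> \<phi> (x - c *s y) = \<phi> x - c * \<phi> y"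
  shows "subspace {x \<in> M. \<phi> x = 0}" "{x \<in> M. \<phi> x = 0} \<inter> span {m} = {0}" "{x \<in> M. \<phi> x = 0} + span {m} = M"
proof -
  let ?K = "{x \<in> M. \<phi> x = 0}"
  have zero: "\<phi> 0 = 0"
    using \<phi>[OF m(1) m(1), of 1] by simp
  have scale: "\<phi> (c *s x) = c * \<phi> x" if "x \<in> M" for c x
    using \<phi>[OF subspace_0[OF M] that, of "- c"] zero by (simp add: scale_minus_left)
  have span: "span {m} \<subseteq> M"
    using m(1) by (intro span_minimal M) simp
  show "subspace ?K"
  proof (rule subspaceI)
    fix x y assume "x \<in> ?K" "y \<in> ?K"
    thus "x + y \<in> ?K"
      using \<phi>[of x y "- 1"] subspace_add[OF M] by (simp add: scale_minus_left)
  qed (use zero scale subspace_0[OF M] subspace_scale[OF M] in auto)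
  show "?K \<inter> span {m} = {0}"
    using m zero scale subspace_0[OF M] by (auto simp: span_singleton)
  show "?K + span {m} = M"
  proof (intro equalityI subsetI)
    fix x assume x: "x \<in> M"
    have "x - (\<phi> x / \<phi> m) *s m \<in> ?K"
      using \<phi>[OF x m(1)] m x subspace_diff[OF M] subspace_scale[OF M] by simp
    moreover have "(\<phi> x / \<phi> m) *s m \<in> span {m}"
      by (intro span_scale span_base) simp
    ultimately have "(x - (\<phi> x / \<phi> m) *s m) + (\<phi> x / \<phi> m) *s m \<in> ?K + span {m}"
      by (rule set_plus_intro)
    thus "x \<in> ?K + span {m}"
      by simp
  qed (use span subspace_add[OF M] in \<open>auto elim!: set_plus_elim\<close>)
qed

lemma dim_functional_kernel:
  assumes M: "subspace M" "fin_dim M"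
    and \<phi>: "\<And>x y c. x \<in> M \<Longrightarrow> y \<in> M \<Longrightarrow> \<phi> (x - c *s y) = \<phi> x - c * \<phi> y"
  shows "dim {x \<in> M. \<phi> x = 0} + (if \<forall>x\<in>M. \<phi> x = 0 then 0 else 1) = dim M"
proof (cases "\<forall>x\<in>M. \<phi> x = 0")
  case True
  hence "{x \<in> M. \<phi> x = 0} = M"
    by blast
  thus ?thesis
    using True by simp
next
  case False
  then obtain m where m: "m \<in> M" "\<phi> m \<noteq> 0"
    by blast
  note complement = functional_kernel_complement[OF M(1) m \<phi>]
  have "dim (span {m}) = 1"
    using \<phi>[OF m(1) m(1), of 1] m(2) by (intro dim_span_singleton) auto
  moreover have "span {m} \<subseteq> M"
    using m(1) by (intro span_minimal M(1)) simp
  hence "dim ({x \<in> M. \<phi> x = 0} + span {m}) = dim {x \<in> M. \<phi> x = 0} + dim (span {m})"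
    by (intro dim_direct_sum complement subspace_span fin_dim_subset[OF M(2)]) auto
  ultimately show ?thesis
    using False by (simp only: complement(3) if_False)
qed

lemma independent_family:
  assumes fin: "finite I"
    and zero: "\<And>c i. (\<Sum>i\<in>I. c i *s g i) = 0 \<Longrightarrow> i \<in> I \<Longrightarrow> c i = 0"
  shows "inj_on g I" "independent (g ` I)"
proof -
  show inj: "inj_on g I"
  proof (rule inj_onI, rule ccontr)
    fix i j assume ij: "i \<in> I" "j \<in> I" "g i = g j" "i \<noteq> j"
    let ?c = "\<lambda>k. if k = i then 1 else if k = j then - 1 else 0"
    have "(\<Sum>k\<in>I. ?c k *s g k) = (\<Sum>k\<in>{i, j}. ?c k *s g k)"
      by (rule sum.mono_neutral_right[OF fin]) (use ij in auto)
    also have "\<dots> = 0"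
      using ij by (simp add: scale_minus_left)
    finally show False
      using zero[of ?c i] ij(1) by simp
  qed
  show "independent (g ` I)"
  proof (rule independent_if_scalars_zero)
    fix f x assume "(\<Sum>x\<in>g ` I. f x *s x) = 0" and "x \<in> g ` I"
    thus "f x = 0"
      using zero[of "\<lambda>i. f (g i)"] by (auto simp: sum.reindex[OF inj])
  qed (use fin in simp)
qed

end

section \<open>Finitely supported functions\<close>

interpretation fs: subspaces "sc :: 'k::field \<Rightarrow> ('a \<Rightarrow> 'k) \<Rightarrow> 'a \<Rightarrow> 'k"
  by unfold_locales (auto simp: sc_def algebra_simps fun_eq_iff)

abbreviation linear_map :: "(('a \<Rightarrow> 'k::field) \<Rightarrow> 'b \<Rightarrow> 'k) \<Rightarrow> bool" where
  "linear_map \<equiv> Vector_Spaces.linear sc sc"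

lemma linear_mapI:
  fixes f :: "('a \<Rightarrow> 'k::field) \<Rightarrow> 'b \<Rightarrow> 'k"
  assumes "\<And>x y. f (x + y) = f x + f y" "\<And>c x. f (sc c x) = sc c (f x)"
  shows "linear_map f"
  unfolding Vector_Spaces.linear_iff by (intro conjI allI fs.vector_space_axioms assms)

lemma sum_fun_apply: "(\<Sum>i\<in>A. f i) w = (\<Sum>i\<in>A. f i w)"
  by (induction A rule: infinite_finite_induct) auto

definition supp_in :: "'a set \<Rightarrow> ('a \<Rightarrow> 'k::field) set" where
  "supp_in W = {f. \<forall>w. w \<notin> W \<longrightarrow> f w = 0}"

definition delta :: "'a \<Rightarrow> 'a \<Rightarrow> 'k::field" where
  "delta v w = (if w = v then 1 else 0)"

lemma subspace_supp_in: "fs.subspace (supp_in W)"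
  by (auto simp: fs.subspace_def supp_in_def sc_def)

lemma delta_in_supp_in: "v \<in> W \<Longrightarrow> delta v \<in> supp_in W"
  by (auto simp: supp_in_def delta_def)

lemma sum_mult_delta: "finite W \<Longrightarrow> (\<Sum>w\<in>W. f w * delta v w) = (if v \<in> W then f v else 0)"
  by (simp add: delta_def if_distrib cong: if_cong)

lemma supp_in_expand:
  assumes "finite W" "f \<in> supp_in W"
  shows "f = (\<Sum>v\<in>W. sc (f v) (delta v))"
proof
  fix w
  have "(\<Sum>v\<in>W. sc (f v) (delta v)) w = (\<Sum>v\<in>W. if v = w then f v else 0)"
    unfolding sum_fun_apply by (rule sum.cong) (auto simp: sc_def delta_def)
  thus "f w = (\<Sum>v\<in>W. sc (f v) (delta v)) w"
    using assms by (auto simp: supp_in_def)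
qed

lemma span_delta:
  assumes "finite W"
  shows "fs.span (delta ` W) = (supp_in W :: ('a \<Rightarrow> 'k::field) set)"
proof
  show "fs.span (delta ` W) \<subseteq> (supp_in W :: ('a \<Rightarrow> 'k) set)"
    by (rule fs.span_minimal) (auto simp: delta_in_supp_in subspace_supp_in)
  show "(supp_in W :: ('a \<Rightarrow> 'k) set) \<subseteq> fs.span (delta ` W)"
  proof
    fix f :: "'a \<Rightarrow> 'k" assume "f \<in> supp_in W"
    hence "f = (\<Sum>v\<in>W. sc (f v) (delta v))"
      by (rule supp_in_expand[OF assms])
    also have "\<dots> \<in> fs.span (delta ` W)"
      by (intro fs.span_sum fs.span_scale fs.span_base imageI)
    finally show "f \<in> fs.span (delta ` W)" .
  qed
qed

lemma fin_dim_supp_in: "finite W \<Longrightarrow> fs.fin_dim (supp_in W)"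
  unfolding fs.fin_dim_def using span_delta[of W] by (metis finite_imageI order_refl)

lemma linear_map_supp_in_subspace:
  assumes W: "finite W" and f: "linear_map f" and S: "fs.subspace S"
    and basis: "\<And>v. v \<in> W \<Longrightarrow> f (delta v) \<in> S" and x: "x \<in> supp_in W"
  shows "f x \<in> S"
proof -
  interpret f: Vector_Spaces.linear sc sc f by (fact f)
  have "f x = (\<Sum>v\<in>W. sc (x v) (f (delta v)))"
    by (subst supp_in_expand[OF W x]) (simp only: f.sum f.scale)
  also have "\<dots> \<in> S"
    using basis by (intro fs.subspace_sum fs.subspace_scale S)
  finally show ?thesis .
qed

lemma linear_map_eq_on_supp_in:
  fixes f g :: "('a \<Rightarrow> 'k::field) \<Rightarrow> 'b \<Rightarrow> 'k"
  assumes "finite W" "linear_map f" "linear_map g"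
    and "\<And>v. v \<in> W \<Longrightarrow> f (delta v) = g (delta v)" and "x \<in> supp_in W"
  shows "f x = g x"
proof -
  interpret vector_space_pair "sc :: 'k \<Rightarrow> ('a \<Rightarrow> 'k) \<Rightarrow> 'a \<Rightarrow> 'k" "sc :: 'k \<Rightarrow> ('b \<Rightarrow> 'k) \<Rightarrow> 'b \<Rightarrow> 'k" ..
  show ?thesis
    by (rule linear_eq_on[OF assms(2,3), of _ "delta ` W"]) (use assms in \<open>auto simp: span_delta\<close>)
qed

section \<open>Modules over a sequence of operators\<close>

locale operator_module =
  fixes N :: nat and T :: "nat \<Rightarrow> ('a \<Rightarrow> 'k::field) \<Rightarrow> 'a \<Rightarrow> 'k" and M :: "('a \<Rightarrow> 'k) set"
  assumes linear_op: "linear_map (T i)"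
    and subspace: "fs.subspace M"
    and stable: "Suc i < N \<Longrightarrow> m \<in> M \<Longrightarrow> T i m \<in> M"

locale operator_hom =
  source: operator_module N T M + target: operator_module N T' M'
  for N and T :: "nat \<Rightarrow> ('a \<Rightarrow> 'k::field) \<Rightarrow> 'a \<Rightarrow> 'k" and M
    and T' :: "nat \<Rightarrow> ('b \<Rightarrow> 'k) \<Rightarrow> 'b \<Rightarrow> 'k" and M' +
  fixes f :: "('a \<Rightarrow> 'k) \<Rightarrow> 'b \<Rightarrow> 'k"
  assumes maps: "m \<in> M \<Longrightarrow> f m \<in> M'"
    and add: "a \<in> M \<Longrightarrow> b \<in> M \<Longrightarrow> f (a + b) = f a + f b"
    and scale: "a \<in> M \<Longrightarrow> f (sc c a) = sc c (f a)"
    and equivariant: "m \<in> M \<Longrightarrow> Suc i < N \<Longrightarrow> f (T i m) = T' i (f m)"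
begin

lemma zero: "f 0 = 0"
  using scale[OF fs.subspace_0[OF source.subspace], of 0] by simp

lemma diff:
  assumes "a \<in> M" "b \<in> M"
  shows "f (a - b) = f a - f b"
proof -
  have "f (a + sc (- 1) b) = f a + sc (- 1) (f b)"
    using assms fs.subspace_scale[OF source.subspace] by (simp only: add scale)
  thus ?thesis
    by (simp add: fs.scale_minus_left)
qed

lemma sum: "(\<And>x. x \<in> A \<Longrightarrow> g x \<in> M) \<Longrightarrow> f (\<Sum>x\<in>A. g x) = (\<Sum>x\<in>A. f (g x))"
proof (induction A rule: infinite_finite_induct)
  case (insert x A)
  have "(\<Sum>x\<in>A. g x) \<in> M"
    using insert.prems by (intro fs.subspace_sum[OF source.subspace]) simp
  hence "f (g x + (\<Sum>x\<in>A. g x)) = f (g x) + f (\<Sum>x\<in>A. g x)"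
    using insert.prems by (intro add) simp_all
  also have "f (\<Sum>x\<in>A. g x) = (\<Sum>x\<in>A. f (g x))"
    using insert.prems by (intro insert.IH) simp
  finally show ?case
    unfolding sum.insert[OF insert.hyps] .
qed (simp_all add: zero)

lemma image_in_span:
  assumes S: "S \<subseteq> M" and image: "f ` S \<subseteq> fs.span S'" and x: "x \<in> fs.span S"
  shows "f x \<in> fs.span S'"
proof -
  obtain A c where x: "x = (\<Sum>a\<in>A. sc (c a) a)" and A: "A \<subseteq> S"
    using x unfolding fs.span_explicit by blast
  have "f x = (\<Sum>a\<in>A. sc (c a) (f a))"
    unfolding x using A S fs.subspace_scale[OF source.subspace]
    by (subst sum) (auto simp: scale subset_iff intro!: sum.cong)
  also have "\<dots> \<in> fs.span S'"
    using A image by (intro fs.span_sum fs.span_scale) blast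
  finally show ?thesis .
qed

end

lemma operator_hom_compose:
  assumes "operator_hom N T M T' M' f" "operator_hom N T' M' T'' M'' g"
  shows "operator_hom N T M T'' M'' (\<lambda>x. g (f x))"
proof -
  interpret f: operator_hom N T M T' M' f by fact
  interpret g: operator_hom N T' M' T'' M'' g by fact
  show ?thesis
    by unfold_locales (simp_all add: f.maps f.add f.scale f.equivariant g.maps g.add g.scale g.equivariant)
qed

section \<open>The Koszul complex of a module\<close>

datatype kind = Sym | Skew

definition relations ::
  "kind \<Rightarrow> (nat \<Rightarrow> ('a \<Rightarrow> 'k::field) \<Rightarrow> 'a \<Rightarrow> 'k) \<Rightarrow> 'k \<Rightarrow> nat \<Rightarrow> ('a \<Rightarrow> 'k) set \<Rightarrow> ('a \<Rightarrow> 'k) set" where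
  "relations k T q i P =
    (case k of Sym \<Rightarrow> (\<lambda>x. T i x - sc q x) ` P | Skew \<Rightarrow> {x \<in> P. T i x = sc q x})"

text \<open>If \<open>M\<close> is the \<open>N\<close>-th tensor power of \<open>V\<close>, the component \<open>W_n \<otimes> A_m\<close>, \<open>n + m = N\<close>, of the Koszul complex of
  \<open>S(V,R)\<close> or \<open>\<Lambda>(V,R)\<close> is the quotient of \<open>joint_relations n\<close> by \<open>relation_span n\<close>.\<close>
definition joint_relations ::
  "kind \<Rightarrow> (nat \<Rightarrow> ('a \<Rightarrow> 'k::field) \<Rightarrow> 'a \<Rightarrow> 'k) \<Rightarrow> 'k \<Rightarrow> ('a \<Rightarrow> 'k) set \<Rightarrow> nat \<Rightarrow> ('a \<Rightarrow> 'k) set" where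
  "joint_relations k T q M n = {x \<in> M. \<forall>i. Suc i < n \<longrightarrow> x \<in> relations k T q i M}"

definition relation_span ::
  "kind \<Rightarrow> (nat \<Rightarrow> ('a \<Rightarrow> 'k::field) \<Rightarrow> 'a \<Rightarrow> 'k) \<Rightarrow> 'k \<Rightarrow> ('a \<Rightarrow> 'k) set \<Rightarrow> nat \<Rightarrow> nat \<Rightarrow> ('a \<Rightarrow> 'k) set" where
  "relation_span k T q M N n =
    fs.span (\<Union>i\<in>{i. n \<le> i \<and> Suc i < N}. relations k T q i (joint_relations k T q M n))"

definition koszul_exact ::
  "kind \<Rightarrow> (nat \<Rightarrow> ('a \<Rightarrow> 'k::field) \<Rightarrow> 'a \<Rightarrow> 'k) \<Rightarrow> 'k \<Rightarrow> ('a \<Rightarrow> 'k) set \<Rightarrow> nat \<Rightarrow> bool" where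
  "koszul_exact k T q M N \<longleftrightarrow> (\<forall>n<N. joint_relations k T q M (Suc n) \<inter> relation_span k T q M N n \<subseteq>
    (if Suc n = N then {0} else joint_relations k T q M (Suc (Suc n)) + relation_span k T q M N (Suc n)))"

lemma relations_mono: "P \<subseteq> Q \<Longrightarrow> relations k T q i P \<subseteq> relations k T q i Q"
  unfolding relations_def by (auto split: kind.split)

lemma joint_relations_subset: "joint_relations k T q M n \<subseteq> M"
  unfolding joint_relations_def by blast

lemma joint_relations_antimono: "n \<le> n' \<Longrightarrow> joint_relations k T q M n' \<subseteq> joint_relations k T q M n"
  unfolding joint_relations_def by auto

lemma joint_relations_mono: "M \<subseteq> M' \<Longrightarrow> joint_relations k T q M n \<subseteq> joint_relations k T q M' n"
  unfolding joint_relations_def using relations_mono[of M M'] by blast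

lemma joint_relations_le_1: "n \<le> 1 \<Longrightarrow> joint_relations k T q M n = M"
  unfolding joint_relations_def by auto

lemma subspace_relation_span: "fs.subspace (relation_span k T q M N n)"
  unfolding relation_span_def by (rule fs.subspace_span)

lemma relations_subset_relation_span:
  "n \<le> i \<Longrightarrow> Suc i < N \<Longrightarrow> relations k T q i (joint_relations k T q M n) \<subseteq> relation_span k T q M N n"
  unfolding relation_span_def by (rule subset_trans[OF _ fs.span_superset]) blast

lemma relation_span_antimono: "n \<le> n' \<Longrightarrow> relation_span k T q M N n' \<subseteq> relation_span k T q M N n"
  unfolding relation_span_def
  by (intro fs.span_mono UN_mono relations_mono joint_relations_antimono) auto

lemma relation_span_mono: "M \<subseteq> M' \<Longrightarrow> relation_span k T q M N n \<subseteq> relation_span k T q M' N n"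
  unfolding relation_span_def by (intro fs.span_mono UN_mono relations_mono joint_relations_mono order_refl)

lemma relation_span_top: "relation_span k T q M N N = {0}"
proof -
  have no_position: "{i. N \<le> i \<and> Suc i < N} = {}"
    by auto
  show ?thesis
    unfolding relation_span_def no_position by simp
qed

context operator_module
begin

lemma linear_map_minus_scale: "linear_map (\<lambda>x. T i x - sc q x)"
proof -
  interpret T: Vector_Spaces.linear sc sc "T i" by (rule linear_op)
  show ?thesis
    by (rule linear_mapI)
      (simp_all add: T.add T.scale fs.scale_right_distrib fs.scale_right_diff_distrib mult.commute)
qed

lemma subspace_relations:
  assumes "fs.subspace P"
  shows "fs.subspace (relations k T q i P)"
proof -
  interpret D: Vector_Spaces.linear sc sc "\<lambda>x. T i x - sc q x"
    by (rule linear_map_minus_scale)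
  have "{x \<in> P. T i x = sc q x} = P \<inter> {x. T i x - sc q x = 0}"
    by auto
  hence "fs.subspace {x \<in> P. T i x = sc q x}"
    using fs.subspace_inter[OF assms D.subspace_kernel] by (simp only:)
  thus ?thesis
    using D.subspace_image[OF assms] by (cases k) (simp_all add: relations_def)
qed

lemma relations_subset: "Suc i < N \<Longrightarrow> relations k T q i M \<subseteq> M"
  unfolding relations_def
  by (auto split: kind.split intro!: fs.subspace_diff fs.subspace_scale subspace stable)

lemma subspace_joint_relations: "fs.subspace (joint_relations k T q M n)"
proof -
  have "joint_relations k T q M n = M \<inter> (\<Inter>i\<in>{i. Suc i < n}. relations k T q i M)"
    unfolding joint_relations_def by auto
  thus ?thesis
    using subspace subspace_relations by (simp add: fs.subspace_inter fs.subspace_Int)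
qed

lemma relation_span_subset: "relation_span k T q M N n \<subseteq> M"
  unfolding relation_span_def
  by (rule fs.span_minimal[OF _ subspace])
    (use relations_subset relations_mono[OF joint_relations_subset] in blast)

end

context operator_hom
begin

lemma maps_relations:
  assumes P: "P \<subseteq> M" "f ` P \<subseteq> P'" and i: "Suc i < N" and x: "x \<in> relations k T q i P"
  shows "f x \<in> relations k T' q i P'"
proof (cases k)
  case Sym
  then obtain y where y: "y \<in> P" "x = T i y - sc q y"
    using x by (auto simp: relations_def)
  hence "y \<in> M"
    using P by blast
  hence "f x = T' i (f y) - sc q (f y)"
    unfolding y(2) using i source.stable fs.subspace_scale[OF source.subspace]
    by (simp add: diff scale equivariant)
  thus ?thesis
    using Sym P y by (auto simp: relations_def)
next
  case Skew
  hence xP: "x \<in> P" "T i x = sc q x"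
    using x by (auto simp: relations_def)
  hence "T' i (f x) = sc q (f x)"
    using P(1) i by (simp add: scale subset_iff flip: equivariant)
  thus ?thesis
    using Skew P xP by (auto simp: relations_def)
qed

lemma maps_joint_relations:
  assumes n: "n \<le> N" and x: "x \<in> joint_relations k T q M n"
  shows "f x \<in> joint_relations k T' q M' n"
proof -
  have "f x \<in> relations k T' q i M'" if "Suc i < n" for i
    using maps_relations[OF order_refl, of M' i x] that n x maps by (auto simp: joint_relations_def)
  thus ?thesis
    using x maps by (simp add: joint_relations_def)
qed

lemma maps_relation_span:
  assumes "x \<in> relation_span k T q M N n"
  shows "f x \<in> relation_span k T' q M' N n"
  using assms unfolding relation_span_def
proof (rule image_in_span[rotated 2])
  let ?J = "joint_relations k T q M n"
  show "(\<Union>i\<in>{i. n \<le> i \<and> Suc i < N}. relations k T q i ?J) \<subseteq> M"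
    using source.relations_subset relations_mono[OF joint_relations_subset] by blast
  have "f x \<in> relations k T' q i (joint_relations k T' q M' n)"
    if "n \<le> i" "Suc i < N" "x \<in> relations k T q i ?J" for i x
    using that maps_joint_relations
    by (intro maps_relations[OF joint_relations_subset _ that(2,3)]) auto
  thus "f ` (\<Union>i\<in>{i. n \<le> i \<and> Suc i < N}. relations k T q i ?J)
      \<subseteq> fs.span (\<Union>i\<in>{i. n \<le> i \<and> Suc i < N}. relations k T' q i (joint_relations k T' q M' n))"
    by (intro subset_trans[OF _ fs.span_superset]) blast
qed

end

locale operator_retract =
  f: operator_hom N T M T' X f + g: operator_hom N T' X T M g
  for N and T :: "nat \<Rightarrow> ('a \<Rightarrow> 'k::field) \<Rightarrow> 'a \<Rightarrow> 'k" and M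
    and T' :: "nat \<Rightarrow> ('b \<Rightarrow> 'k) \<Rightarrow> 'b \<Rightarrow> 'k" and X f g +
  assumes retract: "m \<in> M \<Longrightarrow> g (f m) = m"
begin

lemma joint_relations_eq_image:
  assumes n: "n \<le> N"
  shows "joint_relations k T q M n = g ` joint_relations k T' q X n"
proof (intro equalityI subsetI)
  fix m assume m: "m \<in> joint_relations k T q M n"
  hence "m = g (f m)"
    using joint_relations_subset retract by (metis subsetD)
  thus "m \<in> g ` joint_relations k T' q X n"
    using f.maps_joint_relations[OF n m] by (rule image_eqI)
qed (use g.maps_joint_relations[OF n] in blast)

lemma relation_span_eq_preimage:
  "relation_span k T q M N n = {m \<in> M. f m \<in> relation_span k T' q X N n}"
  using f.maps_relation_span f.source.relation_span_subset g.maps_relation_span retract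
  by (auto dest: g.maps_relation_span simp: subset_iff)

lemma koszul_exact:
  assumes ex: "koszul_exact k T' q X N"
  shows "koszul_exact k T q M N"
  unfolding koszul_exact_def
proof (intro allI impI subsetI)
  fix n x assume n: "n < N" and x: "x \<in> joint_relations k T q M (Suc n) \<inter> relation_span k T q M N n"
  have xM: "x \<in> M"
    using x joint_relations_subset by blast
  have "f x \<in> joint_relations k T' q X (Suc n) \<inter> relation_span k T' q X N n"
    using x n f.maps_joint_relations f.maps_relation_span by auto
  hence fx: "f x \<in> (if Suc n = N then {0}
      else joint_relations k T' q X (Suc (Suc n)) + relation_span k T' q X N (Suc n))"
    using ex n unfolding koszul_exact_def by blast
  show "x \<in> (if Suc n = N then {0}
      else joint_relations k T q M (Suc (Suc n)) + relation_span k T q M N (Suc n))"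
  proof (cases "Suc n = N")
    case True
    thus ?thesis
      using fx retract[OF xM] g.zero by simp
  next
    case False
    then obtain y z where yz: "f x = y + z" "y \<in> joint_relations k T' q X (Suc (Suc n))"
      "z \<in> relation_span k T' q X N (Suc n)"
      using fx by (auto elim: set_plus_elim)
    have "y \<in> X" "z \<in> X"
      using yz(2,3) joint_relations_subset f.target.relation_span_subset by blast+
    hence "x = g y + g z"
      using retract[OF xM] yz(1) by (simp add: g.add)
    thus ?thesis
      using False n yz g.maps_joint_relations g.maps_relation_span by (auto intro!: set_plus_intro)
  qed
qed

end

lemma operator_retract_cong:
  assumes "operator_retract N T M T1 X f g" "operator_module N T2 X" "\<And>i x. x \<in> X \<Longrightarrow> T1 i x = T2 i x"
  shows "operator_retract N T M T2 X f g"
  using assms unfolding operator_retract_def operator_retract_axioms_def operator_hom_def operator_hom_axioms_def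
  by auto

section \<open>Direct sums\<close>

definition projection :: "'a::ab_group_add set \<Rightarrow> 'a set \<Rightarrow> 'a \<Rightarrow> 'a" where
  "projection A B x = (THE a. a \<in> A \<and> x - a \<in> B)"

lemma projection_add:
  fixes A B :: "('a \<Rightarrow> 'k::field) set"
  assumes A: "fs.subspace A" and B: "fs.subspace B" and int: "A \<inter> B = {0}" and ab: "a \<in> A" "b \<in> B"
  shows "projection A B (a + b) = a"
  unfolding projection_def
proof (rule the_equality)
  fix a' assume a': "a' \<in> A \<and> a + b - a' \<in> B"
  have "a - a' = (a + b - a') - b"
    by simp
  hence "a - a' \<in> A \<inter> B"
    using a' ab fs.subspace_diff[OF A] fs.subspace_diff[OF B] by (metis IntI)
  thus "a' = a"
    using int by simp
qed (use ab in simp)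

locale operator_direct_sum =
  M1: operator_module N T M1 + M2: operator_module N T M2
  for N and T :: "nat \<Rightarrow> ('a \<Rightarrow> 'k::field) \<Rightarrow> 'a \<Rightarrow> 'k" and M1 M2 +
  assumes Int_eq: "M1 \<inter> M2 = {0}"
begin

lemma op_add: "T i (x + y) = T i x + T i y"
  using M1.linear_op[of i] unfolding Vector_Spaces.linear_iff by blast

sublocale sum: operator_module N T "M1 + M2"
  by (rule operator_module.intro)
    (auto elim!: set_plus_elim simp: op_add
      intro!: M1.linear_op fs.subspace_set_plus M1.subspace M2.subspace set_plus_intro M1.stable M2.stable)

lemma operator_hom_projection: "operator_hom N T (M1 + M2) T M1 (projection M1 M2)"
proof unfold_locales
  let ?p = "projection M1 M2"
  note p = projection_add[OF M1.subspace M2.subspace Int_eq]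
  show "?p m \<in> M1" if "m \<in> M1 + M2" for m
    using that by (auto elim!: set_plus_elim simp: p)
  show "?p (x + y) = ?p x + ?p y" if "x \<in> M1 + M2" "y \<in> M1 + M2" for x y
  proof -
    obtain a b where "a \<in> M1" "b \<in> M2" "x = a + b"
      using \<open>x \<in> M1 + M2\<close> by (rule set_plus_elim)
    moreover obtain c d where "c \<in> M1" "d \<in> M2" "y = c + d"
      using \<open>y \<in> M1 + M2\<close> by (rule set_plus_elim)
    moreover have "?p ((a + c) + (b + d)) = a + c" if "a \<in> M1" "b \<in> M2" "c \<in> M1" "d \<in> M2" for a b c d
      using that by (intro p fs.subspace_add M1.subspace M2.subspace)
    ultimately show ?thesis
      by (simp only: p add.assoc add.left_commute)
  qed
  show "?p (sc c m) = sc c (?p m)" if "m \<in> M1 + M2" for c m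
    using that
    by (auto elim!: set_plus_elim simp: p fs.scale_right_distrib fs.subspace_scale M1.subspace M2.subspace)
  show "?p (T i m) = T i (?p m)" if "m \<in> M1 + M2" "Suc i < N" for i m
    using that by (auto elim!: set_plus_elim simp: p op_add M1.stable M2.stable)
qed

lemma flip: "operator_direct_sum N T M2 M1"
  by unfold_locales (use Int_eq in blast)

lemma projection_sum:
  assumes "m \<in> M1 + M2"
  shows "projection M1 M2 m + projection M2 M1 m = m"
proof -
  obtain a b where ab: "a \<in> M1" "b \<in> M2" "m = a + b"
    using assms by (rule set_plus_elim)
  moreover have "M2 \<inter> M1 = {0}"
    using Int_eq by blast
  ultimately show ?thesis
    using projection_add[OF M1.subspace M2.subspace Int_eq ab(1,2)]
      projection_add[OF M2.subspace M1.subspace _ ab(2,1)] by (simp add: add.commute)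
qed

lemma subset_sum: "M1 \<subseteq> M1 + M2" "M2 \<subseteq> M1 + M2"
  using set_zero_plus2[of M2 M1] set_zero_plus2[of M1 M2] fs.subspace_0 M1.subspace M2.subspace
  by (auto simp: add.commute)

lemma in_sum_of_projections:
  assumes "x \<in> M1 + M2" "projection M1 M2 x \<in> S1" "projection M2 M1 x \<in> S2"
  shows "x \<in> S1 + S2"
  using set_plus_intro[OF assms(2,3)] projection_sum[OF assms(1)] by simp

interpretation p1: operator_hom N T "M1 + M2" T M1 "projection M1 M2"
  by (rule operator_hom_projection)

interpretation p2: operator_hom N T "M1 + M2" T M2 "projection M2 M1"
  using operator_direct_sum.operator_hom_projection[OF flip] by (simp add: add.commute)

lemma subspace_eq_set_plus:
  assumes S: "fs.subspace S" "S \<subseteq> M1 + M2" and sub: "S1 \<subseteq> S" "S2 \<subseteq> S"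
    and p: "projection M1 M2 ` S \<subseteq> S1" "projection M2 M1 ` S \<subseteq> S2"
  shows "S = S1 + S2"
proof (intro equalityI subsetI)
  fix x assume x: "x \<in> S"
  show "x \<in> S1 + S2"
    by (rule in_sum_of_projections) (use x S(2) p in blast)+
qed (use fs.subspace_add[OF S(1)] sub in \<open>auto elim!: set_plus_elim\<close>)

lemma joint_relations_sum:
  "n \<le> N \<Longrightarrow> joint_relations k T q (M1 + M2) n = joint_relations k T q M1 n + joint_relations k T q M2 n"
  using p1.maps_joint_relations p2.maps_joint_relations
  by (intro subspace_eq_set_plus sum.subspace_joint_relations joint_relations_subset joint_relations_mono
      subset_sum) auto

lemma relation_span_sum:
  "relation_span k T q (M1 + M2) N n = relation_span k T q M1 N n + relation_span k T q M2 N n"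
  using p1.maps_relation_span p2.maps_relation_span
  by (intro subspace_eq_set_plus subspace_relation_span sum.relation_span_subset relation_span_mono
      subset_sum) auto

lemma koszul_exact_sum:
  assumes ex: "koszul_exact k T q M1 N" "koszul_exact k T q M2 N"
  shows "koszul_exact k T q (M1 + M2) N"
  unfolding koszul_exact_def
proof (intro allI impI subsetI)
  fix n x
  let ?J = "\<lambda>M. joint_relations k T q M" and ?Z = "\<lambda>M. relation_span k T q M N"
  let ?B = "\<lambda>M. if Suc n = N then {0} else ?J M (Suc (Suc n)) + ?Z M (Suc n)"
  assume n: "n < N" and x: "x \<in> ?J (M1 + M2) (Suc n) \<inter> ?Z (M1 + M2) n"
  have "projection M1 M2 x \<in> ?J M1 (Suc n) \<inter> ?Z M1 n"
    and "projection M2 M1 x \<in> ?J M2 (Suc n) \<inter> ?Z M2 n"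
    using x n p1.maps_joint_relations p1.maps_relation_span p2.maps_joint_relations p2.maps_relation_span
    by auto
  hence "projection M1 M2 x \<in> ?B M1" "projection M2 M1 x \<in> ?B M2"
    using ex n unfolding koszul_exact_def by blast+
  moreover have "x \<in> M1 + M2"
    using x joint_relations_subset by blast
  ultimately have "x \<in> ?B M1 + ?B M2"
    by (rule in_sum_of_projections[rotated])
  thus "x \<in> ?B (M1 + M2)"
    using n by (simp add: joint_relations_sum relation_span_sum ac_simps split: if_splits)
qed

end

text \<open>Unlike exactness, the equality of the dimensions of invariants and coinvariants is not induced by a natural
  isomorphism, so it has to be carried along the decomposition into indecomposables.\<close>
definition koszul_balanced ::
  "nat \<Rightarrow> (nat \<Rightarrow> ('a \<Rightarrow> 'k::field) \<Rightarrow> 'a \<Rightarrow> 'k) \<Rightarrow> 'k \<Rightarrow> ('a \<Rightarrow> 'k) set \<Rightarrow> bool" where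
  "koszul_balanced N T q M \<longleftrightarrow> (\<forall>k. koszul_exact k T q M N) \<and>
     fs.dim (joint_relations Skew T q M N) + fs.dim (relation_span Sym T q M N 0) = fs.dim M"

lemma (in operator_direct_sum) koszul_balanced_sum:
  assumes fin: "fs.fin_dim M1" "fs.fin_dim M2"
    and balanced: "koszul_balanced N T q M1" "koszul_balanced N T q M2"
  shows "koszul_balanced N T q (M1 + M2)"
proof -
  have dim_sum: "fs.dim (S1 + S2) = fs.dim S1 + fs.dim S2"
    if "fs.subspace S1" "fs.subspace S2" "S1 \<subseteq> M1" "S2 \<subseteq> M2" for S1 S2
  proof (rule fs.dim_direct_sum)
    show "S1 \<inter> S2 = {0}"
      using that Int_eq fs.subspace_0[of S1] fs.subspace_0[of S2] by blast
  qed (use that fin fs.fin_dim_subset in blast)+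
  show ?thesis
    using balanced unfolding koszul_balanced_def
    by (simp add: koszul_exact_sum joint_relations_sum relation_span_sum dim_sum joint_relations_subset
        subspace_relation_span M1.subspace_joint_relations M2.subspace_joint_relations
        M1.relation_span_subset M2.relation_span_subset M1.subspace M2.subspace)
qed

lemma operator_module_zero: "(\<And>i. linear_map (T i)) \<Longrightarrow> operator_module N T {0}"
  by (rule operator_module.intro) (auto simp: linear_iff_module_hom dest: module_hom.zero)

lemma koszul_balanced_zero:
  assumes "\<And>i. linear_map (T i)"
  shows "koszul_balanced N T q {0}"
proof -
  interpret operator_module N T "{0}"
    using assms by (rule operator_module_zero)
  have J: "joint_relations k T q {0} n = {0}" for k n
    using joint_relations_subset fs.subspace_0[OF subspace_joint_relations] by blast
  have "relation_span k T q {0} N n = {0}" for k n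
    using relation_span_subset fs.subspace_0[OF subspace_relation_span] by blast
  thus ?thesis
    unfolding koszul_balanced_def koszul_exact_def J by simp
qed

section \<open>The Euler characteristic\<close>

lemma alternating_sum_telescope:
  fixes f z k :: "nat \<Rightarrow> int"
  assumes step: "\<And>n. n < N \<Longrightarrow> k n + k (Suc n) = f (Suc n) + z n" and "k 0 = f 0" "k N = 0" "z N = 0"
  shows "(\<Sum>n\<le>N. (-1) ^ n * (f n - z n)) = 0"
proof -
  have "(\<Sum>n\<le>j. (-1) ^ n * (f n - z n)) = (-1) ^ j * (k j - z j)" if "j \<le> N" for j
    using that
  proof (induction j)
    case (Suc j)
    have "f (Suc j) = k j + k (Suc j) - z j"
      using step[of j] Suc.prems by simp
    moreover have "(\<Sum>n\<le>Suc j. (-1) ^ n * (f n - z n))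
        = (-1) ^ j * (k j - z j) + (-1) ^ Suc j * (f (Suc j) - z (Suc j))"
      using Suc by simp
    ultimately show ?case
      by (simp only: power_Suc) (simp add: algebra_simps)
  qed (use assms in simp)
  thus ?thesis
    using assms by simp
qed

context operator_module
begin

lemma relation_span_Skew_subset: "relation_span Skew T q M N n \<subseteq> joint_relations Skew T q M n"
  unfolding relation_span_def by (rule fs.span_minimal[OF _ subspace_joint_relations]) (auto simp: relations_def)

lemma joint_relations_Skew_subset:
  assumes "Suc n < N"
  shows "joint_relations Skew T q M (Suc (Suc n)) \<subseteq> relation_span Skew T q M N n"
proof -
  have "joint_relations Skew T q M (Suc (Suc n)) \<subseteq> relations Skew T q n (joint_relations Skew T q M n)"
    by (auto simp: joint_relations_def relations_def)
  thus ?thesis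
    using relations_subset_relation_span[of n n N Skew T q M] assms by simp
qed

definition koszul_cycles :: "'k \<Rightarrow> nat \<Rightarrow> ('a \<Rightarrow> 'k) set" where
  "koszul_cycles q n = (case n of 0 \<Rightarrow> M
    | Suc m \<Rightarrow> joint_relations Skew T q M (Suc m) \<inter> relation_span Skew T q M N m)"

lemma koszul_cycles_eq_set_plus:
  assumes ex: "koszul_exact Skew T q M N" and n: "n < N"
  shows "koszul_cycles q n = joint_relations Skew T q M (Suc n) + relation_span Skew T q M N n" (is "_ = ?J + ?Z")
proof
  show "koszul_cycles q n \<subseteq> ?J + ?Z"
  proof (cases n)
    case 0
    thus ?thesis
      using set_zero_plus2[OF fs.subspace_0[OF subspace_relation_span], of M Skew T q M N 0]
      by (simp add: koszul_cycles_def joint_relations_le_1 add.commute[of M])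
  next
    case (Suc m)
    thus ?thesis
      using ex[unfolded koszul_exact_def, rule_format, of m] n by (simp add: koszul_cycles_def)
  qed
  have J: "?J \<subseteq> koszul_cycles q n"
    using joint_relations_Skew_subset n joint_relations_antimono[of n "Suc n" Skew T q M]
      joint_relations_subset[of Skew T q M "Suc n"]
    by (auto simp: koszul_cycles_def split: nat.split)
  have Z: "?Z \<subseteq> koszul_cycles q n"
    using relation_span_Skew_subset relation_span_antimono[of "n - 1" n Skew T q M N] relation_span_subset
    by (auto simp: koszul_cycles_def split: nat.split)
  have "fs.subspace (koszul_cycles q n)"
    by (auto simp: koszul_cycles_def subspace subspace_joint_relations subspace_relation_span
        intro: fs.subspace_inter split: nat.split)
  with J Z show "?J + ?Z \<subseteq> koszul_cycles q n"
    by (auto elim!: set_plus_elim intro: fs.subspace_add)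
qed

lemma koszul_cycles_top:
  assumes ex: "koszul_exact Skew T q M N" and N: "N > 0"
  shows "koszul_cycles q N = {0}"
proof -
  obtain m where m: "Suc m = N"
    using N by (cases N) auto
  have cycles: "koszul_cycles q N = joint_relations Skew T q M N \<inter> relation_span Skew T q M N m"
    unfolding koszul_cycles_def by (simp split: nat.split flip: m)
  moreover have "\<dots> \<subseteq> {0}"
    using ex[unfolded koszul_exact_def, rule_format, of m] m by simp
  moreover have "0 \<in> koszul_cycles q N"
    unfolding cycles using fs.subspace_0[OF subspace_joint_relations] fs.subspace_0[OF subspace_relation_span] by simp
  ultimately show ?thesis
    by blast
qed

lemma euler_characteristic_eq_0:
  assumes fin: "fs.fin_dim M" and N: "N > 0" and ex: "koszul_exact Skew T q M N"
  shows "(\<Sum>n\<le>N. (-1) ^ n * (int (fs.dim (joint_relations Skew T q M n))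
      - int (fs.dim (relation_span Skew T q M N n)))) = 0"
proof (rule alternating_sum_telescope[where k = "\<lambda>n. int (fs.dim (koszul_cycles q n))"])
  fix n assume n: "n < N"
  have "fs.dim (koszul_cycles q n) + fs.dim (koszul_cycles q (Suc n))
      = fs.dim (joint_relations Skew T q M (Suc n)) + fs.dim (relation_span Skew T q M N n)"
    unfolding koszul_cycles_eq_set_plus[OF ex n]
    using fs.fin_dim_subset[OF fin joint_relations_subset] fs.fin_dim_subset[OF fin relation_span_subset]
    by (simp add: koszul_cycles_def fs.dim_set_plus_Int subspace_joint_relations subspace_relation_span)
  thus "int (fs.dim (koszul_cycles q n)) + int (fs.dim (koszul_cycles q (Suc n)))
      = int (fs.dim (joint_relations Skew T q M (Suc n))) + int (fs.dim (relation_span Skew T q M N n))"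
    by linarith
qed (simp_all add: koszul_cycles_top[OF ex N] relation_span_top koszul_cycles_def[of _ 0] joint_relations_le_1)

end

section \<open>Words\<close>

definition swap_at :: "nat \<Rightarrow> nat list \<Rightarrow> nat list" where
  "swap_at i w = w[i := w ! Suc i, Suc i := w ! i]"

abbreviation arrangements :: "nat multiset \<Rightarrow> nat list set" where
  "arrangements \<equiv> permutations_of_multiset"

abbreviation sorted_word :: "nat multiset \<Rightarrow> nat list" where
  "sorted_word \<equiv> sorted_list_of_multiset"

lemma split_at_adjacent:
  assumes "Suc i < length w"
  obtains s a b t where "w = s @ a # b # t" "length s = i"
proof -
  have "w = take i w @ w ! i # w ! Suc i # drop (Suc (Suc i)) w"
    using assms by (simp add: Cons_nth_drop_Suc)
  thus thesis
    using that[of "take i w"] assms by simp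
qed

lemma bubble_induct [case_names sorted swap]:
  fixes l :: "nat list"
  assumes sorted: "\<And>l. sorted l \<Longrightarrow> P l"
    and swap: "\<And>s a b t. a < b \<Longrightarrow> P (s @ a # b # t) \<Longrightarrow> P (s @ b # a # t)"
  shows "P l"
proof (induction l rule: wf_induct[OF wf_lex[OF wf_less_than]])
  case (1 l)
  show ?case
  proof (cases "sorted l")
    case False
    then obtain i where i: "Suc i < length l" "l ! Suc i < l ! i"
      by (auto simp: sorted_iff_nth_Suc not_le)
    obtain s b a t where l: "l = s @ b # a # t" "length s = i"
      using split_at_adjacent[OF i(1)] .
    have less: "a < b"
      using i(2) l by (auto simp: nth_append)
    have "(s @ a # b # t, l) \<in> lex less_than"
      unfolding lex_conv l(1) using less by auto
    hence "P (s @ a # b # t)"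
      using 1 by blast
    thus ?thesis
      unfolding l(1) by (rule swap[OF less])
  qed (rule sorted)
qed

lemma swap_at_append: "length s = i \<Longrightarrow> swap_at i (s @ a # b # t) = s @ b # a # t"
  by (auto simp: swap_at_def nth_append list_update_append)

lemma length_swap_at [simp]: "length (swap_at i w) = length w"
  by (simp add: swap_at_def)

lemma mset_swap_at: "Suc i < length w \<Longrightarrow> mset (swap_at i w) = mset w"
  by (erule split_at_adjacent) (simp add: swap_at_append)

lemma swap_at_swap_at: "Suc i < length w \<Longrightarrow> swap_at i (swap_at i w) = w"
  by (erule split_at_adjacent) (simp add: swap_at_append)

lemma nth_swap_at:
  "Suc i < length w \<Longrightarrow> swap_at i w ! i = w ! Suc i"
  "Suc i < length w \<Longrightarrow> swap_at i w ! Suc i = w ! i"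
  "j \<noteq> i \<Longrightarrow> j \<noteq> Suc i \<Longrightarrow> swap_at i w ! j = w ! j"
  by (auto simp: swap_at_def)

lemma swap_at_commute: "Suc i < j \<Longrightarrow> swap_at i (swap_at j w) = swap_at j (swap_at i w)"
  by (simp add: swap_at_def list_update_swap[of j i] list_update_swap[of "Suc j" i]
    list_update_swap[of j "Suc i"] list_update_swap[of "Suc j" "Suc i"])

lemma mset_take_add_drop: "mset (take n w) + mset (drop n w) = mset w"
  by (simp flip: mset_append)

lemma sorted_eq_sorted_word: "sorted w \<Longrightarrow> w = sorted_word (mset w)"
  by (simp add: sorted_sort_id)

lemma sum_arrangements_swap:
  fixes h :: "nat list \<Rightarrow> 'b::comm_monoid_add"
  assumes i: "Suc i < size m"
  shows "(\<Sum>v\<in>arrangements m. h v) = (\<Sum>v | v \<in> arrangements m \<and> v ! i < v ! Suc i. h v + h (swap_at i v))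
    + (\<Sum>v | v \<in> arrangements m \<and> v ! i = v ! Suc i. h v)"
proof -
  let ?W = "arrangements m"
  let ?A = "{v. v \<in> ?W \<and> v ! i < v ! Suc i}" and ?B = "{v. v \<in> ?W \<and> v ! Suc i < v ! i}"
    and ?C = "{v. v \<in> ?W \<and> v ! i = v ! Suc i}"
  have length: "Suc i < length v" if "v \<in> ?W" for v
    using that i by (auto simp: permutations_of_multiset_def)
  have "?W = (?A \<union> ?B) \<union> ?C"
    by auto
  hence "sum h ?W = sum h ((?A \<union> ?B) \<union> ?C)"
    by simp
  also have "\<dots> = sum h (?A \<union> ?B) + sum h ?C"
    by (rule sum.union_disjoint) auto
  also have "sum h (?A \<union> ?B) = sum h ?A + sum h ?B"
    by (rule sum.union_disjoint) auto
  also have "sum h ?B = sum (\<lambda>v. h (swap_at i v)) ?A"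
    by (rule sum.reindex_bij_witness[of _ "swap_at i" "swap_at i"])
      (use length in \<open>auto simp: swap_at_swap_at nth_swap_at mset_swap_at permutations_of_multiset_def\<close>)
  finally show ?thesis
    by (simp add: sum.distrib)
qed

section \<open>Permutation supermodules\<close>

text \<open>The standard \<open>q\<close>-permutation supermodule: \<open>T (e_a e_b) = e_b e_a\<close> and
  \<open>T (e_b e_a) = q e_a e_b + (q - 1) e_b e_a\<close> for \<open>a < b\<close>, written on coefficient functions. The letter \<open>c\<close> is
  even if \<open>\<chi> c = q\<close> and odd if \<open>\<chi> c = -1\<close>.\<close>
definition super_op :: "'k::field \<Rightarrow> (nat \<Rightarrow> 'k) \<Rightarrow> nat \<Rightarrow> (nat list \<Rightarrow> 'k) \<Rightarrow> nat list \<Rightarrow> 'k" where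
  "super_op q \<chi> i x w = (if Suc i < length w then
      if w ! i = w ! Suc i then \<chi> (w ! i) * x w
      else if w ! i < w ! Suc i then q * x (swap_at i w) else x (swap_at i w) + (q - 1) * x w else 0)"

abbreviation weight_space :: "nat multiset \<Rightarrow> (nat list \<Rightarrow> 'k::field) set" where
  "weight_space L \<equiv> supp_in (arrangements L)"

lemma super_op_append:
  "length s = i \<Longrightarrow> super_op q \<chi> i x (s @ a # b # t) =
     (if a = b then \<chi> a * x (s @ a # b # t) else if a < b then q * x (s @ b # a # t)
      else x (s @ b # a # t) + (q - 1) * x (s @ a # b # t))"
  by (auto simp: super_op_def swap_at_append nth_append)

lemma weight_space_iff: "x \<in> weight_space L \<longleftrightarrow> (\<forall>w. mset w \<noteq> L \<longrightarrow> x w = 0)"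
  by (auto simp: supp_in_def permutations_of_multiset_def)

lemma weight_space_ext:
  assumes "x \<in> weight_space L" "y \<in> weight_space L" "\<And>w. mset w = L \<Longrightarrow> x w = y w"
  shows "x = y"
  using assms unfolding weight_space_iff by (intro ext) metis

lemma super_op_in_weight_space: "x \<in> weight_space L \<Longrightarrow> super_op q \<chi> i x \<in> weight_space L"
  by (auto simp: weight_space_iff super_op_def mset_swap_at)

lemma linear_map_super_op: "linear_map (super_op q \<chi> i)"
  by (rule linear_mapI) (auto simp: super_op_def sc_def fun_eq_iff algebra_simps)

lemma operator_module_weight_space: "operator_module N (super_op q \<chi>) (weight_space L)"
  by (rule operator_module.intro) (auto simp: linear_map_super_op subspace_supp_in super_op_in_weight_space)

lemma super_op_delta_append:
  fixes q :: "'k::field"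
  assumes l: "length l = i"
  shows "super_op q \<chi> i (delta (l @ a # b # t)) = (if a = b then sc (\<chi> a) (delta (l @ a # b # t))
    else if a < b then delta (l @ b # a # t)
    else sc q (delta (l @ b # a # t)) + sc (q - 1) (delta (l @ a # b # t)))" (is "?L = ?R")
proof (rule weight_space_ext)
  let ?m = "mset (l @ a # b # t)"
  have delta: "(delta (l @ a # b # t) :: nat list \<Rightarrow> 'k) \<in> weight_space ?m"
    "(delta (l @ b # a # t) :: nat list \<Rightarrow> 'k) \<in> weight_space ?m"
    by (auto intro!: delta_in_supp_in simp: permutations_of_multiset_def)
  show "?L \<in> weight_space ?m"
    using delta(1) by (rule super_op_in_weight_space)
  show "?R \<in> weight_space ?m"
    by (simp only: delta fs.subspace_add[OF subspace_supp_in] fs.subspace_scale[OF subspace_supp_in] split: if_split)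
      simp
  fix w assume "mset w = ?m"
  hence "Suc i < length w"
    using l by (metis size_mset length_append length_Cons add_Suc_right less_add_Suc1 add_Suc)
  then obtain s c e u where w: "w = s @ c # e # u" "length s = i"
    by (rule split_at_adjacent)
  show "?L w = ?R w"
    unfolding w(1) using w(2) l by (auto simp: super_op_append sc_def delta_def)
qed

lemma super_op_delta:
  assumes "Suc i < length u"
  shows "super_op q \<chi> i (delta u) = (if u ! i = u ! Suc i then sc (\<chi> (u ! i)) (delta u)
    else if u ! i < u ! Suc i then delta (swap_at i u)
    else sc q (delta (swap_at i u)) + sc (q - 1) (delta u))"
  using assms by (rule split_at_adjacent) (simp add: super_op_delta_append swap_at_append nth_append)

section \<open>The swap rule\<close>

definition swap_rule :: "'k::comm_ring_1 \<Rightarrow> nat set \<Rightarrow> nat \<Rightarrow> (nat list \<Rightarrow> 'k) \<Rightarrow> bool" where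
  "swap_rule \<alpha> Y i x \<longleftrightarrow> (\<forall>w. Suc i < length w \<longrightarrow> (w ! i < w ! Suc i \<longrightarrow> x w = \<alpha> * x (swap_at i w))
      \<and> (w ! i = w ! Suc i \<and> w ! i \<in> Y \<longrightarrow> x w = 0))"

lemma swap_rule_iff_append:
  "swap_rule \<alpha> Y i x \<longleftrightarrow> (\<forall>s t a b. length s = i \<longrightarrow>
      (a < b \<longrightarrow> x (s @ a # b # t) = \<alpha> * x (s @ b # a # t)) \<and> (a = b \<and> a \<in> Y \<longrightarrow> x (s @ a # b # t) = 0))"
  (is "?L \<longleftrightarrow> ?R")
proof
  assume L: ?L
  show ?R
  proof (intro allI impI)
    fix s t :: "nat list" and a b assume "length s = i"
    thus "(a < b \<longrightarrow> x (s @ a # b # t) = \<alpha> * x (s @ b # a # t)) \<and> (a = b \<and> a \<in> Y \<longrightarrow> x (s @ a # b # t) = 0)"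
      using L[unfolded swap_rule_def, rule_format, of "s @ a # b # t"] by (auto simp: swap_at_append nth_append)
  qed
next
  assume R: ?R
  show ?L
    unfolding swap_rule_def
  proof (intro allI impI)
    fix w :: "nat list" assume "Suc i < length w"
    then obtain s a b t where w: "w = s @ a # b # t" "length s = i"
      by (rule split_at_adjacent)
    thus "(w ! i < w ! Suc i \<longrightarrow> x w = \<alpha> * x (swap_at i w)) \<and> (w ! i = w ! Suc i \<and> w ! i \<in> Y \<longrightarrow> x w = 0)"
      using R[rule_format, of s a b t] by (auto simp: swap_at_append nth_append)
  qed
qed

lemma swap_rule_append:
  assumes "swap_rule \<alpha> Y i x" "length s = i"
  shows "a < b \<Longrightarrow> x (s @ a # b # t) = \<alpha> * x (s @ b # a # t)" "a \<in> Y \<Longrightarrow> x (s @ a # a # t) = 0"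
  using assms unfolding swap_rule_iff_append by blast+

lemma swap_rule_left_slice: "swap_rule \<alpha> Y i x \<Longrightarrow> swap_rule \<alpha> Y i (\<lambda>u. x (u @ v))"
  by (auto simp: swap_rule_iff_append)

lemma swap_rule_right_slice: "swap_rule \<alpha> Y (length u + i) x \<Longrightarrow> swap_rule \<alpha> Y i (\<lambda>v. x (u @ v))"
  by (auto simp: swap_rule_iff_append simp flip: append_assoc)

lemma swap_rule_local_op:
  assumes x: "swap_rule \<alpha> Y j x" and j: "Suc j < i"
    and y: "\<And>w. y w = (if Suc i < length w
      then F (w ! i) (w ! Suc i) * x w + G (w ! i) (w ! Suc i) * x (swap_at i w) else 0)"
  shows "swap_rule \<alpha> Y j y"
proof -
  have "swap_at j w ! i = w ! i" "swap_at j w ! Suc i = w ! Suc i"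
    "swap_at i w ! j = w ! j" "swap_at i w ! Suc j = w ! Suc j" for w
    using j by (simp_all add: nth_swap_at)
  thus ?thesis
    using x by (auto simp: swap_rule_def y swap_at_commute[OF j, symmetric] algebra_simps)
qed

definition swap_rule_space :: "'k::field \<Rightarrow> nat set \<Rightarrow> nat multiset \<Rightarrow> nat \<Rightarrow> (nat list \<Rightarrow> 'k) set" where
  "swap_rule_space \<alpha> Y L n = {x \<in> weight_space L. \<forall>i. Suc i < n \<longrightarrow> swap_rule \<alpha> Y i x}"

lemma swap_rule_spaceD:
  "x \<in> swap_rule_space \<alpha> Y L n \<Longrightarrow> x \<in> weight_space L"
  "x \<in> swap_rule_space \<alpha> Y L n \<Longrightarrow> Suc i < n \<Longrightarrow> swap_rule \<alpha> Y i x"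
  unfolding swap_rule_space_def by blast+

lemma swap_rule_space_local_op:
  fixes x :: "nat list \<Rightarrow> 'k::field"
  assumes x: "x \<in> swap_rule_space \<alpha> Y L n" and n: "n \<le> i"
    and y: "\<And>w. y w = (if Suc i < length w
      then F (w ! i) (w ! Suc i) * x w + G (w ! i) (w ! Suc i) * x (swap_at i w) else 0)"
  shows "y \<in> swap_rule_space \<alpha> Y L n"
proof -
  have "y \<in> weight_space L"
    using swap_rule_spaceD(1)[OF x] by (auto simp: weight_space_iff y mset_swap_at)
  moreover have "swap_rule \<alpha> Y j y" if "Suc j < n" for j
    by (rule swap_rule_local_op[OF swap_rule_spaceD(2)[OF x that] _ y]) (use that n in simp)
  ultimately show ?thesis
    by (simp add: swap_rule_space_def)
qed

section \<open>Relations in a weight space\<close>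

text \<open>\<open>- twist k q\<close> is the coefficient by which letters are exchanged in the quadratic algebra of kind \<open>k\<close>, and
  \<open>repeatable k q \<chi>\<close> are the letters with nonzero square there.\<close>
definition twist :: "kind \<Rightarrow> 'k::field \<Rightarrow> 'k" where
  "twist k q = (case k of Sym \<Rightarrow> - q | Skew \<Rightarrow> 1)"

definition repeatable :: "kind \<Rightarrow> 'k::field \<Rightarrow> (nat \<Rightarrow> 'k) \<Rightarrow> nat set" where
  "repeatable k q \<chi> = (case k of Sym \<Rightarrow> {c. \<chi> c = q} | Skew \<Rightarrow> {c. \<chi> c \<noteq> q})"

lemma swap_rule_super_op_minus:
  "swap_rule (- q) {c. \<chi> c = q} i (super_op q \<chi> i x - sc q x)"
  unfolding swap_rule_iff_append by (auto simp: super_op_append sc_def algebra_simps)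

lemma super_op_minus_preimage:
  fixes q :: "'k::field"
  assumes x: "x \<in> swap_rule_space \<alpha> Y L n" and i: "n \<le> i" "Suc i < size L"
    and rule: "swap_rule (- q) {c. \<chi> c = q} i x"
  obtains y where "y \<in> swap_rule_space \<alpha> Y L n" "x = super_op q \<chi> i y - sc q y"
proof
  define y where "y w = (if Suc i < length w
    then (if w ! i = w ! Suc i then 1 / (\<chi> (w ! i) - q) else 0) * x w
      + (if w ! i < w ! Suc i then 1 else 0) * x (swap_at i w)
    else 0)" for w
  show y_in: "y \<in> swap_rule_space \<alpha> Y L n"
    by (rule swap_rule_space_local_op[OF x i(1)]) (rule y_def)
  note weight = swap_rule_spaceD(1)
  show "x = super_op q \<chi> i y - sc q y"
  proof (rule weight_space_ext[OF weight[OF x]])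
    show "super_op q \<chi> i y - sc q y \<in> weight_space L"
      using weight[OF y_in]
      by (intro fs.subspace_diff fs.subspace_scale subspace_supp_in super_op_in_weight_space)
    fix w assume "mset w = L"
    hence "Suc i < length w"
      using i by auto
    then obtain s a b t where w: "w = s @ a # b # t" "length s = i"
      by (rule split_at_adjacent)
    have y_append: "y (s @ a # b # t) = (if a = b then x (s @ a # b # t) / (\<chi> a - q)
        else if a < b then x (s @ b # a # t) else 0)" for a b
      using w(2) by (auto simp: y_def swap_at_append nth_append)
    show "x w = (super_op q \<chi> i y - sc q y) w"
    proof (cases "a = b")
      case True
      thus ?thesis
        unfolding w(1) using w(2) swap_rule_append(2)[OF rule w(2), of a t]
        by (cases "\<chi> a = q")
          (auto simp: super_op_append y_append sc_def simp flip: diff_divide_distrib left_diff_distrib)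
    next
      case False
      thus ?thesis
        unfolding w(1) using w(2) swap_rule_append(1)[OF rule w(2), of a b t]
        by (auto simp: super_op_append y_append sc_def)
    qed
  qed
qed

lemma super_op_eq_scale_iff:
  fixes q :: "'k::field"
  assumes x: "x \<in> weight_space L" and i: "Suc i < size L"
  shows "super_op q \<chi> i x = sc q x \<longleftrightarrow> swap_rule 1 {c. \<chi> c \<noteq> q} i x"
proof
  assume eigen: "super_op q \<chi> i x = sc q x"
  show "swap_rule 1 {c. \<chi> c \<noteq> q} i x"
    unfolding swap_rule_iff_append
  proof (intro allI impI)
    fix s t :: "nat list" and a b assume s: "length s = i"
    have "super_op q \<chi> i x (s @ b # a # t) = q * x (s @ b # a # t)"
      using eigen by (simp add: sc_def)
    thus "(a < b \<longrightarrow> x (s @ a # b # t) = 1 * x (s @ b # a # t)) \<and> (a = b \<and> a \<in> {c. \<chi> c \<noteq> q} \<longrightarrow> x (s @ a # b # t) = 0)"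
      using s by (auto simp: super_op_append algebra_simps)
  qed
next
  assume rule: "swap_rule 1 {c. \<chi> c \<noteq> q} i x"
  show "super_op q \<chi> i x = sc q x"
  proof (rule weight_space_ext)
    fix w assume "mset w = L"
    hence "Suc i < length w"
      using i by auto
    then obtain s a b t where w: "w = s @ a # b # t" "length s = i"
      by (rule split_at_adjacent)
    note append = swap_rule_append[OF rule w(2)]
    show "super_op q \<chi> i x w = sc q x w"
      unfolding w(1) using w(2) append(1)[of a b t] append(1)[of b a t] append(2)[of a t]
      by (auto simp: super_op_append sc_def algebra_simps)
  qed (use x in \<open>auto intro: super_op_in_weight_space fs.subspace_scale[OF subspace_supp_in]\<close>)
qed

lemma relations_swap_rule_space:
  fixes q :: "'k::field"
  assumes i: "n \<le> i" "Suc i < size L"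
  shows "relations k (super_op q \<chi>) q i (swap_rule_space \<alpha> Y L n) =
    {x \<in> swap_rule_space \<alpha> Y L n. swap_rule (twist k q) (repeatable k q \<chi>) i x}"
proof (cases k)
  case Sym
  have "super_op q \<chi> i y - sc q y \<in> swap_rule_space \<alpha> Y L n" if y: "y \<in> swap_rule_space \<alpha> Y L n" for y
  proof (rule swap_rule_space_local_op[OF y i(1)])
    fix w
    show "(super_op q \<chi> i y - sc q y) w = (if Suc i < length w
      then (if w ! i = w ! Suc i then \<chi> (w ! i) - q else if w ! i < w ! Suc i then - q else - 1) * y w
        + (if w ! i = w ! Suc i then 0 else if w ! i < w ! Suc i then q else 1) * y (swap_at i w) else 0)"
      using i swap_rule_spaceD(1)[OF y] by (auto simp: super_op_def sc_def weight_space_iff algebra_simps)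
  qed
  thus ?thesis
    using Sym swap_rule_super_op_minus[of q \<chi> i] super_op_minus_preimage[OF _ i, of _ \<alpha> Y q \<chi>]
    by (auto simp: relations_def twist_def repeatable_def) blast
next
  case Skew
  thus ?thesis
    using super_op_eq_scale_iff[OF swap_rule_spaceD(1) i(2), of _ \<alpha> Y n q \<chi>]
    by (simp add: relations_def twist_def repeatable_def cong: conj_cong)
qed

lemma joint_relations_weight_space:
  assumes "n \<le> size L"
  shows "joint_relations k (super_op q \<chi>) q (weight_space L) n =
    swap_rule_space (twist k q) (repeatable k q \<chi>) L n"
proof -
  have "swap_rule_space (twist k q) (repeatable k q \<chi>) L 0 = weight_space L"
    by (simp add: swap_rule_space_def)
  thus ?thesis
    using relations_swap_rule_space[of 0 _ L k q \<chi> "twist k q" "repeatable k q \<chi>"] assms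
    by (auto simp: joint_relations_def swap_rule_space_def)
qed

section \<open>Straightening\<close>

text \<open>Modulo the relations \<open>e_b e_a = \<beta> e_a e_b\<close> (\<open>a < b\<close>) and \<open>e_c e_c = 0\<close> (\<open>c \<notin> Y\<close>) a word \<open>v\<close> equals
  \<open>straightening \<beta> Y v\<close> times its sorted rearrangement; \<open>letter_coeff\<close> is the contribution of the first letter.\<close>
definition letter_coeff :: "'k::comm_ring_1 \<Rightarrow> nat set \<Rightarrow> nat \<Rightarrow> nat multiset \<Rightarrow> 'k" where
  "letter_coeff \<beta> Y c m = (if c \<in> Y \<or> c \<notin># m then \<beta> ^ size {#a \<in># m. a < c#} else 0)"

primrec straightening :: "'k::comm_ring_1 \<Rightarrow> nat set \<Rightarrow> nat list \<Rightarrow> 'k" where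
  "straightening \<beta> Y [] = 1"
| "straightening \<beta> Y (c # v) = letter_coeff \<beta> Y c (mset v) * straightening \<beta> Y v"

definition repeats_in :: "nat set \<Rightarrow> nat multiset \<Rightarrow> bool" where
  "repeats_in Y m \<longleftrightarrow> (\<forall>c. c \<notin> Y \<longrightarrow> count m c \<le> 1)"

lemma repeats_in_mono: "m \<subseteq># m' \<Longrightarrow> repeats_in Y m' \<Longrightarrow> repeats_in Y m"
  unfolding repeats_in_def by (meson le_trans mset_subset_eq_count)

lemma repeats_in_empty [simp]: "repeats_in Y {#}"
  by (simp add: repeats_in_def)

lemma repeats_in_UNIV [simp]: "repeats_in UNIV m"
  by (simp add: repeats_in_def)

lemma repeats_in_remove: "repeats_in Y m \<Longrightarrow> z \<in> Y \<or> z \<notin># m - {#z#}"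
  unfolding repeats_in_def not_in_iff by auto

lemma repeats_in_add_mset: "repeats_in Y (add_mset z m) \<Longrightarrow> z \<in> Y \<or> z \<notin># m"
  using repeats_in_remove[of Y "add_mset z m" z] by simp

lemma letter_coeff_le:
  assumes "\<And>a. a \<in># m \<Longrightarrow> c \<le> a"
  shows "letter_coeff \<beta> Y c m = (if c \<in> Y \<or> c \<notin># m then 1 else 0)"
proof -
  have "{#a \<in># m. a < c#} = {#}"
    using assms by (auto simp: filter_mset_eq_conv not_less)
  thus ?thesis
    by (simp only: letter_coeff_def size_empty power_0)
qed

lemma letter_coeff_add_less: "z < c \<Longrightarrow> letter_coeff \<beta> Y c (add_mset z m) = \<beta> * letter_coeff \<beta> Y c m"
  by (auto simp: letter_coeff_def)

lemma straightening_swap: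
  "a < b \<Longrightarrow> straightening \<beta> Y (s @ b # a # t) = \<beta> * straightening \<beta> Y (s @ a # b # t)"
proof (induction s)
  case (Cons c s)
  have "mset (s @ b # a # t) = mset (s @ a # b # t)"
    by simp
  thus ?case
    using Cons by (simp add: ac_simps del: mset_append)
qed (auto simp: letter_coeff_def)

lemma straightening_repeat: "c \<notin> Y \<Longrightarrow> straightening \<beta> Y (s @ c # c # t) = 0"
  by (induction s) (auto simp: letter_coeff_def)

lemma straightening_eq_0: "\<not> repeats_in Y (mset v) \<Longrightarrow> straightening \<beta> Y v = 0"
proof (induction v)
  case (Cons c v)
  show ?case
  proof (cases "c \<in> Y \<or> c \<notin> set v")
    case True
    hence "\<not> repeats_in Y (mset v)"
      using Cons.prems unfolding repeats_in_def by (auto split: if_splits)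
    thus ?thesis
      using Cons.IH by simp
  qed (simp add: letter_coeff_def)
qed (simp add: repeats_in_def)

lemma straightening_sorted: "sorted v \<Longrightarrow> repeats_in Y (mset v) \<Longrightarrow> straightening \<beta> Y v = 1"
proof (induction v)
  case (Cons c v)
  have "repeats_in Y (mset v)"
    using Cons.prems(2) by (rule repeats_in_mono[rotated]) simp
  moreover have "letter_coeff \<beta> Y c (mset v) = 1"
    using Cons.prems repeats_in_add_mset[of Y c "mset v"] by (subst letter_coeff_le) auto
  ultimately show ?case
    using Cons by simp
qed simp

lemma straightening_sorted_word: "repeats_in Y m \<Longrightarrow> straightening \<beta> Y (sorted_word m) = 1"
  by (simp add: straightening_sorted)

lemma straightening_one: "straightening 1 UNIV v = 1"
  by (induction v) (simp_all add: letter_coeff_def)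

lemma sorted_not_repeats_in:
  assumes "sorted l" "\<not> repeats_in Y (mset l)"
  obtains s c t where "l = s @ c # c # t" "c \<notin> Y"
proof -
  from assms have "\<exists>s c t. l = s @ c # c # t \<and> c \<notin> Y"
  proof (induction l)
    case (Cons a l)
    show ?case
    proof (cases "repeats_in Y (mset l)")
      case True
      then obtain c where c: "c \<notin> Y" "count (mset (a # l)) c > 1" "count (mset l) c \<le> 1"
        using Cons.prems(2) unfolding repeats_in_def by (auto simp: not_le simp del: mset.simps)
      hence a: "c = a" "a \<in> set l"
        by (auto split: if_splits simp: count_mset_0_iff[symmetric])
      then obtain b l' where l: "l = b # l'"
        by (cases l) auto
      have "b = a"
        using Cons.prems(1) a(2) l by force
      thus ?thesis
        using l c(1) a(1) by (intro exI[of _ "[]"]) auto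
    next
      case False
      then obtain s c t where "l = s @ c # c # t" "c \<notin> Y"
        using Cons by auto
      thus ?thesis
        by (intro exI[of _ "a # s"]) auto
    qed
  qed (simp add: repeats_in_def)
  thus thesis
    using that by blast
qed

lemma swap_rule_straightening:
  assumes rule: "\<And>i. Suc i < n \<Longrightarrow> swap_rule \<alpha> Y i f" and u: "length u = n"
  shows "f u = straightening \<alpha> (- Y) (rev u) * f (rev (sorted_word (mset u)))"
proof -
  have "length l = n \<Longrightarrow> f (rev l) = straightening \<alpha> (- Y) l * f (rev (sorted_word (mset l)))" for l
  proof (induction l rule: bubble_induct)
    case (sorted l)
    have l_eq: "sorted_word (mset l) = l"
      using sorted(1) by (simp add: sorted_sort_id)
    show ?case
    proof (cases "repeats_in (- Y) (mset l)")
      case True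
      thus ?thesis
        using straightening_sorted[OF sorted(1) True, of \<alpha>] l_eq by simp
    next
      case False
      then obtain s c t where l: "l = s @ c # c # t" "c \<in> Y"
        using sorted_not_repeats_in[OF sorted(1) False] by auto
      have "f (rev t @ c # c # rev s) = 0"
        using l sorted(2) by (intro swap_rule_append(2)[OF rule]) auto
      thus ?thesis
        using straightening_eq_0[OF False, of \<alpha>] l(1) by simp
    qed
  next
    case (swap s a b t)
    have "f (rev t @ a # b # rev s) = \<alpha> * f (rev t @ b # a # rev s)"
      using swap by (intro swap_rule_append(1)[OF rule]) auto
    moreover have "mset (s @ b # a # t) = mset (s @ a # b # t)"
      by simp
    ultimately show ?case
      using swap straightening_swap[OF swap(1), of \<alpha> "- Y" s t] by (simp add: mult.assoc del: mset_append)
  qed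
  from this[of "rev u"] u show ?thesis
    by simp
qed

lemma sum_straightening_swap_rule:
  fixes x :: "nat list \<Rightarrow> 'k::comm_ring_1"
  assumes rule: "swap_rule (- \<beta>) Y i x" and i: "Suc i < size m"
  shows "(\<Sum>v\<in>arrangements m. straightening \<beta> Y v * x v) = 0"
proof -
  have split: "\<exists>s a b t. v = s @ a # b # t \<and> length s = i" if "v \<in> arrangements m" for v
    using that i split_at_adjacent[of i v] by (auto simp: permutations_of_multiset_def) metis
  have ascent: "straightening \<beta> Y v * x v + straightening \<beta> Y (swap_at i v) * x (swap_at i v) = 0"
    if v: "v \<in> arrangements m" "v ! i < v ! Suc i" for v
  proof -
    obtain s a b t where w: "v = s @ a # b # t" "length s = i"
      using split v(1) by blast
    have ab: "a < b"
      using v w by (auto simp: nth_append)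
    show ?thesis
      using w swap_rule_append(1)[OF rule w(2) ab, of t] straightening_swap[OF ab, of \<beta> Y s t]
      by (simp add: swap_at_append)
  qed
  have repeated: "straightening \<beta> Y v * x v = 0" if v: "v \<in> arrangements m" "v ! i = v ! Suc i" for v
  proof -
    obtain s a b t where w: "v = s @ a # b # t" "length s = i"
      using split v(1) by blast
    have "a = b"
      using v w by (auto simp: nth_append)
    thus ?thesis
      using w swap_rule_append(2)[OF rule w(2), of a t] straightening_repeat[of a Y \<beta> s t]
      by (cases "a \<in> Y") auto
  qed
  show ?thesis
    unfolding sum_arrangements_swap[OF i] using ascent repeated by (simp add: sum.neutral)
qed

section \<open>Normal forms in a weight space\<close>

locale weight_complex =
  fixes k :: kind and q :: "'k::field" and \<chi> :: "nat \<Rightarrow> 'k" and L :: "nat multiset"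
begin

abbreviation \<alpha> where "\<alpha> \<equiv> twist k q"

abbreviation Y where "Y \<equiv> repeatable k q \<chi>"

abbreviation J where "J \<equiv> joint_relations k (super_op q \<chi>) q (weight_space L)"

abbreviation Z where "Z \<equiv> relation_span k (super_op q \<chi>) q (weight_space L) (size L)"

lemma J_eq: "n \<le> size L \<Longrightarrow> J n = swap_rule_space \<alpha> Y L n"
  by (rule joint_relations_weight_space)

lemma J_weight_space: "x \<in> J n \<Longrightarrow> x \<in> weight_space L"
  using joint_relations_subset by blast

lemma subspace_J: "fs.subspace (J n)"
  using operator_module.subspace_joint_relations[OF operator_module_weight_space] .

lemma subspace_Z: "fs.subspace (Z n)"
  by (rule subspace_relation_span)

lemma relations_J:
  "n \<le> i \<Longrightarrow> Suc i < size L \<Longrightarrow> relations k (super_op q \<chi>) q i (J n) = {x \<in> J n. swap_rule \<alpha> Y i x}"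
  by (simp add: J_eq relations_swap_rule_space)

lemma in_Z_of_swap_rule:
  assumes "x \<in> J n" "n \<le> i" "Suc i < size L" "swap_rule \<alpha> Y i x"
  shows "x \<in> Z n"
proof -
  have "x \<in> relations k (super_op q \<chi>) q i (J n)"
    unfolding relations_J[OF assms(2,3)] using assms(1,4) by blast
  thus ?thesis
    using relations_subset_relation_span[OF assms(2,3)] by blast
qed

text \<open>The coefficient of \<open>e_u \<otimes> e_v\<close>, \<open>v\<close> sorted, in the normal form of \<open>x\<close> modulo the relations in the positions after
  \<open>u\<close>.\<close>
definition normal_coeff :: "(nat list \<Rightarrow> 'k) \<Rightarrow> nat list \<Rightarrow> 'k" where
  "normal_coeff x u = (\<Sum>v\<in>arrangements (L - mset u). straightening (- \<alpha>) Y v * x (u @ v))"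

lemma normal_coeff_linear:
  "normal_coeff (x + y) u = normal_coeff x u + normal_coeff y u"
  "normal_coeff (x - y) u = normal_coeff x u - normal_coeff y u"
  "normal_coeff (sc c x) u = c * normal_coeff x u"
  unfolding normal_coeff_def
  by (simp_all add: sc_def sum.distrib sum_subtractf sum_distrib_left algebra_simps)

lemma normal_coeff_eq_0:
  assumes x: "x \<in> Z n" and u: "length u = n" "mset u \<subseteq># L"
  shows "normal_coeff x u = 0"
  using x unfolding relation_span_def
proof (induction rule: fs.span_induct_alt)
  case base
  show ?case
    by (simp add: normal_coeff_def)
next
  case (step c s y)
  from step(1) obtain i where i: "n \<le> i" "Suc i < size L" "s \<in> relations k (super_op q \<chi>) q i (J n)"
    by blast
  hence "swap_rule \<alpha> Y (length u + (i - n)) s"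
    using relations_J[OF i(1,2)] u(1) by auto
  hence "swap_rule (- (- \<alpha>)) Y (i - n) (\<lambda>v. s (u @ v))"
    using swap_rule_right_slice by simp
  moreover have "Suc (i - n) < size (L - mset u)"
    using i u by (simp add: size_Diff_submset)
  ultimately have "normal_coeff s u = 0"
    unfolding normal_coeff_def by (rule sum_straightening_swap_rule)
  thus ?case
    using step(2) by (simp only: normal_coeff_linear mult_zero_right add_0_left)
qed

definition replace_tail :: "nat \<Rightarrow> (nat list \<Rightarrow> 'k) \<Rightarrow> nat list \<Rightarrow> nat list \<Rightarrow> nat list \<Rightarrow> 'k" where
  "replace_tail n x v v' w = (if n \<le> length w \<and> drop n w = v' then x (take n w @ v) else 0)"

lemma replace_tail_in_weight_space:
  assumes x: "x \<in> weight_space L" and v: "mset v = mset v'"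
  shows "replace_tail n x v v' \<in> weight_space L"
  unfolding weight_space_iff
proof (intro allI impI)
  fix w assume w: "mset w \<noteq> L"
  have "mset (take n w @ v) = mset w" if "drop n w = v'"
    using v that mset_take_add_drop[of n w] by simp
  thus "replace_tail n x v v' w = 0"
    using w x by (simp add: replace_tail_def weight_space_iff)
qed

lemma swap_rule_replace_tail:
  assumes x: "swap_rule \<alpha> Y i x" and i: "Suc i < n"
  shows "swap_rule \<alpha> Y i (replace_tail n x v v')"
  unfolding swap_rule_iff_append
proof (intro allI impI)
  fix s t :: "nat list" and a b assume s: "length s = i"
  have "replace_tail n x v v' (s @ c # d # t) =
      (if n \<le> length (s @ c # d # t) \<and> drop (n - Suc (Suc i)) t = v'
       then x (s @ c # d # (take (n - Suc (Suc i)) t @ v)) else 0)" for c d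
    using s i by (auto simp: replace_tail_def drop_Cons' take_Cons' numeral_2_eq_2)
  thus "(a < b \<longrightarrow> replace_tail n x v v' (s @ a # b # t) = \<alpha> * replace_tail n x v v' (s @ b # a # t)) \<and>
       (a = b \<and> a \<in> Y \<longrightarrow> replace_tail n x v v' (s @ a # b # t) = 0)"
    using swap_rule_append[OF x s, of a] by auto
qed

lemma replace_tail_in_J:
  assumes x: "x \<in> J n" and v: "mset v = mset v'" and n: "n \<le> size L"
  shows "replace_tail n x v v' \<in> J n"
  using x replace_tail_in_weight_space[OF _ v] swap_rule_replace_tail
  unfolding J_eq[OF n] swap_rule_space_def by blast

lemma replace_tail_adjacent:
  "length w = n + length s \<Longrightarrow> replace_tail n x v (s @ a # b # t) (w @ c # e # w') =
    (if drop n w = s \<and> c = a \<and> e = b \<and> w' = t then x (take n w @ v) else 0)"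
  by (auto simp: replace_tail_def)

lemma replace_tail_swap:
  assumes x: "x \<in> J n" and ab: "a < b" and v: "mset v = mset (s @ a # b # t)" and n: "n + length v = size L"
  shows "replace_tail n x v (s @ b # a # t) + sc \<alpha> (replace_tail n x v (s @ a # b # t)) \<in> Z n"
proof (rule in_Z_of_swap_rule)
  show "Suc (n + length s) < size L"
    using n arg_cong[OF v, of size] by simp
  show "replace_tail n x v (s @ b # a # t) + sc \<alpha> (replace_tail n x v (s @ a # b # t)) \<in> J n"
    using x v n by (intro fs.subspace_add fs.subspace_scale subspace_J replace_tail_in_J) simp_all
  show "swap_rule \<alpha> Y (n + length s)
      (replace_tail n x v (s @ b # a # t) + sc \<alpha> (replace_tail n x v (s @ a # b # t)))"
    unfolding swap_rule_iff_append using ab by (auto simp: replace_tail_adjacent sc_def)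
qed simp

lemma replace_tail_repeat:
  assumes x: "x \<in> J n" and c: "c \<notin> Y" and v: "mset v = mset (s @ c # c # t)" and n: "n + length v = size L"
  shows "replace_tail n x v (s @ c # c # t) \<in> Z n"
proof (rule in_Z_of_swap_rule)
  show "Suc (n + length s) < size L"
    using n arg_cong[OF v, of size] by simp
  show "replace_tail n x v (s @ c # c # t) \<in> J n"
    using x v n by (intro replace_tail_in_J) simp_all
  show "swap_rule \<alpha> Y (n + length s) (replace_tail n x v (s @ c # c # t))"
    unfolding swap_rule_iff_append using c by (auto simp: replace_tail_adjacent)
qed simp

lemma replace_tail_straightening:
  assumes x: "x \<in> J n" and n: "n + length v = size L"
  shows "mset v = mset v' \<Longrightarrow> replace_tail n x v v'
    - sc (straightening (- \<alpha>) Y v') (replace_tail n x v (sorted_word (mset v'))) \<in> Z n"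
proof (induction v' rule: bubble_induct)
  case (sorted l)
  have l_eq: "sorted_word (mset l) = l"
    using sorted(1) by (simp add: sorted_sort_id)
  show ?case
  proof (cases "repeats_in Y (mset l)")
    case True
    thus ?thesis
      using straightening_sorted[OF sorted(1) True, of "- \<alpha>"] fs.subspace_0[OF subspace_Z]
      by (simp only: l_eq fs.scale_one diff_self)
  next
    case False
    then obtain s c t where "l = s @ c # c # t" "c \<notin> Y"
      using sorted_not_repeats_in[OF sorted(1) False] by blast
    hence "replace_tail n x v l \<in> Z n"
      using replace_tail_repeat[OF x _ _ n] sorted(2) by blast
    thus ?thesis
      by (simp only: straightening_eq_0[OF False] fs.scale_zero_left diff_zero)
  qed
next
  case (swap s a b t)
  let ?A = "replace_tail n x v (s @ a # b # t)" and ?B = "replace_tail n x v (s @ b # a # t)"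
    and ?C = "replace_tail n x v (sorted_word (mset (s @ a # b # t)))"
    and ?k = "straightening (- \<alpha>) Y (s @ a # b # t)"
  have v: "mset v = mset (s @ a # b # t)"
    using swap(3) by simp
  have "(?B + sc \<alpha> ?A) - sc \<alpha> (?A - sc ?k ?C) \<in> Z n"
    by (intro fs.subspace_diff[OF subspace_Z] fs.subspace_scale[OF subspace_Z]
        replace_tail_swap[OF x swap(1) v n] swap(2)[OF v])
  also have "(?B + sc \<alpha> ?A) - sc \<alpha> (?A - sc ?k ?C) = ?B - sc (straightening (- \<alpha>) Y (s @ b # a # t)) ?C"
    unfolding straightening_swap[OF swap(1)] by (simp add: fun_eq_iff sc_def algebra_simps)
  finally show ?case
    by (simp add: add_mset_commute)
qed

lemma sum_replace_tail:
  assumes x: "x \<in> weight_space L" and n: "n \<le> size L"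
  shows "(\<Sum>v\<in>drop n ` arrangements L. replace_tail n x v v) = x"
proof
  fix w
  have "(\<Sum>v\<in>drop n ` arrangements L. replace_tail n x v v w)
      = (\<Sum>v\<in>drop n ` arrangements L. if v = drop n w then (if n \<le> length w then x w else 0) else 0)"
    by (rule sum.cong) (auto simp: replace_tail_def)
  also have "\<dots> = x w"
  proof (cases "mset w = L")
    case True
    hence "w \<in> arrangements L" "n \<le> length w"
      using n by (auto simp: permutations_of_multiset_def)
    thus ?thesis
      by auto
  next
    case False
    thus ?thesis
      using x by (auto simp: weight_space_iff)
  qed
  finally show "(\<Sum>v\<in>drop n ` arrangements L. replace_tail n x v v) w = x w"
    by (simp add: sum_fun_apply)
qed

lemma sum_replace_tail_sorted:
  assumes x: "x \<in> weight_space L" and w: "mset w = L" "n \<le> length w"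
  shows "(\<Sum>v\<in>drop n ` arrangements L. straightening (- \<alpha>) Y v * replace_tail n x v (sorted_word (mset v)) w)
    = (if sorted (drop n w) then normal_coeff x (take n w) else 0)"
proof (cases "sorted (drop n w)")
  case True
  let ?u = "take n w" and ?v = "drop n w"
  have rest: "L - mset ?u = mset ?v"
    using w(1) mset_take_add_drop[of n w] by (metis add_diff_cancel_left')
  have sorted_iff: "?v = sorted_word (mset v) \<longleftrightarrow> mset v = mset ?v" for v
    using sorted_eq_sorted_word[OF True] by (metis mset_sorted_list_of_multiset)
  have tails: "arrangements (L - mset ?u) \<subseteq> drop n ` arrangements L"
  proof
    fix v assume "v \<in> arrangements (L - mset ?u)"
    hence "?u @ v \<in> arrangements L"
      using w(1) mset_take_add_drop[of n w] by (simp add: rest permutations_of_multiset_def)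
    thus "v \<in> drop n ` arrangements L"
      using w(2) by (intro image_eqI[of _ _ "?u @ v"]) simp_all
  qed
  have "(\<Sum>v\<in>drop n ` arrangements L. straightening (- \<alpha>) Y v * replace_tail n x v (sorted_word (mset v)) w)
      = (\<Sum>v\<in>arrangements (L - mset ?u). straightening (- \<alpha>) Y v * x (?u @ v))"
    by (rule sum.mono_neutral_cong_right[OF finite_imageI[OF finite_permutations_of_multiset] tails])
      (simp_all only: replace_tail_def w(2) sorted_iff rest permutations_of_multiset_def, simp_all)
  thus ?thesis
    using True by (simp add: normal_coeff_def)
next
  case False
  have "replace_tail n x v (sorted_word m) w = 0" for v m
    using False by (auto simp: replace_tail_def)
  thus ?thesis
    using False by (simp del: sorted_list_of_multiset_mset)
qed

lemma in_Z_of_normal_coeff_eq_0: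
  assumes x: "x \<in> J n" and n: "n \<le> size L"
    and zero: "\<And>u. length u = n \<Longrightarrow> mset u \<subseteq># L \<Longrightarrow> normal_coeff x u = 0"
  shows "x \<in> Z n"
proof -
  let ?V = "drop n ` arrangements L"
  let ?k = "straightening (- \<alpha>) Y"
  have x_weight: "x \<in> weight_space L"
    using x by (rule J_weight_space)
  have "(\<Sum>v\<in>?V. sc (?k v) (replace_tail n x v (sorted_word (mset v)))) = 0" (is "?S = 0")
  proof (rule weight_space_ext)
    show "?S \<in> weight_space L"
      by (intro fs.subspace_sum fs.subspace_scale subspace_supp_in replace_tail_in_weight_space x_weight) simp
    fix w assume w: "mset w = L"
    hence length: "length (take n w) = n" "n \<le> length w"
      using n by auto
    have "mset (take n w) \<subseteq># L"
      using w mset_take_add_drop[of n w] by (metis mset_subset_eq_add_left)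
    thus "?S w = 0 w"
      using sum_replace_tail_sorted[OF x_weight w length(2)] zero[OF length(1)] by (simp add: sum_fun_apply sc_def)
  qed (use fs.subspace_0[OF subspace_supp_in] in blast)
  moreover have "(\<Sum>v\<in>?V. replace_tail n x v v - sc (?k v) (replace_tail n x v (sorted_word (mset v)))) \<in> Z n"
    by (intro fs.subspace_sum[OF subspace_Z] replace_tail_straightening[OF x])
      (use n in \<open>auto dest: permutations_of_multisetD\<close>)
  ultimately show ?thesis
    by (simp add: sum_subtractf sum_replace_tail[OF x_weight n])
qed

end

section \<open>The cube of contents\<close>

text \<open>In normal form the Koszul complex in weight \<open>L\<close> consists of functions of the content \<open>\<mu>\<close> of the \<open>W\<close>-part. It is
  contracted by moving the smallest letter of \<open>L\<close> from the \<open>A\<close>-part to the \<open>W\<close>-part.\<close>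
definition cube_diff ::
  "'k::comm_ring_1 \<Rightarrow> nat set \<Rightarrow> nat multiset \<Rightarrow> (nat multiset \<Rightarrow> 'k) \<Rightarrow> nat multiset \<Rightarrow> 'k" where
  "cube_diff \<alpha> Y L X \<mu> = (\<Sum>c\<in>set_mset (L - \<mu>).
    letter_coeff (- \<alpha>) Y c (L - \<mu> - {#c#}) * (letter_coeff \<alpha> (- Y) c \<mu> * X (add_mset c \<mu>)))"

definition cube_homotopy :: "nat \<Rightarrow> (nat multiset \<Rightarrow> 'k::comm_ring_1) \<Rightarrow> nat multiset \<Rightarrow> 'k" where
  "cube_homotopy z X \<mu> = (if z \<in># \<mu> then X (\<mu> - {#z#}) else 0)"

lemma cube_homotopy_absent:
  assumes z: "z \<notin># \<mu>" "z \<in># \<nu>" and min: "\<And>c. c \<in># \<mu> + \<nu> \<Longrightarrow> z \<le> c" and Y: "repeats_in Y \<nu>"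
  shows "cube_diff \<alpha> Y (\<mu> + \<nu>) (cube_homotopy z X) \<mu> = X \<mu>"
proof -
  let ?term = "\<lambda>c. letter_coeff (- \<alpha>) Y c (\<nu> - {#c#}) * (letter_coeff \<alpha> (- Y) c \<mu> * cube_homotopy z X (add_mset c \<mu>))"
  have "letter_coeff (- \<alpha>) Y z (\<nu> - {#z#}) = 1"
    using min in_diffD[of _ \<nu> "{#z#}"] repeats_in_remove[OF Y, of z] by (subst letter_coeff_le) auto
  moreover have "letter_coeff \<alpha> (- Y) z \<mu> = 1"
    using min z(1) by (subst letter_coeff_le) auto
  ultimately have "?term z = X \<mu>"
    by (simp add: cube_homotopy_def)
  moreover have "?term c = 0" if "c \<in> set_mset \<nu> - {z}" for c
    using that z(1) by (simp add: cube_homotopy_def)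
  ultimately show ?thesis
    using z(2) by (simp add: cube_diff_def sum.remove[of "set_mset \<nu>" z] sum.neutral)
qed

lemma cube_homotopy_present:
  assumes min: "\<And>c. c \<in># add_mset z \<mu> + \<nu> \<Longrightarrow> z \<le> c"
    and Y: "repeats_in (- Y) (add_mset z \<mu>)" "repeats_in Y \<nu>"
  shows "cube_diff \<alpha> Y (add_mset z \<mu> + \<nu>) X \<mu>
    + cube_diff \<alpha> Y (add_mset z \<mu> + \<nu>) (cube_homotopy z X) (add_mset z \<mu>) = X (add_mset z \<mu>)"
proof -
  let ?B = "\<lambda>c. letter_coeff (- \<alpha>) Y c (add_mset z \<nu> - {#c#}) * (letter_coeff \<alpha> (- Y) c \<mu> * X (add_mset c \<mu>))"
  let ?A = "\<lambda>c. letter_coeff (- \<alpha>) Y c (\<nu> - {#c#}) *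
    (letter_coeff \<alpha> (- Y) c (add_mset z \<mu>) * cube_homotopy z X (add_mset c (add_mset z \<mu>)))"
  have cancel: "?A c = - ?B c" if c: "c \<in> set_mset \<nu> - {z}" for c
  proof -
    have "z < c"
      using min[of c] c by auto
    moreover have "add_mset z \<nu> - {#c#} = add_mset z (\<nu> - {#c#})"
      using c by simp
    ultimately show ?thesis
      by (simp add: letter_coeff_add_less cube_homotopy_def)
  qed
  have B: "?B z = (if z \<in> Y \<or> z \<notin># \<nu> then X (add_mset z \<mu>) else 0)"
    using min repeats_in_add_mset[OF Y(1)] by (subst (1 2) letter_coeff_le) auto
  have A: "?A z = (if z \<in> Y then 0 else X (add_mset z \<mu>))"
    using min in_diffD[of _ \<nu> "{#z#}"] repeats_in_remove[OF Y(2), of z]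
    by (subst (1 2) letter_coeff_le) (auto simp: cube_homotopy_def)
  have "cube_diff \<alpha> Y (add_mset z \<mu> + \<nu>) X \<mu> = ?B z + (\<Sum>c\<in>set_mset \<nu> - {z}. ?B c)"
    by (simp add: cube_diff_def sum.insert_remove)
  moreover have "cube_diff \<alpha> Y (add_mset z \<mu> + \<nu>) (cube_homotopy z X) (add_mset z \<mu>)
      = (if z \<in># \<nu> then ?A z else 0) + (\<Sum>c\<in>set_mset \<nu> - {z}. ?A c)"
    by (cases "z \<in># \<nu>") (simp_all add: cube_diff_def sum.remove[of "set_mset \<nu>" z])
  moreover have "(\<Sum>c\<in>set_mset \<nu> - {z}. ?A c) = - (\<Sum>c\<in>set_mset \<nu> - {z}. ?B c)"
    unfolding sum_negf[symmetric] by (rule sum.cong[OF refl cancel])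
  ultimately show ?thesis
    using A B by auto
qed

lemma cube_homotopy:
  assumes \<mu>: "\<mu> \<subseteq># L" and z: "z \<in># L" "\<And>c. c \<in># L \<Longrightarrow> z \<le> c"
    and Y: "repeats_in (- Y) \<mu>" "repeats_in Y (L - \<mu>)"
  shows "cube_homotopy z (cube_diff \<alpha> Y L X) \<mu> + cube_diff \<alpha> Y L (cube_homotopy z X) \<mu> = X \<mu>"
proof -
  obtain \<nu> where L: "L = \<mu> + \<nu>"
    using \<mu> by (auto simp: mset_subset_eq_exists_conv)
  show ?thesis
  proof (cases "z \<in># \<mu>")
    case True
    then obtain \<mu>' where \<mu>': "\<mu> = add_mset z \<mu>'"
      by (rule mset_add)
    show ?thesis
      using cube_homotopy_present[of z \<mu>' \<nu> Y \<alpha> X] z Y unfolding L \<mu>' by (simp add: cube_homotopy_def)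
  next
    case False
    thus ?thesis
      using cube_homotopy_absent[of z \<mu> \<nu> Y \<alpha> X] z Y unfolding L by (simp add: cube_homotopy_def)
  qed
qed

section \<open>Exactness in a weight space\<close>

context weight_complex
begin

definition head_coeff :: "nat list \<Rightarrow> 'k" where
  "head_coeff u = straightening \<alpha> (- Y) (rev u)"

lemma head_coeff_snoc: "head_coeff (u @ [c]) = letter_coeff \<alpha> (- Y) c (mset u) * head_coeff u"
  by (simp add: head_coeff_def)

lemma head_coeff_eq_0: "\<not> repeats_in (- Y) (mset u) \<Longrightarrow> head_coeff u = 0"
  unfolding head_coeff_def by (rule straightening_eq_0) simp

lemma normal_coeff_expand:
  assumes "L - mset u \<noteq> {#}"
  shows "normal_coeff x u = (\<Sum>c\<in>set_mset (L - mset u).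
    letter_coeff (- \<alpha>) Y c (L - mset u - {#c#}) * normal_coeff x (u @ [c]))"
proof -
  let ?m = "L - mset u"
  have "normal_coeff x u = (\<Sum>v\<in>(\<Union>c\<in>set_mset ?m. (#) c ` arrangements (?m - {#c#})).
      straightening (- \<alpha>) Y v * x (u @ v))"
    unfolding normal_coeff_def permutations_of_multiset_nonempty[OF assms] by simp
  also have "\<dots> = (\<Sum>c\<in>set_mset ?m. \<Sum>v\<in>(#) c ` arrangements (?m - {#c#}). straightening (- \<alpha>) Y v * x (u @ v))"
    by (rule sum.UNION_disjoint) auto
  also have "\<dots> = (\<Sum>c\<in>set_mset ?m. letter_coeff (- \<alpha>) Y c (?m - {#c#}) * normal_coeff x (u @ [c]))"
  proof (rule sum.cong[OF refl])
    fix c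
    have "(\<Sum>v\<in>(#) c ` arrangements (?m - {#c#}). straightening (- \<alpha>) Y v * x (u @ v)) =
        (\<Sum>v\<in>arrangements (?m - {#c#}). straightening (- \<alpha>) Y (c # v) * x (u @ c # v))"
      by (subst sum.reindex) auto
    also have "\<dots> = (\<Sum>v\<in>arrangements (?m - {#c#}).
        letter_coeff (- \<alpha>) Y c (?m - {#c#}) * (straightening (- \<alpha>) Y v * x ((u @ [c]) @ v)))"
      by (rule sum.cong[OF refl]) (auto simp: permutations_of_multiset_def mult.assoc)
    also have "\<dots> = letter_coeff (- \<alpha>) Y c (?m - {#c#}) * normal_coeff x (u @ [c])"
      unfolding normal_coeff_def by (simp add: sum_distrib_left)
    finally show "(\<Sum>v\<in>(#) c ` arrangements (?m - {#c#}). straightening (- \<alpha>) Y v * x (u @ v)) =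
        letter_coeff (- \<alpha>) Y c (?m - {#c#}) * normal_coeff x (u @ [c])" .
  qed
  finally show ?thesis .
qed

lemma normal_coeff_eq_cube_diff:
  assumes u: "L - mset u \<noteq> {#}"
    and F: "\<And>c. c \<in># L - mset u \<Longrightarrow> normal_coeff x (u @ [c]) = head_coeff (u @ [c]) * F (mset (u @ [c]))"
  shows "normal_coeff x u = head_coeff u * cube_diff \<alpha> Y L F (mset u)"
  unfolding normal_coeff_expand[OF u] cube_diff_def sum_distrib_left
  by (rule sum.cong[OF refl]) (simp add: F head_coeff_snoc ac_simps)

lemma normal_coeff_no_repeats: "\<not> repeats_in Y (L - mset u) \<Longrightarrow> normal_coeff x u = 0"
  unfolding normal_coeff_def
  by (rule sum.neutral) (auto simp: permutations_of_multiset_def straightening_eq_0)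

definition content_coeff :: "(nat list \<Rightarrow> 'k) \<Rightarrow> nat multiset \<Rightarrow> 'k" where
  "content_coeff x \<mu> = normal_coeff x (rev (sorted_word \<mu>))"

lemma normal_coeff_eq_content_coeff:
  assumes x: "x \<in> J n" and n: "n \<le> size L" and u: "length u = n"
  shows "normal_coeff x u = head_coeff u * content_coeff x (mset u)"
  unfolding head_coeff_def content_coeff_def
proof (rule swap_rule_straightening[OF _ u])
  fix i assume "Suc i < n"
  hence slice: "swap_rule \<alpha> Y i (\<lambda>u. x (u @ v))" for v
    using x unfolding J_eq[OF n] by (intro swap_rule_left_slice swap_rule_spaceD)
  show "swap_rule \<alpha> Y i (normal_coeff x)"
    unfolding swap_rule_iff_append
  proof (intro allI impI)
    fix s t :: "nat list" and a b assume s: "length s = i"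
    have content: "mset (s @ a # b # t) = mset (s @ b # a # t)"
      by simp
    show "(a < b \<longrightarrow> normal_coeff x (s @ a # b # t) = \<alpha> * normal_coeff x (s @ b # a # t)) \<and>
        (a = b \<and> a \<in> Y \<longrightarrow> normal_coeff x (s @ a # b # t) = 0)"
      unfolding normal_coeff_def content
      using swap_rule_append[OF slice s, of a]
      by (auto simp: sum_distrib_left mult.left_commute intro!: sum.cong sum.neutral)
  qed
qed

lemma cube_diff_content_coeff:
  assumes x: "x \<in> J (Suc n) \<inter> Z n" and n: "n < size L"
    and \<mu>: "\<mu> \<subseteq># L" "size \<mu> = n" "repeats_in (- Y) \<mu>"
  shows "cube_diff \<alpha> Y L (content_coeff x) \<mu> = 0"
proof -
  let ?u = "rev (sorted_word \<mu>)"
  have u: "mset ?u = \<mu>" "length ?u = n"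
    using \<mu>(2) by (simp_all flip: size_mset)
  have "L - mset ?u \<noteq> {#}"
    using size_Diff_submset[OF \<mu>(1)] \<mu>(2) n u(1) by auto
  hence "normal_coeff x ?u = head_coeff ?u * cube_diff \<alpha> Y L (content_coeff x) (mset ?u)"
    by (rule normal_coeff_eq_cube_diff)
      (use x n u(2) in \<open>auto intro!: normal_coeff_eq_content_coeff simp del: rev_append mset_append\<close>)
  moreover have "normal_coeff x ?u = 0"
    using x u \<mu>(1) by (intro normal_coeff_eq_0) auto
  moreover have "head_coeff ?u = 1"
    using \<mu>(3) by (simp add: head_coeff_def straightening_sorted_word)
  ultimately show ?thesis
    by (simp add: u(1))
qed

definition realization :: "nat \<Rightarrow> (nat multiset \<Rightarrow> 'k) \<Rightarrow> nat list \<Rightarrow> 'k" where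
  "realization n F w = (if mset w = L \<and> sorted (drop n w) then head_coeff (take n w) * F (mset (take n w)) else 0)"

lemma realization_in_J:
  assumes n: "n \<le> size L"
  shows "realization n F \<in> J n"
  unfolding J_eq[OF n] swap_rule_space_def
proof (intro CollectI conjI allI impI)
  show "realization n F \<in> weight_space L"
    by (simp add: weight_space_iff realization_def)
  fix i assume i: "Suc i < n"
  show "swap_rule \<alpha> Y i (realization n F)"
    unfolding swap_rule_iff_append
  proof (intro allI impI)
    fix s t :: "nat list" and a b assume s: "length s = i"
    define j where "j = n - Suc (Suc i)"
    have n_eq: "n = length s + Suc (Suc j)"
      using i s unfolding j_def by simp
    have take_drop: "take n (s @ c # d # t) = s @ c # d # take j t" "drop n (s @ c # d # t) = drop j t" for c d
      unfolding n_eq by simp_all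
    have content: "mset (s @ b # a # t) = mset (s @ a # b # t)"
      "mset (s @ b # a # take j t) = mset (s @ a # b # take j t)"
      by simp_all
    have "a < b \<Longrightarrow> head_coeff (s @ a # b # take j t) = \<alpha> * head_coeff (s @ b # a # take j t)"
      unfolding head_coeff_def using straightening_swap[of a b \<alpha> "- Y" "rev (take j t)" "rev s"] by simp
    moreover have "a \<in> Y \<Longrightarrow> head_coeff (s @ a # a # take j t) = 0"
      unfolding head_coeff_def using straightening_repeat[of a "- Y" \<alpha> "rev (take j t)" "rev s"] by simp
    ultimately show "(a < b \<longrightarrow> realization n F (s @ a # b # t) = \<alpha> * realization n F (s @ b # a # t)) \<and>
        (a = b \<and> a \<in> Y \<longrightarrow> realization n F (s @ a # b # t) = 0)"
      unfolding realization_def take_drop content by (auto simp del: mset_append)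
  qed
qed

lemma normal_coeff_realization:
  assumes u: "length u = n" "mset u \<subseteq># L" and Y: "repeats_in Y (L - mset u)"
  shows "normal_coeff (realization n F) u = head_coeff u * F (mset u)"
proof -
  let ?m = "L - mset u"
  have "realization n F (u @ v) = (if v = sorted_word ?m then head_coeff u * F (mset u) else 0)"
    if v: "v \<in> arrangements ?m" for v
  proof -
    have mset_v: "mset v = ?m"
      using v by (simp add: permutations_of_multiset_def)
    have "mset (u @ v) = L"
      using u(2) by (simp add: mset_v)
    moreover have "sorted v \<longleftrightarrow> v = sorted_word ?m"
      using sorted_eq_sorted_word[of v] mset_v by (metis sorted_sorted_list_of_multiset)
    ultimately show ?thesis
      using u(1) by (simp add: realization_def)
  qed
  hence "normal_coeff (realization n F) u = (\<Sum>v\<in>arrangements ?m.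
      if v = sorted_word ?m then straightening (- \<alpha>) Y v * (head_coeff u * F (mset u)) else 0)"
    unfolding normal_coeff_def by (intro sum.cong) simp_all
  also have "\<dots> = straightening (- \<alpha>) Y (sorted_word ?m) * (head_coeff u * F (mset u))"
    by (simp add: mset_sorted_list_of_multiset permutations_of_multisetI)
  finally show ?thesis
    by (simp add: straightening_sorted_word[OF Y])
qed

lemma content_coeff_homotopy:
  assumes x: "x \<in> J (Suc n) \<inter> Z n" and n: "n < size L"
    and z: "z \<in># L" "\<And>c. c \<in># L \<Longrightarrow> z \<le> c"
    and \<mu>: "\<mu> \<subseteq># L" "size \<mu> = Suc n" "repeats_in (- Y) \<mu>" "repeats_in Y (L - \<mu>)"
  shows "cube_diff \<alpha> Y L (cube_homotopy z (content_coeff x)) \<mu> = content_coeff x \<mu>"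
proof -
  have "cube_homotopy z (cube_diff \<alpha> Y L (content_coeff x)) \<mu> = 0"
  proof (cases "z \<in># \<mu>")
    case True
    have "\<mu> - {#z#} \<subseteq># L" "repeats_in (- Y) (\<mu> - {#z#})"
      using subset_mset.order_trans[OF diff_subset_eq_self \<mu>(1)] repeats_in_mono[OF diff_subset_eq_self \<mu>(3)]
      by blast+
    thus ?thesis
      using cube_diff_content_coeff[OF x n, of "\<mu> - {#z#}"] \<mu>(2) True
      by (simp add: cube_homotopy_def size_Diff_singleton)
  qed (simp add: cube_homotopy_def)
  thus ?thesis
    using cube_homotopy[OF \<mu>(1) z \<mu>(3,4), of \<alpha> "content_coeff x"] by simp
qed

lemma cycle_top_eq_0:
  assumes x: "x \<in> J (Suc n) \<inter> Z n" and n: "Suc n = size L" and z: "z \<in># L" "\<And>c. c \<in># L \<Longrightarrow> z \<le> c"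
  shows "x = 0"
proof (rule weight_space_ext)
  show "x \<in> weight_space L"
    using x J_weight_space by blast
  fix w assume w: "mset w = L"
  have "x w = normal_coeff x w"
    by (simp add: normal_coeff_def w)
  also have "\<dots> = head_coeff w * content_coeff x L"
    using x n w normal_coeff_eq_content_coeff[of x "Suc n" w] by (auto simp flip: size_mset)
  also have "\<dots> = 0"
  proof (cases "repeats_in (- Y) L")
    case True
    have "cube_diff \<alpha> Y L (cube_homotopy z (content_coeff x)) L = content_coeff x L"
      by (rule content_coeff_homotopy[OF x _ z]) (use n True in simp_all)
    thus ?thesis
      by (simp add: cube_diff_def)
  qed (simp add: head_coeff_eq_0 w)
  finally show "x w = 0 w"
    by simp
qed (use fs.subspace_0[OF subspace_supp_in] in blast)

lemma normal_coeff_realization_homotopy: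
  assumes x: "x \<in> J (Suc n) \<inter> Z n" and n: "Suc n < size L" and z: "z \<in># L" "\<And>c. c \<in># L \<Longrightarrow> z \<le> c"
    and u: "length u = Suc n" "mset u \<subseteq># L"
  shows "normal_coeff (realization (Suc (Suc n)) (cube_homotopy z (content_coeff x))) u = normal_coeff x u"
    (is "normal_coeff (realization _ ?F) u = _")
proof (cases "repeats_in Y (L - mset u)")
  case True
  have snoc: "normal_coeff (realization (Suc (Suc n)) ?F) (u @ [c]) = head_coeff (u @ [c]) * ?F (mset (u @ [c]))"
    if c: "c \<in># L - mset u" for c
  proof (rule normal_coeff_realization)
    obtain \<nu> where \<nu>: "L - mset u = add_mset c \<nu>"
      using c by (rule mset_add)
    hence L: "L = mset (u @ [c]) + \<nu>"
      using u(2) by (metis add_mset_add_single mset.simps mset_append subset_mset.add_diff_inverse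
          union_mset_add_mset_left union_mset_add_mset_right add.right_neutral)
    thus "mset (u @ [c]) \<subseteq># L"
      by simp
    have "L - mset (u @ [c]) = \<nu>"
      unfolding L by simp
    moreover have "\<nu> \<subseteq># L - mset u"
      unfolding \<nu> by simp
    ultimately show "repeats_in Y (L - mset (u @ [c]))"
      using repeats_in_mono True by metis
  qed (use u(1) in simp)
  have "L - mset u \<noteq> {#}"
    using size_Diff_submset[OF u(2)] u(1) n by auto
  hence "normal_coeff (realization (Suc (Suc n)) ?F) u = head_coeff u * cube_diff \<alpha> Y L ?F (mset u)"
    by (rule normal_coeff_eq_cube_diff[OF _ snoc])
  also have "\<dots> = head_coeff u * content_coeff x (mset u)"
    using content_coeff_homotopy[OF x _ z u(2)] head_coeff_eq_0[of u] True n u(1)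
    by (cases "repeats_in (- Y) (mset u)") simp_all
  also have "\<dots> = normal_coeff x u"
    using x n u(1) by (intro normal_coeff_eq_content_coeff[symmetric]) auto
  finally show ?thesis .
qed (simp add: normal_coeff_no_repeats)

lemma cycle_in_boundaries:
  assumes x: "x \<in> J (Suc n) \<inter> Z n" and n: "Suc n < size L" and z: "z \<in># L" "\<And>c. c \<in># L \<Longrightarrow> z \<le> c"
  shows "x \<in> J (Suc (Suc n)) + Z (Suc n)"
proof -
  let ?y = "realization (Suc (Suc n)) (cube_homotopy z (content_coeff x))"
  have y: "?y \<in> J (Suc (Suc n))"
    using n by (intro realization_in_J) simp
  hence "?y \<in> J (Suc n)"
    by (rule subsetD[OF joint_relations_antimono, rotated]) simp
  hence "x - ?y \<in> J (Suc n)"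
    using x by (intro fs.subspace_diff[OF subspace_J]) simp_all
  hence "x - ?y \<in> Z (Suc n)"
    using n by (rule in_Z_of_normal_coeff_eq_0[OF _ less_imp_le])
      (simp add: normal_coeff_linear normal_coeff_realization_homotopy[OF x n z])
  from set_plus_intro[OF y this] show ?thesis
    by simp
qed

theorem koszul_exact_weight_space:
  assumes "L \<noteq> {#}"
  shows "koszul_exact k (super_op q \<chi>) q (weight_space L) (size L)"
  unfolding koszul_exact_def
proof (intro allI impI subsetI)
  fix n x assume n: "n < size L" and x: "x \<in> J (Suc n) \<inter> Z n"
  obtain z where z: "z \<in># L" "\<And>c. c \<in># L \<Longrightarrow> z \<le> c"
    using assms that[of "Min (set_mset L)"] by simp
  show "x \<in> (if Suc n = size L then {0} else J (Suc (Suc n)) + Z (Suc n))"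
    using cycle_top_eq_0[OF x _ z] cycle_in_boundaries[OF x _ z] n by auto
qed

end

section \<open>Length of permutations\<close>

definition inversions :: "nat \<Rightarrow> (nat \<Rightarrow> nat) \<Rightarrow> (nat \<times> nat) set" where
  "inversions N p = {(i, j). i < j \<and> j < N \<and> p j < p i}"

lemma finite_inversions: "finite (inversions N p)"
  by (rule finite_subset[of _ "{..<N} \<times> {..<N}"]) (auto simp: inversions_def)

lemma hlen_eq_card: "hlen N p = card (inversions N p)"
  by (simp add: hlen_def inversions_def)

lemma inversions_id: "inversions N id = {}"
  by (auto simp: inversions_def)

lemma hlen_id: "hlen N id = 0"
  unfolding hlen_eq_card inversions_id by simp

lemma sgen_less_iff:
  "x \<noteq> y \<Longrightarrow> sgen s x < sgen s y \<longleftrightarrow> (x < y \<and> \<not> (x = s \<and> y = Suc s)) \<or> (x = Suc s \<and> y = s)"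
  by (auto simp: sgen_def transpose_def)

lemma sgen_simps [simp]: "sgen s s = Suc s" "sgen s (Suc s) = s" "sgen s (sgen s x) = x"
  by (simp_all add: sgen_def)

lemma sgen_other: "x \<noteq> s \<Longrightarrow> x \<noteq> Suc s \<Longrightarrow> sgen s x = x"
  by (simp add: sgen_def)

lemma sgen_comp_cancel: "sgen s \<circ> (sgen s \<circ> p) = p" "(p \<circ> sgen s) \<circ> sgen s = p"
  by (simp_all add: fun_eq_iff)

lemma sgen_comp_perms:
  assumes "Suc s < N" "p \<in> perms N"
  shows "sgen s \<circ> p \<in> perms N" "p \<circ> sgen s \<in> perms N"
  using assms permutes_swap_id[of s "{..<N}" "Suc s"]
  unfolding perms_def sgen_def by (auto intro: permutes_compose)

lemma finite_perms: "finite (perms N)"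
  unfolding perms_def by (simp add: finite_permutations)

lemma id_in_perms: "id \<in> perms N"
  by (simp add: perms_def permutes_id)

lemma inv_in_perms: "p \<in> perms N \<Longrightarrow> inv p \<in> perms N"
  by (simp add: perms_def permutes_inv)

lemma perms_bij: "p \<in> perms N \<Longrightarrow> bij p"
  by (simp add: perms_def permutes_bij)

lemma perms_inv [simp]:
  assumes "p \<in> perms N"
  shows "p (inv p x) = x" "inv p (p x) = x" "inv (inv p) = p" "inv p x < N \<longleftrightarrow> x < N" "p x < N \<longleftrightarrow> x < N"
    "p x = p y \<longleftrightarrow> x = y" "inv p x = inv p y \<longleftrightarrow> x = y"
  using assms inv_in_perms[OF assms] unfolding perms_def
  by (auto simp: permutes_inverses permutes_inv_inv permutes_in_image[of _ "{..<N}", simplified]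
      dest: permutes_inj inj_eq)

lemma perms_descent: "p \<in> perms N \<Longrightarrow> \<not> p s < p (Suc s) \<Longrightarrow> p (Suc s) < p s"
  by (metis perms_inv(6) n_not_Suc_n linorder_neqE_nat)

lemma inv_sgen_comp: "p \<in> perms N \<Longrightarrow> inv (sgen s \<circ> p) = inv p \<circ> sgen s"
  by (simp add: o_inv_distrib perms_bij sgen_def)

lemma inv_comp_sgen: "p \<in> perms N \<Longrightarrow> inv (p \<circ> sgen s) = sgen s \<circ> inv p"
  by (simp add: o_inv_distrib perms_bij sgen_def)

lemma inversions_sgen_comp:
  assumes p: "p \<in> perms N" and s: "Suc s < N" and up: "inv p s < inv p (Suc s)"
  shows "inversions N (sgen s \<circ> p) = insert (inv p s, inv p (Suc s)) (inversions N p)"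
    "(inv p s, inv p (Suc s)) \<notin> inversions N p"
proof -
  have flip: "sgen s (p b) < sgen s (p a) \<longleftrightarrow> p b < p a \<or> (a = inv p s \<and> b = inv p (Suc s))" if "a < b" for a b
  proof -
    have "\<not> (p b = s \<and> p a = Suc s)"
      using that up perms_inv(2)[OF p, of a] perms_inv(2)[OF p, of b] by force
    moreover have "(p b = Suc s \<and> p a = s) \<longleftrightarrow> (a = inv p s \<and> b = inv p (Suc s))"
      using perms_inv(1,2)[OF p] by metis
    ultimately show ?thesis
      using that p by (subst sgen_less_iff) auto
  qed
  show "inversions N (sgen s \<circ> p) = insert (inv p s, inv p (Suc s)) (inversions N p)"
    using up s p flip unfolding inversions_def by auto
  show "(inv p s, inv p (Suc s)) \<notin> inversions N p"
    using p by (simp add: inversions_def)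
qed

lemma bij_betw_inversions_inv:
  assumes p: "p \<in> perms N"
  shows "bij_betw (\<lambda>(i, j). (p j, p i)) (inversions N p) (inversions N (inv p))"
  by (rule bij_betw_byWitness[where f' = "\<lambda>(a, b). (inv p b, inv p a)"]) (use p in \<open>auto simp: inversions_def\<close>)

lemma hlen_inv: "p \<in> perms N \<Longrightarrow> hlen N (inv p) = hlen N p"
  using bij_betw_same_card[OF bij_betw_inversions_inv] by (simp add: hlen_eq_card)

lemma hlen_sgen_comp:
  assumes "p \<in> perms N" "Suc s < N" "inv p s < inv p (Suc s)"
  shows "hlen N (sgen s \<circ> p) = Suc (hlen N p)"
  unfolding hlen_eq_card inversions_sgen_comp(1)[OF assms]
  using inversions_sgen_comp(2)[OF assms] finite_inversions by (simp add: card_insert_if)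

lemma hlen_comp_sgen:
  assumes p: "p \<in> perms N" and s: "Suc s < N" and up: "p s < p (Suc s)"
  shows "hlen N (p \<circ> sgen s) = Suc (hlen N p)"
proof -
  have "hlen N (inv (p \<circ> sgen s)) = Suc (hlen N (inv p))"
    using hlen_sgen_comp[OF inv_in_perms[OF p] s] up p by (simp add: inv_comp_sgen)
  thus ?thesis
    using p s by (simp add: hlen_inv sgen_comp_perms)
qed

lemma inversions_subset_step:
  assumes p: "p \<in> perms N" and g: "g \<in> perms N" and s: "Suc s < N" and up: "inv p s < inv p (Suc s)"
    and subset: "inversions N (sgen s \<circ> p \<circ> g) \<subseteq> inversions N g"
  shows "inv (sgen s \<circ> p \<circ> g) s < inv (sgen s \<circ> p \<circ> g) (Suc s)" "inversions N (p \<circ> g) \<subseteq> inversions N g"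
proof -
  define r where "r = sgen s \<circ> p \<circ> g"
  have r: "r \<in> perms N" "p \<circ> g = sgen s \<circ> r"
    using sgen_comp_perms(1)[OF s p] g by (auto simp: r_def perms_def permutes_compose fun_eq_iff)
  have g_inv_r: "g (inv r s) = inv p (Suc s)" "g (inv r (Suc s)) = inv p s"
  proof -
    have "p (g x) = sgen s (r x)" for x
      using r(2) by (simp add: fun_eq_iff)
    from this[of "inv r s"] this[of "inv r (Suc s)"]
    have "p (g (inv r s)) = Suc s" "p (g (inv r (Suc s))) = s"
      using r(1) by simp_all
    thus "g (inv r s) = inv p (Suc s)" "g (inv r (Suc s)) = inv p s"
      using p by (metis perms_inv(2))+
  qed
  have up_r: "inv r s < inv r (Suc s)"
  proof (rule ccontr)
    assume "\<not> inv r s < inv r (Suc s)"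
    hence "(inv r (Suc s), inv r s) \<in> inversions N r"
      using perms_descent[OF inv_in_perms[OF r(1)]] r(1) s by (simp add: inversions_def)
    hence "(inv r (Suc s), inv r s) \<in> inversions N g"
      using subset unfolding r_def by blast
    thus False
      using up by (simp add: inversions_def g_inv_r)
  qed
  thus "inv (sgen s \<circ> p \<circ> g) s < inv (sgen s \<circ> p \<circ> g) (Suc s)"
    unfolding r_def .
  have "(inv r s, inv r (Suc s)) \<in> inversions N g"
    using up_r up r(1) s by (simp add: inversions_def g_inv_r)
  thus "inversions N (p \<circ> g) \<subseteq> inversions N g"
    unfolding r(2) inversions_sgen_comp(1)[OF r(1) s up_r] using subset unfolding r_def by simp
qed

lemma perms_ascending_eq_id:
  assumes p: "p \<in> perms N" and asc: "\<And>s. Suc s < N \<Longrightarrow> p s < p (Suc s)"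
  shows "p = id"
proof (rule permutes_natset_ge)
  show "p permutes {..<N}"
    using p by (simp add: perms_def)
  have "i < N \<Longrightarrow> i \<le> p i" for i
  proof (induction i)
    case (Suc i)
    thus ?case
      using asc[of i] by simp
  qed simp
  thus "\<forall>i\<in>{..<N}. i \<le> p i"
    by simp
qed

lemma perms_induct [consumes 1, case_names id step]:
  assumes p: "p \<in> perms N" and base: "P id"
    and step: "\<And>p s. p \<in> perms N \<Longrightarrow> Suc s < N \<Longrightarrow> inv p s < inv p (Suc s) \<Longrightarrow> P p \<Longrightarrow> P (sgen s \<circ> p)"
  shows "P p"
  using p
proof (induction "hlen N p" arbitrary: p rule: less_induct)
  case less
  show ?case
  proof (cases "p = id")
    case False
    hence "inv p \<noteq> id"
      using less.prems by (metis inv_id perms_inv(3))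
    then obtain s where s: "Suc s < N" "\<not> inv p s < inv p (Suc s)"
      using perms_ascending_eq_id[OF inv_in_perms[OF less.prems]] by blast
    have up: "inv (sgen s \<circ> p) s < inv (sgen s \<circ> p) (Suc s)"
      using perms_descent[OF inv_in_perms[OF less.prems] s(2)] less.prems by (simp add: inv_sgen_comp)
    note p' = sgen_comp_perms(1)[OF s(1) less.prems]
    have "hlen N p = Suc (hlen N (sgen s \<circ> p))"
      using hlen_sgen_comp[OF p' s(1) up] by (simp only: sgen_comp_cancel)
    hence "P (sgen s \<circ> p)"
      using less.hyps p' by simp
    from step[OF p' s(1) up this] show ?thesis
      by (simp only: sgen_comp_cancel)
  qed (simp add: base)
qed

lemma hecke_eq_supp_in: "hecke N = supp_in (perms N)"
  by (simp add: hecke_def supp_in_def)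

lemma delta_in_hecke: "p \<in> perms N \<Longrightarrow> delta p \<in> hecke N"
  by (simp add: hecke_eq_supp_in delta_in_supp_in)

lemma linear_map_hl: "linear_map (hl N q s)"
  by (rule linear_mapI) (auto simp: hl_def sc_def fun_eq_iff algebra_simps)

lemma linear_map_hr: "linear_map (\<lambda>x. hr N q x s)"
  by (rule linear_mapI) (auto simp: hr_def sc_def fun_eq_iff algebra_simps)

lemma hl_in_hecke:
  assumes "x \<in> hecke N" "Suc s < N"
  shows "hl N q s x \<in> hecke N"
proof -
  have "sgen s \<circ> u \<notin> perms N" if "u \<notin> perms N" for u
    using that sgen_comp_perms(1)[OF assms(2), of "sgen s \<circ> u"] by (auto simp only: sgen_comp_cancel)
  thus ?thesis
    using assms(1) by (simp add: hl_def hecke_def)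
qed

lemma hl_delta:
  assumes p: "p \<in> perms N" and s: "Suc s < N" and "inv p s < inv p (Suc s)"
  shows "hl N q s (delta p) = delta (sgen s \<circ> p)"
    "hl N q s (delta (sgen s \<circ> p)) = sc q (delta p) + sc (q - 1) (delta (sgen s \<circ> p))"
proof -
  have sgen_comp_eq: "sgen s \<circ> u = v \<longleftrightarrow> u = sgen s \<circ> v" for u v :: "nat \<Rightarrow> nat"
    using sgen_comp_cancel(1)[of s u] sgen_comp_cancel(1)[of s v] by auto
  have "p \<noteq> sgen s \<circ> p"
    using hlen_sgen_comp[OF assms] by (metis n_not_Suc_n)
  thus "hl N q s (delta p) = delta (sgen s \<circ> p)"
    "hl N q s (delta (sgen s \<circ> p)) = sc q (delta p) + sc (q - 1) (delta (sgen s \<circ> p))"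
    using hlen_sgen_comp[OF assms]
    by (auto intro!: ext simp: hl_def delta_def sc_def sgen_comp_eq sgen_comp_cancel)
qed

lemma hr_delta:
  assumes p: "p \<in> perms N" and s: "Suc s < N" and "p s < p (Suc s)"
  shows "hr N q (delta p) s = delta (p \<circ> sgen s)"
    "hr N q (delta (p \<circ> sgen s)) s = sc q (delta p) + sc (q - 1) (delta (p \<circ> sgen s))"
proof -
  have comp_sgen_eq: "u \<circ> sgen s = v \<longleftrightarrow> u = v \<circ> sgen s" for u v :: "nat \<Rightarrow> nat"
    using sgen_comp_cancel(2)[of u s] sgen_comp_cancel(2)[of v s] by auto
  have "p \<noteq> p \<circ> sgen s"
    using hlen_comp_sgen[OF assms] by (metis n_not_Suc_n)
  thus "hr N q (delta p) s = delta (p \<circ> sgen s)"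
    "hr N q (delta (p \<circ> sgen s)) s = sc q (delta p) + sc (q - 1) (delta (p \<circ> sgen s))"
    using hlen_comp_sgen[OF assms]
    by (auto intro!: ext simp: hr_def delta_def sc_def comp_sgen_eq sgen_comp_cancel)
qed

section \<open>Cosets of a parabolic subgroup\<close>

locale blocks =
  fixes N :: nat and block :: "nat \<Rightarrow> nat"
  assumes block_mono: "i \<le> j \<Longrightarrow> j < N \<Longrightarrow> block i \<le> block j"
begin

definition block_word :: "(nat \<Rightarrow> nat) \<Rightarrow> nat list" where
  "block_word p = map (\<lambda>i. block (inv p i)) [0..<N]"

definition block_content :: "nat multiset" where
  "block_content = mset (map block [0..<N])"

definition block_increasing :: "(nat \<Rightarrow> nat) \<Rightarrow> bool" where
  "block_increasing p \<longleftrightarrow> (\<forall>i j. i < j \<and> j < N \<and> block i = block j \<longrightarrow> p i < p j)"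

lemma size_block_content: "size block_content = N"
  by (simp add: block_content_def)

lemma length_block_word [simp]: "length (block_word p) = N"
  by (simp add: block_word_def)

lemma nth_block_word: "i < N \<Longrightarrow> block_word p ! i = block (inv p i)"
  by (simp add: block_word_def)

lemma mset_block_word:
  assumes "p \<in> perms N"
  shows "mset (block_word p) = block_content"
proof -
  have "inv p permutes {0..<N}"
    using inv_in_perms[OF assms] by (simp add: perms_def lessThan_atLeast0)
  hence "image_mset (inv p) (mset_set {0..<N}) = mset_set {0..<N}"
    by (rule permutes_image_mset)
  from arg_cong[where f = "image_mset block", OF this] show ?thesis
    by (simp add: block_word_def block_content_def multiset.map_comp comp_def)
qed

lemma block_word_arrangement: "p \<in> perms N \<Longrightarrow> block_word p \<in> arrangements block_content"
  by (simp add: permutations_of_multiset_def mset_block_word)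

lemma block_word_sgen_comp:
  assumes p: "p \<in> perms N" and s: "Suc s < N"
  shows "block_word (sgen s \<circ> p) = swap_at s (block_word p)"
proof (rule nth_equalityI)
  fix i assume "i < length (block_word (sgen s \<circ> p))"
  thus "block_word (sgen s \<circ> p) ! i = swap_at s (block_word p) ! i"
    using p s by (auto simp: swap_at_def nth_list_update nth_block_word inv_sgen_comp sgen_other)
qed simp

lemma block_sgen: "block s = block (Suc s) \<Longrightarrow> block (sgen s a) = block a"
  by (auto simp: sgen_def transpose_def)

lemma block_word_comp_sgen: "p \<in> perms N \<Longrightarrow> block s = block (Suc s) \<Longrightarrow> block_word (p \<circ> sgen s) = block_word p"
  by (simp add: block_word_def inv_comp_sgen block_sgen)

lemma block_word_id: "block_word id = sorted_word block_content"
proof -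
  have "sorted (map block [0..<N])"
    by (rule sorted_map_mono[OF _ monotone_onI]) (simp_all add: block_mono)
  hence "map block [0..<N] = sorted_word block_content"
    unfolding block_content_def by (rule sorted_eq_sorted_word)
  thus ?thesis
    by (simp add: block_word_def)
qed

lemma ascent_of_block_word:
  assumes p: "p \<in> perms N" and s: "Suc s < N" and less: "block_word p ! s < block_word p ! Suc s"
  shows "inv p s < inv p (Suc s)"
proof (rule ccontr)
  assume "\<not> inv p s < inv p (Suc s)"
  hence "block (inv p (Suc s)) \<le> block (inv p s)"
    using p s by (intro block_mono) simp_all
  thus False
    using less s by (simp add: nth_block_word)
qed

lemma block_word_le_of_ascent:
  assumes "p \<in> perms N" "Suc s < N" "inv p s < inv p (Suc s)"
  shows "block_word p ! s \<le> block_word p ! Suc s"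
  using assms block_mono[of "inv p s" "inv p (Suc s)"] by (simp add: nth_block_word)

lemma block_word_eq_imp_eq:
  assumes p: "p \<in> perms N" "block_increasing p" and p': "p' \<in> perms N" "block_increasing p'"
    and word: "block_word p = block_word p'"
  shows "p = p'"
proof -
  define \<sigma> where "\<sigma> = inv p' \<circ> p"
  have \<sigma>: "\<sigma> \<in> perms N"
    using p(1) inv_in_perms[OF p'(1)] by (simp add: \<sigma>_def perms_def permutes_compose)
  have p'_\<sigma>: "p' (\<sigma> i) = p i" for i
    using p'(1) by (simp add: \<sigma>_def)
  have block_\<sigma>: "block (\<sigma> i) = block i" if "i < N" for i
    using arg_cong[where f = "\<lambda>w. w ! p i", OF word] that p(1) by (simp add: \<sigma>_def nth_block_word)
  have "\<sigma> s < \<sigma> (Suc s)" if s: "Suc s < N" for s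
  proof (rule ccontr)
    assume "\<not> \<sigma> s < \<sigma> (Suc s)"
    hence less: "\<sigma> (Suc s) < \<sigma> s"
      using perms_inv(6)[OF \<sigma>, of "Suc s" s] by linarith
    hence "block (\<sigma> (Suc s)) \<le> block (\<sigma> s)"
      using s \<sigma> by (intro block_mono) simp_all
    hence block_eq: "block s = block (Suc s)"
      using block_\<sigma>[of s] block_\<sigma>[of "Suc s"] block_mono[of s "Suc s"] s by simp
    hence "p s < p (Suc s)"
      using p(2) s by (simp add: block_increasing_def)
    moreover have "p' (\<sigma> (Suc s)) < p' (\<sigma> s)"
      using p'(2) less block_eq block_\<sigma>[of s] block_\<sigma>[of "Suc s"] s \<sigma> by (simp add: block_increasing_def)
    ultimately show False
      by (simp add: p'_\<sigma>)
  qed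
  hence "\<sigma> = id"
    by (rule perms_ascending_eq_id[OF \<sigma>])
  thus ?thesis
    using p'_\<sigma> by (simp add: fun_eq_iff)
qed

lemma not_block_increasing_descent:
  assumes p: "p \<in> perms N" and "\<not> block_increasing p"
  obtains s where "Suc s < N" "block s = block (Suc s)" "p (Suc s) < p s"
proof -
  obtain i j where ij: "i < j" "j < N" "block i = block j" "\<not> p i < p j"
    using assms(2) unfolding block_increasing_def by blast
  have "\<exists>s. i \<le> s \<and> s < j \<and> p (Suc s) < p s"
  proof (rule ccontr)
    assume no_descent: "\<nexists>s. i \<le> s \<and> s < j \<and> p (Suc s) < p s"
    have "p i < p k" if "Suc i \<le> k" "k \<le> j" for k
      using that
    proof (induction k rule: dec_induct)
      case base
      thus ?case
        using no_descent p perms_inv(6)[OF p, of i "Suc i"] by (metis Suc_le_lessD nat_neq_iff n_not_Suc_n order_refl)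
    next
      case (step k)
      thus ?case
        using no_descent by (metis Suc_leD le_simps(2) not_le_imp_less order.strict_trans1 order_less_le_trans)
    qed
    thus False
      using ij by simp
  qed
  then obtain s where s: "i \<le> s" "s < j" "p (Suc s) < p s"
    by blast
  moreover have "block i \<le> block s" "block s \<le> block (Suc s)" "block (Suc s) \<le> block j"
    using s ij(2) by (auto intro: block_mono)
  ultimately show thesis
    using that[of s] ij by simp
qed

lemma coset_induct [consumes 1, case_names increasing step]:
  assumes p: "p \<in> perms N" and increasing: "\<And>p. p \<in> perms N \<Longrightarrow> block_increasing p \<Longrightarrow> P p"
    and step: "\<And>p s. p \<in> perms N \<Longrightarrow> Suc s < N \<Longrightarrow> block s = block (Suc s) \<Longrightarrow> p s < p (Suc s) \<Longrightarrow> P p \<Longrightarrow> P (p \<circ> sgen s)"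
  shows "P p"
  using p
proof (induction "hlen N p" arbitrary: p rule: less_induct)
  case less
  show ?case
  proof (cases "block_increasing p")
    case False
    then obtain s where s: "Suc s < N" "block s = block (Suc s)" "p (Suc s) < p s"
      using not_block_increasing_descent less.prems by blast
    note p' = sgen_comp_perms(2)[OF s(1) less.prems]
    have up: "(p \<circ> sgen s) s < (p \<circ> sgen s) (Suc s)"
      using s(3) by simp
    have "hlen N p = Suc (hlen N (p \<circ> sgen s))"
      using hlen_comp_sgen[OF p' s(1) up] by (simp only: sgen_comp_cancel)
    hence "P (p \<circ> sgen s)"
      using less.hyps p' by simp
    from step[OF p' s(1,2) up this] show ?thesis
      by (simp only: sgen_comp_cancel)
  qed (simp add: increasing less.prems)
qed

lemma block_word_surj:
  assumes "w \<in> arrangements block_content"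
  obtains p where "p \<in> perms N" "block_increasing p" "block_word p = w"
proof -
  have "mset w = mset (map block [0..<N])"
    using assms by (simp add: permutations_of_multiset_def block_content_def)
  then obtain f where f: "f permutes {..<length (map block [0..<N])}" "permute_list f (map block [0..<N]) = w"
    using mset_eq_permutation by blast
  hence "f \<in> perms N"
    by (simp add: perms_def)
  hence "inv f \<in> perms N" "block_word (inv f) = w"
    using f(2) by (auto simp: inv_in_perms block_word_def permute_list_def)
  moreover have "\<exists>p'\<in>perms N. block_increasing p' \<and> block_word p' = block_word p" if "p \<in> perms N" for p
    using that by (induction p rule: coset_induct) (blast, metis block_word_comp_sgen)
  ultimately show thesis
    using that by blast
qed

definition coset_rep :: "nat list \<Rightarrow> nat \<Rightarrow> nat" where
  "coset_rep w = (SOME p. p \<in> perms N \<and> block_increasing p \<and> block_word p = w)"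

lemma coset_rep:
  assumes "w \<in> arrangements block_content"
  shows "coset_rep w \<in> perms N" "block_increasing (coset_rep w)" "block_word (coset_rep w) = w"
proof -
  have "\<exists>p. p \<in> perms N \<and> block_increasing p \<and> block_word p = w"
    using block_word_surj[OF assms] by blast
  from someI_ex[OF this] show "coset_rep w \<in> perms N" "block_increasing (coset_rep w)" "block_word (coset_rep w) = w"
    by (simp_all add: coset_rep_def)
qed

lemma coset_rep_block_word:
  assumes "p \<in> perms N" "block_increasing p"
  shows "coset_rep (block_word p) = p"
  using assms coset_rep[OF block_word_arrangement[OF assms(1)]] by (intro block_word_eq_imp_eq) simp_all

end

section \<open>Modules induced from characters\<close>

text \<open>\<open>\<chi>\<close> is the value of a character of the parabolic subalgebra on the generators of each block. The induced module
  is identified with a weight space by sending \<open>T_p\<close> to the sorted word permuted by \<open>p\<close>, times the character value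
  \<open>block_char p\<close> of the parabolic component of \<open>p\<close>.\<close>
locale block_character = blocks N block
  for N :: nat and block :: "nat \<Rightarrow> nat" +
  fixes q :: "'k::field" and \<chi> :: "nat \<Rightarrow> 'k"
  assumes character_quadratic: "(\<chi> c - q) * (\<chi> c + 1) = 0"
begin

definition block_char :: "(nat \<Rightarrow> nat) \<Rightarrow> 'k" where
  "block_char p = (\<Prod>(i, j)\<in>inversions N p. if block i = block j then \<chi> (block i) else 1)"

definition to_word :: "((nat \<Rightarrow> nat) \<Rightarrow> 'k) \<Rightarrow> nat list \<Rightarrow> 'k" where
  "to_word x = (\<Sum>p\<in>perms N. sc (x p) (sc (block_char p) (delta (block_word p))))"

definition of_word :: "(nat list \<Rightarrow> 'k) \<Rightarrow> (nat \<Rightarrow> nat) \<Rightarrow> 'k" where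
  "of_word v = (\<Sum>w\<in>arrangements block_content. sc (v w) (delta (coset_rep w)))"

definition induction_kernel :: "((nat \<Rightarrow> nat) \<Rightarrow> 'k) set" where
  "induction_kernel = fs.span {(\<lambda>u. hr N q x s u - \<chi> (block s) * x u) | x s.
    x \<in> hecke N \<and> Suc s < N \<and> block s = block (Suc s)}"

lemma character_square: "\<chi> c * \<chi> c = (q - 1) * \<chi> c + q"
  using character_quadratic[of c] by (simp add: algebra_simps)

lemma block_char_id: "block_char id = 1"
  unfolding block_char_def inversions_id by simp

lemma block_char_block_increasing: "block_increasing p \<Longrightarrow> block_char p = 1"
  unfolding block_char_def block_increasing_def
  by (rule prod.neutral) (auto simp: inversions_def dest: less_asym)

lemma block_char_sgen_comp:
  assumes "p \<in> perms N" "Suc s < N" "inv p s < inv p (Suc s)"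
  shows "block_char (sgen s \<circ> p)
    = (if block (inv p s) = block (inv p (Suc s)) then \<chi> (block (inv p s)) else 1) * block_char p"
  unfolding block_char_def inversions_sgen_comp(1)[OF assms]
  using inversions_sgen_comp(2)[OF assms] finite_inversions by simp

lemma block_char_eq_prod_inv:
  assumes "p \<in> perms N"
  shows "block_char p
    = (\<Prod>(a, b)\<in>inversions N (inv p). if block (inv p a) = block (inv p b) then \<chi> (block (inv p a)) else 1)"
proof -
  let ?g = "\<lambda>(a, b). if block (inv p a) = block (inv p b) then \<chi> (block (inv p a)) else 1"
  have "prod ?g (inversions N (inv p)) = prod (\<lambda>x. ?g (case x of (i, j) \<Rightarrow> (p j, p i))) (inversions N p)"
    by (rule prod.reindex_bij_betw[OF bij_betw_inversions_inv[OF assms], symmetric])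
  also have "\<dots> = block_char p"
    unfolding block_char_def by (rule prod.cong) (use assms in auto)
  finally show ?thesis ..
qed

lemma block_char_comp_sgen:
  assumes p: "p \<in> perms N" and s: "Suc s < N" and up: "p s < p (Suc s)" and same: "block s = block (Suc s)"
  shows "block_char (p \<circ> sgen s) = \<chi> (block s) * block_char p"
proof -
  have up': "inv (inv p) s < inv (inv p) (Suc s)"
    using up p by simp
  show ?thesis
    unfolding block_char_eq_prod_inv[OF sgen_comp_perms(2)[OF s p]] block_char_eq_prod_inv[OF p] inv_comp_sgen[OF p]
      inversions_sgen_comp(1)[OF inv_in_perms[OF p] s up']
    using inversions_sgen_comp(2)[OF inv_in_perms[OF p] s up'] finite_inversions p same
    by (simp add: block_sgen[OF same] cong: if_cong)
qed

interpretation to_word: Vector_Spaces.linear sc sc to_word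
  by (rule linear_mapI)
    (simp_all add: to_word_def fun_eq_iff sum_fun_apply sc_def sum.distrib sum_distrib_left algebra_simps)

interpretation of_word: Vector_Spaces.linear sc sc of_word
  by (rule linear_mapI)
    (simp_all add: of_word_def fun_eq_iff sum_fun_apply sc_def sum.distrib sum_distrib_left algebra_simps)

lemma to_word_delta:
  assumes "p \<in> perms N"
  shows "to_word (delta p) = sc (block_char p) (delta (block_word p))"
proof -
  have "to_word (delta p) = (\<Sum>r\<in>perms N. if r = p then sc (block_char p) (delta (block_word p)) else 0)"
    unfolding to_word_def by (rule sum.cong) (auto simp: delta_def)
  thus ?thesis
    using assms finite_perms by simp
qed

lemma of_word_delta:
  assumes "w \<in> arrangements block_content"
  shows "of_word (delta w) = delta (coset_rep w)"
proof -
  have "of_word (delta w) = (\<Sum>v\<in>arrangements block_content. if v = w then delta (coset_rep w) else 0)"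
    unfolding of_word_def by (rule sum.cong) (auto simp: delta_def)
  thus ?thesis
    using assms by simp
qed

lemma to_word_in_weight_space: "to_word x \<in> weight_space block_content"
  unfolding to_word_def
  by (intro fs.subspace_sum fs.subspace_scale subspace_supp_in delta_in_supp_in block_word_arrangement)

lemma of_word_in_hecke: "of_word v \<in> hecke N"
  unfolding of_word_def
  by (intro fs.subspace_sum fs.subspace_scale delta_in_hecke coset_rep)
    (simp_all add: hecke_eq_supp_in subspace_supp_in)

lemma super_op_quadratic:
  fixes x :: "nat list \<Rightarrow> 'k"
  assumes x: "x \<in> weight_space L" and s: "Suc s < size L"
  shows "super_op q \<chi> s (super_op q \<chi> s x) = sc (q - 1) (super_op q \<chi> s x) + sc q x" (is "?L = ?R")
proof (rule weight_space_ext)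
  show "?L \<in> weight_space L"
    by (intro super_op_in_weight_space x)
  show "?R \<in> weight_space L"
    by (intro fs.subspace_add fs.subspace_scale subspace_supp_in super_op_in_weight_space x)
  fix w assume "mset w = L"
  hence "Suc s < length w"
    using s by auto
  then obtain l a b t where w: "w = l @ a # b # t" "length l = s"
    by (rule split_at_adjacent)
  have "\<chi> a * (\<chi> a * y) = (q - 1) * (\<chi> a * y) + q * y" for y
    using character_square[of a] by (simp add: distrib_right flip: mult.assoc)
  thus "?L w = ?R w"
    unfolding w(1) using w(2)
    by (cases a b rule: linorder_cases) (simp_all add: super_op_append sc_def, simp_all add: algebra_simps)
qed

lemma to_word_sgen_comp:
  assumes p: "p \<in> perms N" and s: "Suc s < N" and "inv p s < inv p (Suc s)"
  shows "to_word (delta (sgen s \<circ> p)) = super_op q \<chi> s (to_word (delta p))"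
proof -
  interpret T: Vector_Spaces.linear sc sc "super_op q \<chi> s"
    by (rule linear_map_super_op)
  have nth: "block_word p ! s = block (inv p s)" "block_word p ! Suc s = block (inv p (Suc s))"
    using s by (simp_all add: nth_block_word)
  have swap: "swap_at s (block_word p) = block_word p" if "block_word p ! s = block_word p ! Suc s"
    using that by (metis list_update_id swap_at_def)
  show ?thesis
    using block_word_le_of_ascent[OF assms] s swap
    by (simp add: to_word_delta p sgen_comp_perms block_word_sgen_comp block_char_sgen_comp[OF assms]
        T.scale super_op_delta nth mult.commute)
qed

lemma to_word_hl:
  assumes x: "x \<in> hecke N" and s: "Suc s < N"
  shows "to_word (hl N q s x) = super_op q \<chi> s (to_word x)"
proof (rule linear_map_eq_on_supp_in[OF finite_perms, where x = x and f = "\<lambda>x. to_word (hl N q s x)"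
      and g = "\<lambda>x. super_op q \<chi> s (to_word x)"])
  interpret T: Vector_Spaces.linear sc sc "super_op q \<chi> s"
    by (rule linear_map_super_op)
  interpret hl: Vector_Spaces.linear sc sc "hl N q s"
    by (rule linear_map_hl)
  show "linear_map (\<lambda>x. to_word (hl N q s x))" "linear_map (\<lambda>x. super_op q \<chi> s (to_word x))"
    by (rule linear_mapI; simp only: to_word.add to_word.scale hl.add hl.scale T.add T.scale)+
  fix p assume p: "p \<in> perms N"
  show "to_word (hl N q s (delta p)) = super_op q \<chi> s (to_word (delta p))"
  proof (cases "inv p s < inv p (Suc s)")
    case True
    thus ?thesis
      by (simp only: hl_delta[OF p s] to_word_sgen_comp[OF p s])
  next
    case False
    define r where "r = sgen s \<circ> p"
    have r: "r \<in> perms N" "p = sgen s \<circ> r"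
      unfolding r_def using sgen_comp_perms(1)[OF s p] by (simp_all only: sgen_comp_cancel)
    have up: "inv r s < inv r (Suc s)"
      using perms_descent[OF inv_in_perms[OF p] False] p by (simp add: r_def inv_sgen_comp)
    have "to_word (hl N q s (delta p)) = sc q (to_word (delta r)) + sc (q - 1) (super_op q \<chi> s (to_word (delta r)))"
      unfolding r(2) hl_delta(2)[OF r(1) s up] to_word.add to_word.scale to_word_sgen_comp[OF r(1) s up] ..
    also have "\<dots> = super_op q \<chi> s (super_op q \<chi> s (to_word (delta r)))"
      using super_op_quadratic[OF to_word_in_weight_space] s by (simp add: size_block_content add.commute)
    finally show ?thesis
      unfolding r(2) to_word_sgen_comp[OF r(1) s up] .
  qed
qed (use x in \<open>simp add: hecke_eq_supp_in\<close>)

lemma to_word_comp_sgen: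
  assumes "p \<in> perms N" "Suc s < N" "p s < p (Suc s)" "block s = block (Suc s)"
  shows "to_word (delta (p \<circ> sgen s)) = sc (\<chi> (block s)) (to_word (delta p))"
  using assms by (simp add: to_word_delta sgen_comp_perms block_word_comp_sgen block_char_comp_sgen)

lemma to_word_hr:
  assumes x: "x \<in> hecke N" and s: "Suc s < N" "block s = block (Suc s)"
  shows "to_word (hr N q x s) = sc (\<chi> (block s)) (to_word x)"
proof (rule linear_map_eq_on_supp_in[OF finite_perms, where x = x and f = "\<lambda>x. to_word (hr N q x s)"
      and g = "\<lambda>x. sc (\<chi> (block s)) (to_word x)"])
  interpret hr: Vector_Spaces.linear sc sc "\<lambda>x. hr N q x s"
    by (rule linear_map_hr)
  show "linear_map (\<lambda>x. to_word (hr N q x s))" "linear_map (\<lambda>x. sc (\<chi> (block s)) (to_word x))"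
    by (rule linear_mapI;
        simp only: to_word.add to_word.scale hr.add hr.scale fs.scale_right_distrib fs.scale_left_commute)+
  fix p assume p: "p \<in> perms N"
  show "to_word (hr N q (delta p) s) = sc (\<chi> (block s)) (to_word (delta p))"
  proof (cases "p s < p (Suc s)")
    case True
    thus ?thesis
      by (simp only: hr_delta[OF p s(1)] to_word_comp_sgen[OF p s(1) _ s(2)])
  next
    case False
    define r where "r = p \<circ> sgen s"
    have r: "r \<in> perms N" "p = r \<circ> sgen s"
      unfolding r_def using sgen_comp_perms(2)[OF s(1) p] by (simp_all only: sgen_comp_cancel)
    have up: "r s < r (Suc s)"
      using perms_descent[OF p False] by (simp add: r_def)
    have "to_word (hr N q (delta p) s) = sc (q + (q - 1) * \<chi> (block s)) (to_word (delta r))"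
      unfolding r(2) hr_delta(2)[OF r(1) s(1) up] to_word.add to_word.scale to_word_comp_sgen[OF r(1) s(1) up s(2)]
        fs.scale_scale fs.scale_left_distrib ..
    also have "q + (q - 1) * \<chi> (block s) = \<chi> (block s) * \<chi> (block s)"
      by (simp add: character_square)
    finally show ?thesis
      unfolding r(2) to_word_comp_sgen[OF r(1) s(1) up s(2)] fs.scale_scale .
  qed
qed (use x in \<open>simp add: hecke_eq_supp_in\<close>)

lemma to_word_induction_kernel:
  assumes "x \<in> induction_kernel"
  shows "to_word x = 0"
proof -
  have "induction_kernel \<subseteq> {x. to_word x = 0}"
    unfolding induction_kernel_def
  proof (rule fs.span_minimal[OF _ to_word.subspace_kernel], safe)
    fix x :: "(nat \<Rightarrow> nat) \<Rightarrow> 'k" and s assume x: "x \<in> hecke N" and s: "Suc s < N" "block s = block (Suc s)"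
    have "(\<lambda>u. hr N q x s u - \<chi> (block s) * x u) = hr N q x s - sc (\<chi> (block s)) x"
      by (simp add: sc_def fun_eq_iff)
    thus "to_word (\<lambda>u. hr N q x s u - \<chi> (block s) * x u) = 0"
      by (simp only: to_word.diff to_word.scale to_word_hr[OF x s] diff_self)
  qed
  thus ?thesis
    using assms by blast
qed

lemma subspace_induction_kernel: "fs.subspace induction_kernel"
  unfolding induction_kernel_def by (rule fs.subspace_span)

lemma delta_comp_sgen_in_kernel:
  assumes p: "p \<in> perms N" and s: "Suc s < N" "block s = block (Suc s)" and up: "p s < p (Suc s)"
  shows "delta (p \<circ> sgen s) - sc (\<chi> (block s)) (delta p) \<in> induction_kernel"
proof -
  have "(\<lambda>u. hr N q (delta p) s u - \<chi> (block s) * delta p u) \<in> induction_kernel"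
    unfolding induction_kernel_def using s delta_in_hecke[OF p] by (intro fs.span_base) blast
  also have "(\<lambda>u. hr N q (delta p) s u - \<chi> (block s) * delta p u) = delta (p \<circ> sgen s) - sc (\<chi> (block s)) (delta p)"
    unfolding hr_delta(1)[OF p s(1) up] by (simp add: fun_eq_iff sc_def)
  finally show ?thesis .
qed

lemma delta_coset_rep_in_kernel:
  assumes "p \<in> perms N"
  shows "delta p - sc (block_char p) (delta (coset_rep (block_word p))) \<in> induction_kernel"
  using assms
proof (induction p rule: coset_induct)
  case (increasing p)
  thus ?case
    using fs.subspace_0[OF subspace_induction_kernel]
    by (simp only: coset_rep_block_word block_char_block_increasing fs.scale_one diff_self)
next
  case (step p s)
  let ?rep = "delta (coset_rep (block_word p)) :: (nat \<Rightarrow> nat) \<Rightarrow> 'k"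
  have "(delta (p \<circ> sgen s) - sc (\<chi> (block s)) (delta p)) + sc (\<chi> (block s)) (delta p - sc (block_char p) ?rep)
      \<in> induction_kernel"
    using step delta_comp_sgen_in_kernel
    by (intro fs.subspace_add[OF subspace_induction_kernel] fs.subspace_scale[OF subspace_induction_kernel])
  also have "(delta (p \<circ> sgen s) - sc (\<chi> (block s)) (delta p)) + sc (\<chi> (block s)) (delta p - sc (block_char p) ?rep)
      = delta (p \<circ> sgen s) - sc (block_char (p \<circ> sgen s)) (delta (coset_rep (block_word (p \<circ> sgen s))))"
    using step by (simp add: block_char_comp_sgen block_word_comp_sgen fs.scale_right_diff_distrib)
  finally show ?case .
qed

lemma to_word_of_word:
  assumes "v \<in> weight_space block_content"
  shows "to_word (of_word v) = v"
  by (rule linear_map_eq_on_supp_in[OF finite_permutations_of_multiset _ _ _ assms,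
        where f = "\<lambda>v. to_word (of_word v)" and g = "\<lambda>v. v"])
    (auto intro!: linear_mapI simp: to_word.add to_word.scale of_word.add of_word.scale of_word_delta to_word_delta
      coset_rep block_char_block_increasing)

lemma of_word_to_word:
  assumes "x \<in> hecke N"
  shows "x - of_word (to_word x) \<in> induction_kernel"
proof (rule linear_map_supp_in_subspace[OF finite_perms _ subspace_induction_kernel,
      where f = "\<lambda>x. x - of_word (to_word x)"])
  show "linear_map (\<lambda>x. x - of_word (to_word x))"
    by (rule linear_mapI)
      (simp_all add: to_word.add to_word.scale of_word.add of_word.scale fs.scale_right_diff_distrib)
  show "delta p - of_word (to_word (delta p)) \<in> induction_kernel" if "p \<in> perms N" for p
    using delta_coset_rep_in_kernel[OF that] that
    by (simp only: to_word_delta of_word.scale of_word_delta block_word_arrangement)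
qed (use assms in \<open>simp add: hecke_eq_supp_in\<close>)

lemma operator_hom_to_word:
  assumes M: "operator_module N T M" and f: "\<And>m. m \<in> M \<Longrightarrow> f m \<in> hecke N"
    and add: "\<And>a b. a \<in> M \<Longrightarrow> b \<in> M \<Longrightarrow> f (a + b) = f a + f b"
    and scale: "\<And>c a. a \<in> M \<Longrightarrow> f (sc c a) = sc c (f a)"
    and equivariant: "\<And>m s. m \<in> M \<Longrightarrow> Suc s < N \<Longrightarrow> f (T s m) - hl N q s (f m) \<in> induction_kernel"
  shows "operator_hom N T M (super_op q \<chi>) (weight_space block_content) (\<lambda>m. to_word (f m))"
proof (intro operator_hom.intro operator_hom_axioms.intro M operator_module_weight_space)
  fix m s assume m: "m \<in> M" "Suc s < N"
  have "to_word (f (T s m) - hl N q s (f m)) = 0"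
    by (rule to_word_induction_kernel[OF equivariant[OF m]])
  thus "to_word (f (T s m)) = super_op q \<chi> s (to_word (f m))"
    by (simp only: to_word.diff to_word_hl[OF f[OF m(1)] m(2)] right_minus_eq)
qed (simp_all only: add scale to_word.add to_word.scale to_word_in_weight_space)

lemma kernel_hom_of_word_to_word:
  assumes add: "\<And>x y. x \<in> hecke N \<Longrightarrow> y \<in> hecke N \<Longrightarrow> g (x + y) = g x + g y"
    and kernel: "\<And>x. x \<in> induction_kernel \<Longrightarrow> g x = 0" and x: "x \<in> hecke N"
  shows "g (of_word (to_word x)) = (g x :: 'b::ab_group_add)"
proof -
  have "x - of_word (to_word x) \<in> hecke N"
    using x of_word_in_hecke unfolding hecke_eq_supp_in by (rule fs.subspace_diff[OF subspace_supp_in])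
  hence "g ((x - of_word (to_word x)) + of_word (to_word x)) = g (x - of_word (to_word x)) + g (of_word (to_word x))"
    by (rule add[OF _ of_word_in_hecke])
  thus ?thesis
    by (simp only: kernel[OF of_word_to_word[OF x]] add_0_left diff_add_cancel)
qed

lemma operator_hom_of_word:
  assumes M: "operator_module N T M" and g: "\<And>x. x \<in> hecke N \<Longrightarrow> g x \<in> M"
    and add: "\<And>x y. x \<in> hecke N \<Longrightarrow> y \<in> hecke N \<Longrightarrow> g (x + y) = g x + g y"
    and scale: "\<And>c x. x \<in> hecke N \<Longrightarrow> g (sc c x) = sc c (g x)"
    and kernel: "\<And>x. x \<in> induction_kernel \<Longrightarrow> g x = 0"
    and equivariant: "\<And>x s. x \<in> hecke N \<Longrightarrow> Suc s < N \<Longrightarrow> g (hl N q s x) = T s (g x)"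
  shows "operator_hom N (super_op q \<chi>) (weight_space block_content) T M (\<lambda>v. g (of_word v))"
proof (intro operator_hom.intro operator_hom_axioms.intro M operator_module_weight_space)
  fix v :: "nat list \<Rightarrow> 'k" and s assume v: "v \<in> weight_space block_content" "Suc s < N"
  have "super_op q \<chi> s v = to_word (hl N q s (of_word v))"
    by (simp add: to_word_hl[OF of_word_in_hecke v(2)] to_word_of_word[OF v(1)])
  thus "g (of_word (super_op q \<chi> s v)) = T s (g (of_word v))"
    by (simp only: kernel_hom_of_word_to_word[OF add kernel hl_in_hecke[OF of_word_in_hecke v(2)]]
        equivariant[OF of_word_in_hecke v(2)])
qed (simp_all only: g add scale of_word_in_hecke of_word.add of_word.scale)

end

definition block_index :: "nat list \<Rightarrow> nat \<Rightarrow> nat" where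
  "block_index lam i = card (breaks lam \<inter> {..i})"

lemma block_index_mono: "i \<le> j \<Longrightarrow> block_index lam i \<le> block_index lam j"
  unfolding block_index_def by (intro card_mono) auto

lemma block_index_Suc: "block_index lam s = block_index lam (Suc s) \<longleftrightarrow> Suc s \<notin> breaks lam"
proof -
  have "breaks lam \<inter> {..Suc s} =
      (if Suc s \<in> breaks lam then insert (Suc s) (breaks lam \<inter> {..s}) else breaks lam \<inter> {..s})"
    by (auto simp: atMost_Suc)
  thus ?thesis
    unfolding block_index_def by auto
qed

lemma par_gens_iff: "s \<in> par_gens N lam \<longleftrightarrow> Suc s < N \<and> block_index lam s = block_index lam (Suc s)"
  by (simp add: par_gens_def block_index_Suc)

lemma one_dim_rep_Suc:
  assumes q: "q \<noteq> 0" and rep: "one_dim_rep q N lam chi" and s: "s \<in> par_gens N lam" "Suc s \<in> par_gens N lam"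
  shows "chi s = chi (Suc s)"
proof -
  have "(chi s - q) * (chi s + 1) = 0" "(chi (Suc s) - q) * (chi (Suc s) + 1) = 0"
    using rep s unfolding one_dim_rep_def by blast+
  hence "chi s \<noteq> 0" "chi (Suc s) \<noteq> 0"
    using q by auto
  moreover have "chi s * chi (Suc s) * chi s = chi (Suc s) * chi s * chi (Suc s)"
    using rep s unfolding one_dim_rep_def by blast
  ultimately show ?thesis
    by simp
qed

lemma one_dim_rep_constant_on_blocks:
  assumes q: "q \<noteq> 0" and rep: "one_dim_rep q N lam chi"
    and s: "s \<in> par_gens N lam" and s': "s' \<in> par_gens N lam"
    and le: "s \<le> s'" and same: "block_index lam s = block_index lam s'"
  shows "chi s = chi s'"
proof -
  have generator: "t \<in> par_gens N lam" if "s \<le> t" "t \<le> s'" for t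
  proof (cases "t = s'")
    case False
    hence "block_index lam s \<le> block_index lam t" "block_index lam t \<le> block_index lam (Suc t)"
      "block_index lam (Suc t) \<le> block_index lam s'"
      using that by (simp_all add: block_index_mono)
    moreover have "Suc t < N"
      using that s' by (simp add: par_gens_iff)
    ultimately show ?thesis
      using same by (simp add: par_gens_iff)
  qed (use s' in simp)
  from le show ?thesis
  proof (induction s' rule: dec_induct)
    case base
    show ?case ..
  next
    case (step t)
    thus ?case
      using one_dim_rep_Suc[OF q rep generator generator, of t] by simp
  qed
qed

lemma one_dim_rep_block_values:
  assumes q: "q \<noteq> 0" and rep: "one_dim_rep q N lam chi"
  obtains \<chi> where "\<And>c. (\<chi> c - q) * (\<chi> c + 1) = 0"
    "\<And>s. s \<in> par_gens N lam \<Longrightarrow> \<chi> (block_index lam s) = chi s"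
proof -
  have "\<exists>v. (v - q) * (v + 1) = 0 \<and> (\<forall>s\<in>par_gens N lam. block_index lam s = c \<longrightarrow> v = chi s)" for c
  proof (cases "\<exists>s\<in>par_gens N lam. block_index lam s = c")
    case True
    then obtain s where s: "s \<in> par_gens N lam" "block_index lam s = c"
      by blast
    have "chi s = chi t" if "t \<in> par_gens N lam" "block_index lam t = c" for t
    proof (cases "s \<le> t")
      case True
      show ?thesis
        by (rule one_dim_rep_constant_on_blocks[OF q rep s(1) that(1) True]) (simp only: s(2) that(2))
    next
      case False
      have "chi t = chi s"
        by (rule one_dim_rep_constant_on_blocks[OF q rep that(1) s(1)]) (use False s(2) that(2) in simp_all)
      thus ?thesis ..
    qed
    thus ?thesis
      using rep s(1) unfolding one_dim_rep_def by blast
  qed (use q in \<open>auto intro: exI[of _ q]\<close>)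
  hence "\<exists>\<chi>. \<forall>c. (\<chi> c - q) * (\<chi> c + 1) = 0 \<and>
      (\<forall>s\<in>par_gens N lam. block_index lam s = c \<longrightarrow> \<chi> c = chi s)"
    by (intro choice allI)
  thus thesis
    using that by blast
qed

lemma ind_kernel_eq_induction_kernel:
  assumes \<chi>: "\<And>s. s \<in> par_gens N lam \<Longrightarrow> \<chi> (block_index lam s) = chi s"
    and "block_character N (block_index lam) q \<chi>"
  shows "ind_kernel N q lam chi = block_character.induction_kernel N (block_index lam) q \<chi>"
proof -
  interpret block_character N "block_index lam" q \<chi> by fact
  have "(x \<in> hecke N \<and> s \<in> par_gens N lam \<and> y = (\<lambda>u. hr N q x s u - chi s * x u)) \<longleftrightarrow>
      (x \<in> hecke N \<and> Suc s < N \<and> block_index lam s = block_index lam (Suc s) \<and>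
        y = (\<lambda>u. hr N q x s u - \<chi> (block_index lam s) * x u))" for x s y
    using \<chi>[of s] by (auto simp: par_gens_iff)
  thus ?thesis
    unfolding ind_kernel_def induction_kernel_def by (intro arg_cong[where f = fs.span]) blast
qed

lemma summand_of_induced_retract:
  fixes q :: "'k::field"
  assumes q: "q \<noteq> 0" and rep: "one_dim_rep q N lam chi" and summand: "summand_of_induced d q R N M lam chi"
    and M: "operator_module N (Rop d R) M"
  obtains L \<chi> f g where "size L = N" "operator_retract N (Rop d R) M (super_op q \<chi>) (weight_space L) f g"
proof -
  obtain \<chi> where quadratic: "\<And>c. (\<chi> c - q) * (\<chi> c + 1) = 0"
    and \<chi>: "\<And>s. s \<in> par_gens N lam \<Longrightarrow> \<chi> (block_index lam s) = chi s"
    using one_dim_rep_block_values[OF q rep] by blast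
  interpret block_character N "block_index lam" q \<chi>
    by unfold_locales (simp_all add: block_index_mono quadratic)
  have kernel: "ind_kernel N q lam chi = induction_kernel"
    using \<chi> block_character_axioms by (rule ind_kernel_eq_induction_kernel)
  obtain f g where f: "\<forall>m\<in>M. f m \<in> hecke N" "\<forall>a\<in>M. \<forall>b\<in>M. f (a + b) = f a + f b"
      "\<forall>c. \<forall>a\<in>M. f (sc c a) = sc c (f a)"
      "\<forall>m\<in>M. \<forall>s. Suc s < N \<longrightarrow> f (Rop d R s m) - hl N q s (f m) \<in> induction_kernel"
    and g: "\<forall>x\<in>hecke N. g x \<in> M" "\<forall>x\<in>hecke N. \<forall>y\<in>hecke N. g (x + y) = g x + g y"
      "\<forall>c. \<forall>x\<in>hecke N. g (sc c x) = sc c (g x)" "\<forall>x\<in>induction_kernel. g x = 0"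
      "\<forall>x\<in>hecke N. \<forall>s. Suc s < N \<longrightarrow> g (hl N q s x) = Rop d R s (g x)"
    and gf: "\<forall>m\<in>M. g (f m) = m"
    using summand unfolding summand_of_induced_def kernel by (elim exE conjE)
  have "operator_hom N (Rop d R) M (super_op q \<chi>) (weight_space block_content) (\<lambda>m. to_word (f m))"
    using f by (intro operator_hom_to_word M) blast+
  moreover have "operator_hom N (super_op q \<chi>) (weight_space block_content) (Rop d R) M (\<lambda>v. g (of_word v))"
    using g by (intro operator_hom_of_word M) blast+
  moreover have "g (of_word (to_word (f m))) = m" if "m \<in> M" for m
    using kernel_hom_of_word_to_word[of g "f m"] f(1) g(2,4) gf that by simp
  ultimately show thesis
    by (intro that[OF size_block_content] operator_retract.intro operator_retract_axioms.intro)
qed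

section \<open>Length generating functions\<close>

definition coinvariant :: "'r::comm_ring_1 \<Rightarrow> nat multiset \<Rightarrow> (nat list \<Rightarrow> 'r) \<Rightarrow> 'r" where
  "coinvariant Q L x = (\<Sum>w\<in>arrangements L. straightening Q UNIV w * x w)"

lemma straightening_swap_at:
  assumes "Suc i < length w" "w ! i < w ! Suc i"
  shows "straightening \<beta> Y (swap_at i w) = \<beta> * straightening \<beta> Y w"
proof -
  obtain s a b t where w: "w = s @ a # b # t" "length s = i"
    using split_at_adjacent[OF assms(1)] .
  hence "a < b"
    using assms(2) by (auto simp: nth_append)
  thus ?thesis
    unfolding w(1) using w(2) by (simp add: swap_at_append straightening_swap)
qed

lemma poly_straightening: "poly (straightening [:0, 1:] UNIV v) c = straightening c UNIV v"
  by (induction v) (simp_all add: letter_coeff_def poly_power)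

lemma hlen_eq_0_iff:
  assumes p: "p \<in> perms N"
  shows "hlen N p = 0 \<longleftrightarrow> p = id"
proof
  assume "hlen N p = 0"
  hence no_inversions: "inversions N p = {}"
    using finite_inversions by (simp add: hlen_eq_card)
  have "p s < p (Suc s)" if "Suc s < N" for s
    using perms_descent[OF p, of s] no_inversions that unfolding inversions_def by blast
  thus "p = id"
    by (rule perms_ascending_eq_id[OF p])
qed (simp only: hlen_id)

context blocks
begin

definition stabilizer_poly :: "'r::comm_ring_1 \<Rightarrow> 'r" where
  "stabilizer_poly Q = (\<Sum>p | p \<in> perms N \<and> block_word p = sorted_word block_content. Q ^ hlen N p)"

lemma sum_over_coset:
  fixes Q :: "'r::comm_ring_1"
  shows "mset w = block_content \<Longrightarrow>
    (\<Sum>p | p \<in> perms N \<and> block_word p = w. Q ^ hlen N p) = straightening Q UNIV w * stabilizer_poly Q"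
proof (induction w rule: bubble_induct)
  case (sorted w)
  hence "w = sorted_word block_content"
    using sorted_eq_sorted_word[OF sorted(1)] by simp
  thus ?case
    by (simp add: stabilizer_poly_def straightening_sorted_word)
next
  case (swap s a b t)
  let ?i = "length s" and ?u = "s @ a # b # t" and ?w = "s @ b # a # t"
  have content: "mset ?u = block_content"
    using swap(3) by (simp add: add_mset_commute)
  have i: "Suc ?i < N"
    using arg_cong[OF content, of size] by (simp add: size_block_content)
  have u: "swap_at ?i ?u = ?w" "swap_at ?i ?w = ?u" "?u ! ?i < ?u ! Suc ?i"
    using swap(1) by (simp_all add: swap_at_append nth_append)
  have "(\<Sum>p | p \<in> perms N \<and> block_word p = ?w. Q ^ hlen N p)
      = (\<Sum>p | p \<in> perms N \<and> block_word p = ?u. Q ^ hlen N (sgen ?i \<circ> p))"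
    by (rule sum.reindex_bij_witness[of _ "\<lambda>p. sgen ?i \<circ> p" "\<lambda>p. sgen ?i \<circ> p"])
      (use i u in \<open>simp_all only: mem_Collect_eq sgen_comp_perms block_word_sgen_comp sgen_comp_cancel simp_thms\<close>)
  also have "\<dots> = (\<Sum>p | p \<in> perms N \<and> block_word p = ?u. Q * Q ^ hlen N p)"
    by (rule sum.cong[OF refl])
      (use i u(3) in \<open>auto simp: hlen_sgen_comp ascent_of_block_word simp del: o_apply comp_apply\<close>)
  also have "\<dots> = Q * (straightening Q UNIV ?u * stabilizer_poly Q)"
    using swap.IH[OF content] by (simp flip: sum_distrib_left)
  finally show ?case
    by (simp add: straightening_swap[OF swap(1)] mult.assoc)
qed

lemma sum_perms_block_word:
  fixes Q :: "'r::comm_ring_1"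
  shows "(\<Sum>p\<in>perms N. Q ^ hlen N p * F (block_word p))
    = stabilizer_poly Q * coinvariant Q block_content F"
proof -
  have "(\<Sum>p\<in>perms N. Q ^ hlen N p * F (block_word p))
      = (\<Sum>w\<in>arrangements block_content. \<Sum>p | p \<in> perms N \<and> block_word p = w. Q ^ hlen N p * F (block_word p))"
    using block_word_arrangement by (intro sum.group[symmetric] finite_perms) auto
  also have "\<dots> = (\<Sum>w\<in>arrangements block_content. (\<Sum>p | p \<in> perms N \<and> block_word p = w. Q ^ hlen N p) * F w)"
    by (simp add: sum_distrib_right)
  also have "\<dots> = (\<Sum>w\<in>arrangements block_content. stabilizer_poly Q * (straightening Q UNIV w * F w))"
    by (rule sum.cong) (auto simp: sum_over_coset permutations_of_multiset_def ac_simps)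
  finally show ?thesis
    by (simp add: coinvariant_def sum_distrib_left)
qed

lemma stabilizer_poly_nonzero: "stabilizer_poly [:0, 1:] \<noteq> (0 :: 'k::field poly)"
proof -
  have "poly (stabilizer_poly [:0, 1:]) (0 :: 'k)
      = (\<Sum>p | p \<in> perms N \<and> block_word p = sorted_word block_content. if p = id then 1 else 0)"
    unfolding stabilizer_poly_def poly_sum
    by (rule sum.cong) (auto simp: poly_power power_0_left hlen_eq_0_iff)
  also have "\<dots> = 1"
    using finite_perms by (simp add: id_in_perms block_word_id)
  finally show ?thesis
    by auto
qed

text \<open>A function of \<open>p\<close> that is constant on double cosets has the same length generating function as its composition
  with \<open>p \<mapsto> p\<inverse>\<close>. Passing from \<open>p\<close> to minimal coset representatives divides both by the Poincare polynomial of
  the parabolic subgroup, which may vanish at \<open>c\<close>; hence the indeterminate.\<close>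
lemma coinvariant_inverse_coset_rep:
  fixes F :: "nat list \<Rightarrow> 'k::field"
  assumes invariant:
    "\<And>w s. w \<in> arrangements block_content \<Longrightarrow> Suc s < N \<Longrightarrow> block s = block (Suc s) \<Longrightarrow> F (swap_at s w) = F w"
  shows "coinvariant c block_content F = coinvariant c block_content (\<lambda>w. F (block_word (inv (coset_rep w))))"
proof -
  define Q :: "'k poly" where "Q = [:0, 1:]"
  define F' where "F' w = F (block_word (inv (coset_rep w)))" for w
  have F': "F' (block_word p) = F (block_word (inv p))" if "p \<in> perms N" for p
    using that
  proof (induction p rule: coset_induct)
    case (increasing p)
    thus ?case
      by (simp add: F'_def coset_rep_block_word)
  next
    case (step p s)
    thus ?case
      using invariant[OF block_word_arrangement[OF inv_in_perms[OF step(1)]]]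
      by (simp only: block_word_comp_sgen inv_comp_sgen block_word_sgen_comp inv_in_perms)
  qed
  have "stabilizer_poly Q * coinvariant Q block_content (\<lambda>w. [:F w:])
      = (\<Sum>p\<in>perms N. Q ^ hlen N p * [:F (block_word p):])"
    by (rule sum_perms_block_word[symmetric])
  also have "\<dots> = (\<Sum>p\<in>perms N. Q ^ hlen N p * [:F' (block_word p):])"
    by (rule sum.reindex_bij_witness[of _ inv inv]) (auto simp: inv_in_perms hlen_inv F')
  also have "\<dots> = stabilizer_poly Q * coinvariant Q block_content (\<lambda>w. [:F' w:])"
    by (rule sum_perms_block_word)
  finally have "coinvariant Q block_content (\<lambda>w. [:F w:]) = coinvariant Q block_content (\<lambda>w. [:F' w:])"
    using stabilizer_poly_nonzero[where 'k = 'k] by (simp add: Q_def)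
  from arg_cong[where f = "\<lambda>x. poly x c", OF this] show ?thesis
    by (simp add: coinvariant_def poly_sum Q_def poly_straightening F'_def mult.commute)
qed

end

section \<open>Endomorphisms of trivially induced modules\<close>

definition word_form ::
  "'k::field \<Rightarrow> nat multiset \<Rightarrow> (nat list \<Rightarrow> 'k) \<Rightarrow> (nat list \<Rightarrow> 'k) \<Rightarrow> 'k" where
  "word_form q L x y = coinvariant q L (\<lambda>w. x w * y w)"

lemma word_form_delta: "w \<in> arrangements L \<Longrightarrow> word_form q L x (delta w) = straightening q UNIV w * x w"
  by (simp add: word_form_def coinvariant_def sum_mult_delta flip: mult.assoc)

lemma word_form_scale:
  "word_form q L (sc c x) y = c * word_form q L x y"
  "word_form q L x (sc c y) = c * word_form q L x y"
  by (simp_all add: word_form_def coinvariant_def sc_def sum_distrib_left ac_simps)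

lemma word_form_super_op:
  assumes i: "Suc i < size L"
  shows "word_form q L (super_op q (\<lambda>_. q) i x) y = word_form q L x (super_op q (\<lambda>_. q) i y)"
proof -
  have length: "Suc i < length w" if "w \<in> arrangements L" for w
    using that i by (auto simp: permutations_of_multiset_def)
  show ?thesis
    unfolding word_form_def coinvariant_def sum_arrangements_swap[OF i]
    by (rule arg_cong2[where f = "(+)"]; rule sum.cong[OF refl])
      (auto simp: length super_op_def straightening_swap_at nth_swap_at swap_at_swap_at algebra_simps)
qed

definition all_ones :: "nat multiset \<Rightarrow> nat list \<Rightarrow> 'k::field" where
  "all_ones L = (\<Sum>w\<in>arrangements L. delta w)"

lemma all_ones_apply: "all_ones L w = (if mset w = L then 1 else 0)"
proof -
  have "all_ones L w = (\<Sum>v\<in>arrangements L. if w = v then 1 else 0)"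
    unfolding all_ones_def sum_fun_apply by (simp add: delta_def)
  also have "\<dots> = (if w \<in> arrangements L then 1 else 0)"
    by simp
  finally show ?thesis
    by (simp add: permutations_of_multiset_def)
qed

lemma all_ones_in_weight_space: "all_ones L \<in> weight_space L"
  by (simp add: weight_space_iff all_ones_apply)

lemma sorted_word_arrangement: "sorted_word L \<in> arrangements L"
  by (simp add: permutations_of_multiset_def)

lemma delta_in_weight_space: "w \<in> arrangements L \<Longrightarrow> delta w \<in> weight_space L"
  by (rule delta_in_supp_in)

locale trivial_character = blocks N block for N :: nat and block :: "nat \<Rightarrow> nat" +
  fixes q :: "'k::field" and e :: "(nat list \<Rightarrow> 'k) \<Rightarrow> nat list \<Rightarrow> 'k"
  assumes endomorphism: "operator_hom N (super_op q (\<lambda>_. q)) (weight_space block_content)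
    (super_op q (\<lambda>_. q)) (weight_space block_content) e"
begin

sublocale block_character N block q "\<lambda>_. q"
  by unfold_locales simp

interpretation e: operator_hom N "super_op q (\<lambda>_. q)" "weight_space block_content"
    "super_op q (\<lambda>_. q)" "weight_space block_content" e
  by (rule endomorphism)

lemma block_char_straightening:
  assumes "p \<in> perms N"
  shows "block_char p * straightening q UNIV (block_word p) = q ^ hlen N p"
  using assms
proof (induction p rule: perms_induct)
  case id
  show ?case
    by (simp only: block_char_id block_word_id straightening_sorted_word repeats_in_UNIV hlen_id power_0 mult_1)
next
  case (step p s)
  let ?w = "block_word p"
  have nth: "?w ! s = block (inv p s)" "?w ! Suc s = block (inv p (Suc s))"
    using step(2) by (simp_all add: nth_block_word)
  have hlen: "q ^ hlen N (sgen s \<circ> p) = q * q ^ hlen N p"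
    by (simp only: hlen_sgen_comp[OF step(1-3)] power_Suc)
  show ?case
  proof (cases "?w ! s = ?w ! Suc s")
    case True
    hence "swap_at s ?w = ?w"
      by (metis list_update_id swap_at_def)
    thus ?thesis
      using True step.IH
      by (simp only: hlen block_char_sgen_comp[OF step(1-3)] block_word_sgen_comp[OF step(1,2)] nth mult.assoc) simp
  next
    case False
    hence "?w ! s < ?w ! Suc s"
      using block_word_le_of_ascent[OF step(1-3)] by simp
    thus ?thesis
      using False step.IH step(2)
      unfolding hlen block_char_sgen_comp[OF step(1-3)] block_word_sgen_comp[OF step(1,2)] nth[symmetric]
      by (simp add: straightening_swap_at mult.left_commute)
  qed
qed

text \<open>The inclusion of the inversions means \<open>T_g = T_{p\<inverse>} T_{p g}\<close>, and \<open>T_{p\<inverse>}\<close> is the adjoint of \<open>T_p\<close>.\<close>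
lemma word_form_endomorphism:
  assumes p: "p \<in> perms N" and g: "g \<in> perms N"
  shows "inversions N (p \<circ> g) \<subseteq> inversions N g \<Longrightarrow>
    word_form q block_content (e (to_word (delta p))) (to_word (delta (p \<circ> g)))
      = word_form q block_content (e (to_word (delta id))) (to_word (delta g))"
  using p
proof (induction p rule: perms_induct)
  case (step p s)
  let ?\<phi> = "\<lambda>p. to_word (delta p)" and ?T = "super_op q (\<lambda>_. q) s"
  define r where "r = sgen s \<circ> p \<circ> g"
  note inversions = inversions_subset_step[OF step(1) g step(2,3,5), folded r_def]
  have r: "r \<in> perms N" "p \<circ> g = sgen s \<circ> r"
    using sgen_comp_perms(1)[OF step(2,1)] g by (auto simp: r_def perms_def permutes_compose fun_eq_iff)
  have "word_form q block_content (e (?\<phi> (sgen s \<circ> p))) (?\<phi> r) = word_form q block_content (?T (e (?\<phi> p))) (?\<phi> r)"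
    by (simp only: to_word_sgen_comp[OF step(1-3)] e.equivariant[OF to_word_in_weight_space step(2)])
  also have "\<dots> = word_form q block_content (e (?\<phi> p)) (?T (?\<phi> r))"
    using step(2) by (intro word_form_super_op) (simp add: size_block_content)
  also have "\<dots> = word_form q block_content (e (?\<phi> p)) (?\<phi> (p \<circ> g))"
    by (simp only: r(2) to_word_sgen_comp[OF r(1) step(2) inversions(1)])
  finally show ?case
    using step.IH[OF inversions(2)] by (simp only: r_def)
qed simp

lemma endomorphism_delta_sorted:
  assumes w: "w \<in> arrangements block_content"
  shows "e (delta w) (sorted_word block_content)
    = straightening q UNIV w * e (delta (sorted_word block_content)) (block_word (inv (coset_rep w)))"
proof -
  define p where "p = coset_rep w"
  have p: "p \<in> perms N" "block_char p = 1" "block_word p = w"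
    using coset_rep[OF w] block_char_block_increasing unfolding p_def by auto
  note p' = inv_in_perms[OF p(1)]
  let ?v = "sorted_word block_content" and ?w' = "block_word (inv p)"
  have id: "p \<circ> inv p = id"
    using p(1) by (simp add: fun_eq_iff)
  have "word_form q block_content (e (to_word (delta p))) (to_word (delta id))
      = word_form q block_content (e (to_word (delta id))) (to_word (delta (inv p)))"
    using word_form_endomorphism[OF p(1) p'] unfolding id inversions_id by simp
  hence "straightening q UNIV ?v * e (delta w) ?v
      = block_char (inv p) * (straightening q UNIV ?w' * e (delta ?v) ?w')"
    by (simp add: to_word_delta p(1) p' id_in_perms p(2,3) block_char_id block_word_id word_form_scale
        word_form_delta sorted_word_arrangement block_word_arrangement)
  also have "\<dots> = straightening q UNIV w * e (delta ?v) ?w'"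
    using block_char_straightening[OF p'] block_char_straightening[OF p(1)]
    by (simp add: hlen_inv[OF p(1)] p(2,3) flip: mult.assoc)
  finally show ?thesis
    by (simp add: straightening_sorted_word p_def)
qed

lemma swap_rule_one_swap_at:
  assumes rule: "swap_rule 1 Y i x" and i: "Suc i < length w"
  shows "x (swap_at i w) = x w"
proof (cases "w ! i" "w ! Suc i" rule: linorder_cases)
  case less
  thus ?thesis
    using rule i by (simp add: swap_rule_def)
next
  case equal
  thus ?thesis
    by (metis list_update_id swap_at_def)
next
  case greater
  hence "x (swap_at i w) = 1 * x (swap_at i (swap_at i w))"
    using rule i unfolding swap_rule_def by (simp add: nth_swap_at)
  thus ?thesis
    by (simp add: swap_at_swap_at[OF i])
qed

lemma swap_at_endomorphism_sorted:
  assumes w: "w \<in> arrangements block_content" and s: "Suc s < N" "block s = block (Suc s)"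
  shows "e (delta (sorted_word block_content)) (swap_at s w) = e (delta (sorted_word block_content)) w"
proof -
  let ?v = "sorted_word block_content"
  have v: "?v ! s = ?v ! Suc s" "Suc s < length ?v"
    using s by (simp_all add: block_word_id[symmetric] nth_block_word)
  have "super_op q (\<lambda>_. q) s (e (delta ?v)) = e (sc q (delta ?v))"
    using super_op_delta[OF v(2), of q "\<lambda>_. q"] v(1) s(1)
    by (simp flip: e.equivariant[OF delta_in_weight_space[OF sorted_word_arrangement]])
  also have "\<dots> = sc q (e (delta ?v))"
    by (rule e.scale[OF delta_in_weight_space[OF sorted_word_arrangement]])
  finally have "swap_rule 1 {c. q \<noteq> q} s (e (delta ?v))"
    using s(1) e.maps[OF delta_in_weight_space[OF sorted_word_arrangement]]
    by (subst (asm) super_op_eq_scale_iff[where L = block_content]) (simp_all add: size_block_content)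
  moreover have "Suc s < length w"
    using arg_cong[OF permutations_of_multisetD[OF w], of size] s(1) by (simp add: size_block_content)
  ultimately show ?thesis
    by (rule swap_rule_one_swap_at)
qed

lemma endomorphism_all_ones_sorted:
  "e (all_ones block_content) (sorted_word block_content)
    = coinvariant q block_content (e (delta (sorted_word block_content)))"
proof -
  have "e (all_ones block_content) (sorted_word block_content)
      = (\<Sum>w\<in>arrangements block_content. e (delta w) (sorted_word block_content))"
    unfolding all_ones_def by (subst e.sum) (simp_all add: delta_in_weight_space sum_fun_apply)
  also have "\<dots> = coinvariant q block_content
      (\<lambda>w. e (delta (sorted_word block_content)) (block_word (inv (coset_rep w))))"
    unfolding coinvariant_def by (intro sum.cong refl endomorphism_delta_sorted)
  also have "\<dots> = coinvariant q block_content (e (delta (sorted_word block_content)))"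
    by (rule coinvariant_inverse_coset_rep[OF swap_at_endomorphism_sorted, symmetric])
  finally show ?thesis .
qed

end

section \<open>Invariants and coinvariants\<close>

lemma coinvariant_diff_scale: "coinvariant q L (x - sc c y) = coinvariant q L x - c * coinvariant q L y"
  unfolding coinvariant_def by (simp add: sc_def sum_subtractf sum_distrib_left algebra_simps)

lemma coinvariant_delta_sorted: "coinvariant q L (delta (sorted_word L)) = 1"
  by (simp add: coinvariant_def sum_mult_delta sorted_word_arrangement straightening_sorted_word)

lemma all_ones_nonzero: "all_ones L \<noteq> 0"
  by (rule notI, drule fun_cong[of _ _ "sorted_word L"]) (simp add: all_ones_apply)

lemma joint_relations_Skew_trivial:
  "joint_relations Skew (super_op q (\<lambda>_. q)) q (weight_space L) (size L) = fs.span {all_ones L}"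
proof -
  have "x \<in> fs.span {all_ones L}" if x: "x \<in> swap_rule_space 1 {} L (size L)" for x :: "nat list \<Rightarrow> 'a"
  proof -
    have "x = sc (x (rev (sorted_word L))) (all_ones L)"
    proof (rule weight_space_ext[OF swap_rule_spaceD(1)[OF x]])
      show "sc (x (rev (sorted_word L))) (all_ones L) \<in> weight_space L"
        by (intro fs.subspace_scale subspace_supp_in all_ones_in_weight_space)
      fix w assume w: "mset w = L"
      hence "x w = straightening 1 (- {}) (rev w) * x (rev (sorted_word (mset w)))"
        by (intro swap_rule_straightening[OF swap_rule_spaceD(2)[OF x]]) (auto simp flip: size_mset)
      thus "x w = sc (x (rev (sorted_word L))) (all_ones L) w"
        using w by (simp add: straightening_one sc_def all_ones_apply)
    qed
    thus ?thesis
      by (metis fs.span_base fs.span_scale singletonI)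
  qed
  moreover have "all_ones L \<in> swap_rule_space 1 {} L (size L)"
    by (simp add: swap_rule_space_def all_ones_in_weight_space swap_rule_iff_append all_ones_apply
        add_mset_commute)
  ultimately show ?thesis
    using joint_relations_weight_space[of "size L" L Skew q "\<lambda>_. q"]
      operator_module.subspace_joint_relations[OF operator_module_weight_space, of Skew q "\<lambda>_. q" q L "size L"]
    by (auto simp: twist_def repeatable_def fs.span_minimal intro: subsetD[OF fs.span_minimal])
qed

lemma relation_span_Sym_trivial:
  "relation_span Sym (super_op q (\<lambda>_. q)) q (weight_space L) (size L) 0 = {x \<in> weight_space L. coinvariant q L x = 0}"
proof -
  interpret weight_complex Sym q "\<lambda>_. q" L .
  have "normal_coeff x [] = coinvariant q L x" for x
    by (simp add: normal_coeff_def coinvariant_def twist_def repeatable_def)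
  thus ?thesis
    using normal_coeff_eq_0[of _ 0 "[]"] in_Z_of_normal_coeff_eq_0[of _ 0]
      operator_module.relation_span_subset[OF operator_module_weight_space, of Sym q "\<lambda>_. q" q L "size L" 0]
    by (auto simp: joint_relations_le_1)
qed

lemma endomorphism_all_ones:
  assumes e: "operator_hom (size L) (super_op q (\<lambda>_. q)) (weight_space L) (super_op q (\<lambda>_. q)) (weight_space L) e"
  shows "e (all_ones L) = sc (coinvariant q L (e (delta (sorted_word L)))) (all_ones L)"
proof -
  interpret e: operator_hom "size L" "super_op q (\<lambda>_. q)" "weight_space L" "super_op q (\<lambda>_. q)" "weight_space L" e
    by (rule e)
  interpret b: blocks "size L" "\<lambda>i. sorted_word L ! i"
    by unfold_locales (simp add: sorted_nth_mono flip: size_mset)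
  have "length (sorted_word L) = size L"
    by (simp flip: size_mset)
  hence "map ((!) (sorted_word L)) [0..<size L] = sorted_word L"
    using map_nth[of "sorted_word L"] by simp
  hence content: "b.block_content = L"
    by (simp add: b.block_content_def)
  interpret trivial_character "size L" "\<lambda>i. sorted_word L ! i" q e
    by (rule trivial_character.intro[OF b.blocks_axioms]) (simp add: trivial_character_axioms_def content e)
  have "e (all_ones L) \<in> fs.span {all_ones L}"
    using e.maps_joint_relations[OF order_refl, of "all_ones L" Skew q]
    by (simp add: joint_relations_Skew_trivial fs.span_base)
  then obtain c where c: "e (all_ones L) = sc c (all_ones L)"
    by (auto simp: fs.span_singleton)
  have "c = e (all_ones L) (sorted_word L)"
    by (simp add: c sc_def all_ones_apply)
  also have "\<dots> = coinvariant q L (e (delta (sorted_word L)))"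
    using endomorphism_all_ones_sorted by (simp add: content)
  finally show ?thesis
    using c by simp
qed

lemma coinvariant_endomorphism:
  assumes e: "operator_hom (size L) (super_op q (\<lambda>_. q)) (weight_space L) (super_op q (\<lambda>_. q)) (weight_space L) e"
    and x: "x \<in> weight_space L"
  shows "coinvariant q L (e x) = coinvariant q L x * coinvariant q L (e (delta (sorted_word L)))"
proof -
  interpret e: operator_hom "size L" "super_op q (\<lambda>_. q)" "weight_space L" "super_op q (\<lambda>_. q)" "weight_space L" e
    by (rule e)
  let ?v = "delta (sorted_word L)" and ?c = "coinvariant q L x"
  have v: "?v \<in> weight_space L" "sc ?c ?v \<in> weight_space L"
    using delta_in_weight_space[OF sorted_word_arrangement] by (auto intro: fs.subspace_scale subspace_supp_in)
  have "x - sc ?c ?v \<in> relation_span Sym (super_op q (\<lambda>_. q)) q (weight_space L) (size L) 0"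
    unfolding relation_span_Sym_trivial using x v
    by (simp add: coinvariant_diff_scale coinvariant_delta_sorted fs.subspace_diff[OF subspace_supp_in])
  from e.maps_relation_span[OF this] have "coinvariant q L (e (x - sc ?c ?v)) = 0"
    by (simp add: relation_span_Sym_trivial)
  thus ?thesis
    by (simp only: e.diff[OF x v(2)] e.scale[OF v(1)] coinvariant_diff_scale right_minus_eq)
qed

lemma dim_invariants_coinvariants_even:
  assumes "operator_retract (size L) T M (super_op q (\<lambda>_. q)) (weight_space L) f g" and fin: "fs.fin_dim M"
  shows "fs.dim (joint_relations Skew T q M (size L)) + fs.dim (relation_span Sym T q M (size L) 0) = fs.dim M"
proof -
  interpret operator_retract "size L" T M "super_op q (\<lambda>_. q)" "weight_space L" f g by fact
  let ?one = "all_ones L" and ?\<pi> = "coinvariant q L"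
  define A where "A = ?\<pi> (f (g (delta (sorted_word L))))"
  note e = operator_hom_compose[OF g.operator_hom_axioms f.operator_hom_axioms]
  have "f (g ?one) = sc A ?one"
    using endomorphism_all_ones[OF e] by (simp add: A_def)
  hence one: "g ?one = 0 \<longleftrightarrow> A = 0"
    using retract[OF g.maps[OF all_ones_in_weight_space]] f.zero g.zero all_ones_nonzero
    by (metis fs.scale_eq_0_iff)
  have "?\<pi> (f m) = ?\<pi> (f m) * A" if "m \<in> M" for m
    using coinvariant_endomorphism[OF e f.maps[OF that]] retract[OF that] by (simp add: A_def)
  hence functional: "(\<forall>m\<in>M. ?\<pi> (f m) = 0) \<longleftrightarrow> A = 0"
    using g.maps[OF delta_in_weight_space[OF sorted_word_arrangement]] by (auto simp: A_def)
  have "joint_relations Skew T q M (size L) = fs.span {g ?one}"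
    unfolding joint_relations_eq_image[OF order_refl] joint_relations_Skew_trivial
    by (simp add: fs.span_singleton image_image g.scale all_ones_in_weight_space)
  moreover have "fs.dim (fs.span {g ?one}) = (if A = 0 then 0 else 1)"
    using one fs.dim_span_singleton[of "g ?one"] by (cases "A = 0") simp_all
  moreover have "relation_span Sym T q M (size L) 0 = {m \<in> M. ?\<pi> (f m) = 0}"
    unfolding relation_span_eq_preimage relation_span_Sym_trivial using f.maps by blast
  moreover have "fs.dim {m \<in> M. ?\<pi> (f m) = 0} + (if \<forall>m\<in>M. ?\<pi> (f m) = 0 then 0 else 1) = fs.dim M"
    by (rule fs.dim_functional_kernel[OF f.source.subspace fin])
      (simp only: f.diff f.scale fs.subspace_scale[OF f.source.subspace] coinvariant_diff_scale)
  ultimately show ?thesis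
    using functional by simp
qed

lemma joint_relations_Skew_odd:
  fixes q :: "'k::field"
  assumes odd: "\<not> repeats_in {c. \<chi> c = q} L"
  shows "joint_relations Skew (super_op q \<chi>) q (weight_space L) (size L) = {0}" (is "?J = _")
proof -
  have "x = 0" if x: "x \<in> ?J" for x
  proof (rule weight_space_ext)
    have x_rule: "x \<in> swap_rule_space 1 {c. \<chi> c \<noteq> q} L (size L)"
      using x by (simp add: joint_relations_weight_space twist_def repeatable_def)
    show "x \<in> weight_space L"
      using x_rule by (rule swap_rule_spaceD)
    fix w assume w: "mset w = L"
    have "\<not> repeats_in (- {c. \<chi> c \<noteq> q}) (mset (rev w))"
      using odd w by (simp add: Collect_neg_eq[symmetric])
    hence "straightening 1 (- {c. \<chi> c \<noteq> q}) (rev w) = (0 :: 'k)"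
      by (rule straightening_eq_0)
    thus "x w = 0 w"
      using swap_rule_straightening[OF swap_rule_spaceD(2)[OF x_rule], where u = w] w
      by (auto simp flip: size_mset)
  qed (use fs.subspace_0[OF subspace_supp_in] in blast)
  thus ?thesis
    using fs.subspace_0[OF operator_module.subspace_joint_relations[OF operator_module_weight_space]] by blast
qed

lemma relation_span_Sym_odd:
  assumes odd: "\<not> repeats_in {c. \<chi> c = q} L"
  shows "relation_span Sym (super_op q \<chi>) q (weight_space L) (size L) 0 = weight_space L"
proof -
  interpret weight_complex Sym q \<chi> L .
  have "x \<in> Z 0" if "x \<in> weight_space L" for x
  proof (rule in_Z_of_normal_coeff_eq_0)
    show "x \<in> J 0"
      using that by (simp add: joint_relations_le_1)
    show "normal_coeff x u = 0" if "length u = 0" for u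
      using odd that by (intro normal_coeff_no_repeats) (simp add: repeatable_def)
  qed simp
  thus ?thesis
    using operator_module.relation_span_subset[OF operator_module_weight_space] by blast
qed

lemma super_op_even_cong:
  assumes even: "repeats_in {c. \<chi> c = q} L" and x: "x \<in> weight_space L"
  shows "super_op q \<chi> i x = super_op q (\<lambda>_. q) i x"
proof (rule weight_space_ext)
  fix w assume w: "mset w = L"
  show "super_op q \<chi> i x w = super_op q (\<lambda>_. q) i x w"
  proof (cases "Suc i < length w")
    case True
    then obtain s a b t where s: "w = s @ a # b # t" "length s = i"
      by (rule split_at_adjacent)
    have "\<chi> a = q" if "a = b"
    proof (rule ccontr)
      assume "\<chi> a \<noteq> q"
      hence "count L a \<le> 1"
        using even unfolding repeats_in_def by blast
      thus False
        using w s(1) that by auto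
    qed
    thus ?thesis
      unfolding s(1) using s(2) by (simp add: super_op_append)
  qed (simp add: super_op_def)
qed (intro super_op_in_weight_space x)+

lemma koszul_balanced_retract:
  assumes L: "L \<noteq> {#}" and retraction: "operator_retract (size L) T M (super_op q \<chi>) (weight_space L) f g"
    and fin: "fs.fin_dim M"
  shows "koszul_balanced (size L) T q M"
  unfolding koszul_balanced_def
proof
  interpret operator_retract "size L" T M "super_op q \<chi>" "weight_space L" f g by (rule retraction)
  show "\<forall>k. koszul_exact k T q M (size L)"
    using koszul_exact weight_complex.koszul_exact_weight_space[OF L] by blast
  show "fs.dim (joint_relations Skew T q M (size L)) + fs.dim (relation_span Sym T q M (size L) 0) = fs.dim M"
  proof (cases "repeats_in {c. \<chi> c = q} L")
    case True
    hence "operator_retract (size L) T M (super_op q (\<lambda>_. q)) (weight_space L) f g"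
      by (intro operator_retract_cong[OF retraction operator_module_weight_space] super_op_even_cong)
    thus ?thesis
      using fin by (rule dim_invariants_coinvariants_even)
  next
    case False
    have "joint_relations Skew T q M (size L) = {0}"
      unfolding joint_relations_eq_image[OF order_refl] joint_relations_Skew_odd[OF False] by (simp add: g.zero)
    moreover have "relation_span Sym T q M (size L) 0 = M"
      unfolding relation_span_eq_preimage relation_span_Sym_odd[OF False] using f.maps by blast
    ultimately show ?thesis
      by simp
  qed
qed

section \<open>Decomposition of the tensor powers\<close>

lemma finite_words: "finite (words d n)"
proof -
  have "words d n = {xs. set xs \<subseteq> {..<d} \<and> length xs = n}"
    by (auto simp: words_def)
  thus ?thesis
    using finite_lists_length_eq[of "{..<d}" n] by simp
qed

lemma tens_eq_supp_in: "tens d n = supp_in (words d n)"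
  by (simp add: tens_def supp_in_def)

lemma delta_in_tens: "v \<in> words d n \<Longrightarrow> delta v \<in> tens d n"
  unfolding tens_eq_supp_in by (rule delta_in_supp_in)

lemma fin_dim_tens: "fs.fin_dim (tens d n)"
  unfolding tens_eq_supp_in by (rule fin_dim_supp_in[OF finite_words])

lemma subspace_tens: "fs.subspace (tens d n)"
  unfolding tens_eq_supp_in by (rule subspace_supp_in)

lemma linear_map_Rop: "linear_map (Rop d R i)"
  by (rule linear_mapI) (auto simp: Rop_def sc_def fun_eq_iff sum.distrib sum_distrib_left algebra_simps)

lemma Rop_in_tens: "x \<in> tens d n \<Longrightarrow> Rop d R i x \<in> tens d n"
  by (auto simp: tens_def Rop_def words_def intro!: sum.neutral)

lemma operator_module_tens: "operator_module n (Rop d R) (tens d n)"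
  by (rule operator_module.intro) (simp_all add: linear_map_Rop subspace_tens Rop_in_tens)

lemma inv_sub_iff: "inv_sub d R n M \<longleftrightarrow> operator_module n (Rop d R) M \<and> M \<subseteq> tens d n"
  unfolding inv_sub_def operator_module_def using linear_map_Rop by blast

lemma inv_sub_set_plus:
  assumes "inv_sub d R n A" "inv_sub d R n B"
  shows "inv_sub d R n (A + B)"
proof -
  interpret Rop: Vector_Spaces.linear sc sc "Rop d R i" for i
    by (rule linear_map_Rop)
  have "operator_module n (Rop d R) (A + B)"
    using assms unfolding inv_sub_iff operator_module_def
    by (auto elim!: set_plus_elim simp: Rop.add fs.subspace_set_plus intro!: set_plus_intro)
  moreover have "A + B \<subseteq> tens d n"
    using assms unfolding inv_sub_iff
    by (auto elim!: set_plus_elim intro!: fs.subspace_add[OF subspace_tens])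
  ultimately show ?thesis
    by (simp add: inv_sub_iff)
qed

lemma Int_set_plus_eq_zero:
  fixes A B C :: "('a \<Rightarrow> 'k::field) set"
  assumes subspaces: "fs.subspace A" "fs.subspace B" "fs.subspace C"
    and int: "A \<inter> B = {0}" "(A + B) \<inter> C = {0}"
  shows "A \<inter> (B + C) = {0}"
proof -
  have "x = 0" if x: "x \<in> A" "x \<in> B + C" for x
  proof -
    obtain b c where bc: "x = b + c" "b \<in> B" "c \<in> C"
      using x(2) by (rule set_plus_elim)
    have "x + - b \<in> A + B"
      using x(1) bc(2) fs.subspace_neg[OF subspaces(2)] by (intro set_plus_intro)
    hence "c \<in> (A + B) \<inter> C"
      using bc by simp
    hence "x \<in> A \<inter> B"
      using int(2) x(1) bc by auto
    thus ?thesis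
      using int(1) by blast
  qed
  moreover have "0 \<in> A" "0 \<in> B + C"
    using fs.subspace_0 subspaces fs.subspace_set_plus by blast+
  ultimately show ?thesis
    by blast
qed

lemma inv_sub_complement_refine:
  assumes inv: "inv_sub d R n A" "inv_sub d R n B" "inv_sub d R n C"
    and int: "A \<inter> B = {0}" "(A + B) \<inter> C = {0}" and sum: "tens d n = A + B + C"
  shows "inv_sub d R n (B + C)" "A \<inter> (B + C) = {0}" "tens d n = A + (B + C)"
  using inv_sub_set_plus[OF inv(2,3)] Int_set_plus_eq_zero[OF _ _ _ int] inv sum
  by (auto simp: inv_sub_def add.assoc)

lemma direct_summand_induct [consumes 4, case_names zero indecomposable sum]:
  assumes summand: "inv_sub d R n M" "inv_sub d R n C" "M \<inter> C = {0}" "tens d n = M + C"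
    and zero: "P {0}"
    and indecomposable: "\<And>M. indec_summand d R n M \<Longrightarrow> P M"
    and sum: "\<And>M1 M2. inv_sub d R n M1 \<Longrightarrow> inv_sub d R n M2 \<Longrightarrow> M1 \<inter> M2 = {0} \<Longrightarrow> P M1 \<Longrightarrow> P M2 \<Longrightarrow> P (M1 + M2)"
  shows "P M"
  using summand
proof (induction "fs.dim M" arbitrary: M C rule: less_induct)
  case less
  show ?case
  proof (cases "M = {0} \<or> indec_summand d R n M")
    case False
    have set_plus_eq: "A + B = {a + b | a b. a \<in> A \<and> b \<in> B}" for A B :: "(nat list \<Rightarrow> 'a) set"
      by (auto simp: set_plus_def)
    obtain M1 M2 where M12: "inv_sub d R n M1" "inv_sub d R n M2" "M1 \<inter> M2 = {0}" "M = M1 + M2"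
      and nonzero: "M1 \<noteq> {0}" "M2 \<noteq> {0}"
      using False less.prems unfolding indec_summand_def set_plus_eq by blast
    have subspaces: "fs.subspace M1" "fs.subspace M2"
      using M12(1,2) by (auto simp: inv_sub_def)
    have fin: "fs.fin_dim M1" "fs.fin_dim M2"
      using M12(1,2) fs.fin_dim_subset[OF fin_dim_tens] by (auto simp: inv_sub_def)
    have dim: "fs.dim M = fs.dim M1 + fs.dim M2"
      unfolding M12(4) by (rule fs.dim_direct_sum[OF subspaces(1) fin(1) subspaces(2) fin(2) M12(3)])
    have dim_less: "fs.dim M1 < fs.dim M" "fs.dim M2 < fs.dim M"
      using dim fs.fin_dim_dim_pos[OF subspaces(1) fin(1) nonzero(1)]
        fs.fin_dim_dim_pos[OF subspaces(2) fin(2) nonzero(2)] by simp_all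
    have C: "(M1 + M2) \<inter> C = {0}" "tens d n = M1 + M2 + C"
      using less.prems(3,4) M12(4) by simp_all
    have "P M1"
      by (rule less.hyps[OF dim_less(1) M12(1) inv_sub_complement_refine[OF M12(1,2) less.prems(2) M12(3) C]])
    moreover have "P M2"
    proof -
      have "M2 \<inter> M1 = {0}" "(M2 + M1) \<inter> C = {0}" "tens d n = M2 + M1 + C"
        using M12(3) C by (auto simp: add.commute)
      note refine = inv_sub_complement_refine[OF M12(2,1) less.prems(2) this]
      show ?thesis
        by (rule less.hyps[OF dim_less(2) M12(2) refine])
    qed
    ultimately show ?thesis
      unfolding M12(4) by (rule sum[OF M12(1-3)])
  qed (use zero indecomposable in blast)
qed

lemma koszul_balanced_indec_summand:
  assumes q: "q \<noteq> 0" and source: "one_dim_source_cond d q R" and n: "n > 0" and M: "indec_summand d R n M"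
  shows "koszul_balanced n (Rop d R) q M"
proof -
  have inv: "operator_module n (Rop d R) M" "M \<subseteq> tens d n"
    using M by (auto simp: indec_summand_def inv_sub_iff)
  obtain lam chi where lam: "one_dim_rep q n lam chi" "summand_of_induced d q R n M lam chi"
    using source n M unfolding one_dim_source_cond_def by blast
  obtain L \<chi> f g where L: "size L = n" "operator_retract n (Rop d R) M (super_op q \<chi>) (weight_space L) f g"
    using summand_of_induced_retract[OF q lam inv(1)] .
  moreover have "L \<noteq> {#}"
    using L(1) n by auto
  ultimately show ?thesis
    using koszul_balanced_retract[of L "Rop d R" M q \<chi> f g] fs.fin_dim_subset[OF fin_dim_tens inv(2)] by simp
qed

theorem koszul_balanced_tens:
  fixes q :: "'k::field"
  assumes q: "q \<noteq> 0" and source: "one_dim_source_cond d q R" and n: "n > 0"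
  shows "koszul_balanced n (Rop d R) q (tens d n)"
proof (rule direct_summand_induct)
  have zero_in_tens: "(0 :: nat list \<Rightarrow> 'k) \<in> tens d n"
    by (rule fs.subspace_0[OF subspace_tens])
  have zero: "operator_module n (Rop d R) {0}"
    by (rule operator_module_zero[OF linear_map_Rop])
  show "inv_sub d R n (tens d n)"
    by (simp add: inv_sub_iff operator_module_tens)
  show "inv_sub d R n {0}"
    using zero zero_in_tens by (simp add: inv_sub_iff)
  show "tens d n \<inter> {0} = {0 :: nat list \<Rightarrow> 'k}"
    using zero_in_tens by simp
  show "tens d n = tens d n + {0 :: nat list \<Rightarrow> 'k}"
    by simp
  show "koszul_balanced n (Rop d R) q {0}"
    by (rule koszul_balanced_zero[OF linear_map_Rop])
next
  fix M assume "indec_summand d R n M"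
  thus "koszul_balanced n (Rop d R) q M"
    by (rule koszul_balanced_indec_summand[OF q source n])
next
  fix M1 M2
  assume M12: "inv_sub d R n M1" "inv_sub d R n M2" "M1 \<inter> M2 = {0}"
    and balanced: "koszul_balanced n (Rop d R) q M1" "koszul_balanced n (Rop d R) q M2"
  hence "operator_direct_sum n (Rop d R) M1 M2"
    by (simp add: operator_direct_sum_def operator_direct_sum_axioms_def inv_sub_iff)
  moreover have "fs.fin_dim M1" "fs.fin_dim M2"
    using M12(1,2) fs.fin_dim_subset[OF fin_dim_tens] by (auto simp: inv_sub_def)
  ultimately show "koszul_balanced n (Rop d R) q (M1 + M2)"
    using balanced by (rule operator_direct_sum.koszul_balanced_sum)
qed

section \<open>Tensor products in coordinates\<close>

lemma words_append_iff:
  "length u = a \<Longrightarrow> length v = b \<Longrightarrow> u @ v \<in> words d (a + b) \<longleftrightarrow> u \<in> words d a \<and> v \<in> words d b"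
  by (auto simp: words_def)

lemma words_take_drop: "w \<in> words d (a + b) \<longleftrightarrow> take a w \<in> words d a \<and> drop a w \<in> words d b"
proof
  assume "w \<in> words d (a + b)"
  thus "take a w \<in> words d a \<and> drop a w \<in> words d b"
    by (auto simp: words_def dest: in_set_takeD in_set_dropD)
next
  assume split: "take a w \<in> words d a \<and> drop a w \<in> words d b"
  hence "length (take a w) = a" "length (drop a w) = b"
    by (auto simp: words_def)
  thus "w \<in> words d (a + b)"
    using words_append_iff[of "take a w" a "drop a w" b d] split by simp
qed

lemma etens_in_tens: "u \<in> tens d a \<Longrightarrow> v \<in> tens d b \<Longrightarrow> etens a u v \<in> tens d (a + b)"
  by (auto simp: tens_def etens_def words_take_drop)

lemma linear_map_etens_left: "linear_map (\<lambda>u. etens a u v)"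
  by (rule linear_mapI) (auto simp: etens_def sc_def fun_eq_iff algebra_simps)

lemma linear_map_etens_right: "linear_map (etens a u)"
  by (rule linear_mapI) (auto simp: etens_def sc_def fun_eq_iff algebra_simps)

lemma etens_0_right [simp]: "etens a u 0 = 0"
  by (simp add: etens_def fun_eq_iff)

lemma etens_diff_scale:
  "etens a (u - sc c u') v = etens a u v - sc c (etens a u' v)"
  "etens a u (v - sc c v') = etens a u v - sc c (etens a u v')"
  by (auto simp: etens_def sc_def fun_eq_iff algebra_simps)

lemma subspace_tensor_sp: "fs.subspace (tensor_sp a U U')"
  unfolding tensor_sp_def by (rule fs.subspace_span)

lemma etens_in_tensor_sp: "u \<in> U \<Longrightarrow> v \<in> U' \<Longrightarrow> etens a u v \<in> tensor_sp a U U'"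
  unfolding tensor_sp_def by (intro fs.span_base) blast

lemma tensor_sp_minimal:
  assumes "fs.subspace S" "\<And>u v. u \<in> U \<Longrightarrow> v \<in> U' \<Longrightarrow> etens a u v \<in> S"
  shows "tensor_sp a U U' \<subseteq> S"
  unfolding tensor_sp_def using assms by (intro fs.span_minimal) blast+

lemma tensor_sp_mono: "U \<subseteq> W \<Longrightarrow> U' \<subseteq> W' \<Longrightarrow> tensor_sp a U U' \<subseteq> tensor_sp a W W'"
  by (intro tensor_sp_minimal subspace_tensor_sp etens_in_tensor_sp) auto

lemma tensor_sp_span_left: "tensor_sp a (fs.span U) U' = tensor_sp a U U'"
proof
  show "tensor_sp a (fs.span U) U' \<subseteq> tensor_sp a U U'"
  proof (rule tensor_sp_minimal[OF subspace_tensor_sp])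
    fix u v :: "nat list \<Rightarrow> 'a" assume u: "u \<in> fs.span U" and v: "v \<in> U'"
    interpret etens: Vector_Spaces.linear sc sc "\<lambda>u. etens a u v"
      by (rule linear_map_etens_left)
    have "fs.span U \<subseteq> {u. etens a u v \<in> tensor_sp a U U'}"
      by (rule fs.span_minimal[OF _ etens.subspace_linear_preimage[OF subspace_tensor_sp]])
        (use v in \<open>auto intro: etens_in_tensor_sp\<close>)
    thus "etens a u v \<in> tensor_sp a U U'"
      using u by blast
  qed
  show "tensor_sp a U U' \<subseteq> tensor_sp a (fs.span U) U'"
    by (intro tensor_sp_mono fs.span_superset order_refl)
qed

lemma tensor_sp_span_right: "tensor_sp a U (fs.span U') = tensor_sp a U U'"
proof
  show "tensor_sp a U (fs.span U') \<subseteq> tensor_sp a U U'"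
  proof (rule tensor_sp_minimal[OF subspace_tensor_sp])
    fix u v :: "nat list \<Rightarrow> 'a" assume u: "u \<in> U" and v: "v \<in> fs.span U'"
    interpret etens: Vector_Spaces.linear sc sc "etens a u"
      by (rule linear_map_etens_right)
    have "fs.span U' \<subseteq> {v. etens a u v \<in> tensor_sp a U U'}"
      by (rule fs.span_minimal[OF _ etens.subspace_linear_preimage[OF subspace_tensor_sp]])
        (use u in \<open>auto intro: etens_in_tensor_sp\<close>)
    thus "etens a u v \<in> tensor_sp a U U'"
      using v by blast
  qed
  show "tensor_sp a U U' \<subseteq> tensor_sp a U (fs.span U')"
    by (intro tensor_sp_mono fs.span_superset order_refl)
qed

lemma tensor_sp_UN: "tensor_sp a U (\<Union>i\<in>K. S i) = fs.span (\<Union>i\<in>K. tensor_sp a U (S i))"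
proof
  show "tensor_sp a U (\<Union>i\<in>K. S i) \<subseteq> fs.span (\<Union>i\<in>K. tensor_sp a U (S i))"
    by (intro tensor_sp_minimal fs.subspace_span fs.span_base) (auto intro: etens_in_tensor_sp)
  show "fs.span (\<Union>i\<in>K. tensor_sp a U (S i)) \<subseteq> tensor_sp a U (\<Union>i\<in>K. S i)"
    by (intro fs.span_minimal subspace_tensor_sp UN_least tensor_sp_mono) auto
qed

lemma image_tensor_sp_left:
  assumes "linear_map g" and g: "\<And>u v. u \<in> U \<Longrightarrow> v \<in> U' \<Longrightarrow> g (etens a u v) = etens a (f u) v"
  shows "g ` tensor_sp a U U' = tensor_sp a (f ` U) U'"
proof -
  interpret g: Vector_Spaces.linear sc sc g by fact
  have "g ` {etens a u v | u v. u \<in> U \<and> v \<in> U'} = {etens a u v | u v. u \<in> f ` U \<and> v \<in> U'}"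
    using g by (auto simp: image_iff) metis+
  thus ?thesis
    unfolding tensor_sp_def by (simp flip: g.span_image)
qed

lemma image_tensor_sp_right:
  assumes "linear_map g" and g: "\<And>u v. u \<in> U \<Longrightarrow> v \<in> U' \<Longrightarrow> g (etens a u v) = etens a u (f v)"
  shows "g ` tensor_sp a U U' = tensor_sp a U (f ` U')"
proof -
  interpret g: Vector_Spaces.linear sc sc g by fact
  have "g ` {etens a u v | u v. u \<in> U \<and> v \<in> U'} = {etens a u v | u v. u \<in> U \<and> v \<in> f ` U'}"
    using g by (auto simp: image_iff) metis+
  thus ?thesis
    unfolding tensor_sp_def by (simp flip: g.span_image)
qed

lemma tensor_sp_insert_left:
  fixes U :: "(nat list \<Rightarrow> 'k::field) set"
  assumes U: "fs.subspace U"
  shows "tensor_sp a (insert b B) U = etens a b ` U + tensor_sp a B U"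
proof -
  interpret etens: Vector_Spaces.linear sc sc "etens a b"
    by (rule linear_map_etens_right)
  have "{etens a u v | u v. u \<in> insert b B \<and> v \<in> U} = etens a b ` U \<union> {etens a u v | u v. u \<in> B \<and> v \<in> U}"
    by blast
  moreover have "fs.span (etens a b ` U) = etens a b ` U"
    using etens.subspace_image[OF U] by (simp only: fs.span_eq_iff)
  ultimately show ?thesis
    by (simp only: tensor_sp_def fs.span_Un_eq_set_plus)
qed

lemma tensor_sp_expand:
  assumes "finite B" and U: "fs.subspace U" and "x \<in> tensor_sp a B U"
  obtains c where "\<And>b. b \<in> B \<Longrightarrow> c b \<in> U" "x = (\<Sum>b\<in>B. etens a b (c b))"
proof -
  have "\<exists>c. (\<forall>b\<in>B. c b \<in> U) \<and> x = (\<Sum>b\<in>B. etens a b (c b))"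
    using assms(1,3)
  proof (induction B arbitrary: x rule: finite_induct)
    case (insert b B)
    obtain u y where uy: "u \<in> U" "y \<in> tensor_sp a B U" "x = etens a b u + y"
      using insert.prems unfolding tensor_sp_insert_left[OF U] by (auto elim!: set_plus_elim)
    obtain c where c: "\<forall>b\<in>B. c b \<in> U" "y = (\<Sum>b\<in>B. etens a b (c b))"
      using insert.IH[OF uy(2)] by blast
    have "(\<Sum>b'\<in>B. etens a b' ((c(b := u)) b')) = y"
      unfolding c(2) using insert.hyps(2) by (intro sum.cong) auto
    hence "x = (\<Sum>b'\<in>insert b B. etens a b' ((c(b := u)) b'))"
      using uy(3) insert.hyps by simp
    moreover have "\<forall>b'\<in>insert b B. (c(b := u)) b' \<in> U"
      using c(1) uy(1) by simp
    ultimately show ?case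
      by (intro exI[of _ "c(b := u)"] conjI)
  qed (simp add: tensor_sp_def)
  thus thesis
    using that by blast
qed

lemma etens_sum_eq_0:
  fixes B :: "(nat list \<Rightarrow> 'k::field) set"
  assumes B: "finite B" "fs.independent B" "B \<subseteq> tens d a" and sum: "(\<Sum>b\<in>B. etens a b (c b)) = 0" and b: "b \<in> B"
  shows "c b = 0"
proof
  fix v
  have "(\<Sum>b\<in>B. sc (c b v) b) = 0"
  proof
    fix u
    show "(\<Sum>b\<in>B. sc (c b v) b) u = 0 u"
    proof (cases "length u = a")
      case True
      thus ?thesis
        using fun_cong[OF sum, of "u @ v"] by (simp add: sum_fun_apply etens_def sc_def mult.commute)
    next
      case False
      hence vanish: "b u = 0" if "b \<in> B" for b
        using that B(3) by (auto simp: tens_def words_def)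
      show ?thesis
        by (simp add: sum_fun_apply sc_def vanish)
    qed
  qed
  thus "c b v = 0 v"
    using fs.independentD[OF B(2,1) order_refl _ b, of "\<lambda>b. c b v"] by simp
qed

lemma tensor_sp_kernel_right:
  fixes W U :: "(nat list \<Rightarrow> 'k::field) set"
  assumes W: "fs.subspace W" "W \<subseteq> tens d a" and U: "fs.subspace U" and "linear_map g"
    and g: "\<And>u v. u \<in> W \<Longrightarrow> v \<in> U \<Longrightarrow> g (etens a u v) = etens a u (f v)"
  shows "tensor_sp a W {v \<in> U. f v = 0} = {x \<in> tensor_sp a W U. g x = 0}" (is "?L = ?R")
proof
  interpret g: Vector_Spaces.linear sc sc g by fact
  have "?L \<subseteq> tensor_sp a W U \<inter> {x. g x = 0}"
    by (intro tensor_sp_minimal fs.subspace_inter subspace_tensor_sp g.subspace_kernel)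
      (simp add: g etens_in_tensor_sp)
  thus "?L \<subseteq> ?R"
    by auto
  show "?R \<subseteq> ?L"
  proof
    fix x assume x: "x \<in> ?R"
    obtain B where B: "finite B" "B \<subseteq> W" "fs.independent B" "fs.span B = W"
      by (rule fs.fin_dim_basis[OF W(1) fs.fin_dim_subset[OF fin_dim_tens W(2)]]) (rule that, assumption+)
    have "x \<in> tensor_sp a B U"
      using x tensor_sp_span_left[of a B U] by (simp add: B(4))
    then obtain c where c: "\<And>b. b \<in> B \<Longrightarrow> c b \<in> U" "x = (\<Sum>b\<in>B. etens a b (c b))"
      by (rule tensor_sp_expand[OF B(1) U]) (rule that, assumption+)
    have "(\<Sum>b\<in>B. etens a b (f (c b))) = (\<Sum>b\<in>B. g (etens a b (c b)))"
      using c(1) B(2) by (intro sum.cong refl g[symmetric]) auto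
    also have "\<dots> = g x"
      unfolding c(2) by (rule g.sum[symmetric])
    also have "\<dots> = 0"
      using x by simp
    finally have kernel: "f (c b) = 0" if "b \<in> B" for b
      by (rule etens_sum_eq_0[OF B(1,3) subset_trans[OF B(2) W(2)] _ that])
    show "x \<in> ?L"
      unfolding c(2)
    proof (rule fs.subspace_sum[OF subspace_tensor_sp])
      fix b assume "b \<in> B"
      thus "etens a b (c b) \<in> ?L"
        using c(1) kernel B(2) by (intro etens_in_tensor_sp) auto
    qed
  qed
qed

lemma dim_tensor_sp:
  fixes U U' :: "(nat list \<Rightarrow> 'k::field) set"
  assumes U: "fs.subspace U" "U \<subseteq> tens d a" and U': "fs.subspace U'" "U' \<subseteq> tens d b"
  shows "fs.dim (tensor_sp a U U') = fs.dim U * fs.dim U'"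
proof -
  obtain B where B: "finite B" "B \<subseteq> U" "fs.independent B" "fs.span B = U" "card B = fs.dim U"
    using fs.fin_dim_basis[OF U(1) fs.fin_dim_subset[OF fin_dim_tens U(2)]] .
  obtain B' where B': "finite B'" "B' \<subseteq> U'" "fs.independent B'" "fs.span B' = U'" "card B' = fs.dim U'"
    using fs.fin_dim_basis[OF U'(1) fs.fin_dim_subset[OF fin_dim_tens U'(2)]] .
  interpret etens: Vector_Spaces.linear sc sc "etens a u" for u :: "nat list \<Rightarrow> 'k"
    by (rule linear_map_etens_right)
  let ?e = "\<lambda>(u, v). etens a u v"
  have zero: "c p = 0" if sum: "(\<Sum>p\<in>B \<times> B'. sc (c p) (?e p)) = 0" and p: "p \<in> B \<times> B'" for c p
  proof -
    have "(\<Sum>p\<in>B \<times> B'. sc (c p) (?e p)) = (\<Sum>u\<in>B. \<Sum>v\<in>B'. sc (c (u, v)) (etens a u v))"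
      by (simp add: sum.cartesian_product case_prod_beta)
    also have "\<dots> = (\<Sum>u\<in>B. etens a u (\<Sum>v\<in>B'. sc (c (u, v)) v))"
      by (simp only: etens.sum etens.scale)
    finally have "(\<Sum>v\<in>B'. sc (c (fst p, v)) v) = 0"
      using etens_sum_eq_0[OF B(1,3) subset_trans[OF B(2) U(2)], of "\<lambda>u. \<Sum>v\<in>B'. sc (c (u, v)) v" "fst p"]
        sum p by auto
    thus "c p = 0"
      using fs.independentD[OF B'(3,1) order_refl, of "\<lambda>v. c (fst p, v)" "snd p"] p by auto
  qed
  have inj: "inj_on ?e (B \<times> B')" and indep: "fs.independent (?e ` (B \<times> B'))"
    using fs.independent_family[OF finite_cartesian_product[OF B(1) B'(1)], of ?e] zero by blast+
  have "?e ` (B \<times> B') = {etens a u v | u v. u \<in> B \<and> v \<in> B'}"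
    by auto
  hence "tensor_sp a U U' = fs.span (?e ` (B \<times> B'))"
    unfolding B(4)[symmetric] B'(4)[symmetric] tensor_sp_span_left tensor_sp_span_right
    by (simp add: tensor_sp_def)
  hence "fs.dim (tensor_sp a U U') = card (?e ` (B \<times> B'))"
    using fs.dim_span_eq_card_independent[OF indep] by simp
  also have "\<dots> = card B * card B'"
    by (simp add: card_image[OF inj] card_cartesian_product)
  finally show ?thesis
    using B(5) B'(5) by simp
qed

section \<open>Slices\<close>

definition head_slice :: "(nat list \<Rightarrow> 'k) \<Rightarrow> nat list \<Rightarrow> nat list \<Rightarrow> 'k" where
  "head_slice x v = (\<lambda>u. x (u @ v))"

definition tail_slice :: "(nat list \<Rightarrow> 'k) \<Rightarrow> nat list \<Rightarrow> nat list \<Rightarrow> 'k" where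
  "tail_slice x u = (\<lambda>v. x (u @ v))"

lemma linear_map_head_slice: "linear_map (\<lambda>x. head_slice x v)"
  by (rule linear_mapI) (auto simp: head_slice_def sc_def)

lemma head_slice_in_tens:
  assumes x: "x \<in> tens d (a + b)" and v: "v \<in> words d b"
  shows "head_slice x v \<in> tens d a"
proof -
  have "u \<in> words d a" if "u @ v \<in> words d (a + b)" for u
    using that v by (auto simp: words_def)
  thus ?thesis
    using x by (auto simp: tens_def head_slice_def)
qed

lemma tens_ext_head:
  assumes xy: "x \<in> tens d (a + b)" "y \<in> tens d (a + b)"
    and slices: "\<And>v. v \<in> words d b \<Longrightarrow> head_slice x v = head_slice y v"
  shows "x = y"
proof
  fix w
  show "x w = y w"
  proof (cases "w \<in> words d (a + b)")
    case True
    hence "drop a w \<in> words d b"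
      by (simp add: words_take_drop)
    from fun_cong[OF slices[OF this], of "take a w"] show ?thesis
      by (simp add: head_slice_def)
  qed (use xy in \<open>simp add: tens_def\<close>)
qed

lemma tens_ext_tail:
  assumes xy: "x \<in> tens d (a + b)" "y \<in> tens d (a + b)"
    and slices: "\<And>u. u \<in> words d a \<Longrightarrow> tail_slice x u = tail_slice y u"
  shows "x = y"
proof
  fix w
  show "x w = y w"
  proof (cases "w \<in> words d (a + b)")
    case True
    hence "take a w \<in> words d a"
      by (simp add: words_take_drop)
    from fun_cong[OF slices[OF this], of "drop a w"] show ?thesis
      by (simp add: tail_slice_def)
  qed (use xy in \<open>simp add: tens_def\<close>)
qed

lemma head_slice_etens:
  fixes u v :: "nat list \<Rightarrow> 'k::field"
  assumes u: "u \<in> tens d a" and v': "v' \<in> words d b" and v: "v \<in> tens d b"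
  shows "head_slice (etens a u v) v' = sc (v v') u"
proof
  fix u'
  show "head_slice (etens a u v) v' u' = sc (v v') u u'"
  proof (cases "u' \<in> words d a")
    case True
    thus ?thesis
      by (simp add: head_slice_def etens_def sc_def words_def)
  next
    case False
    thus ?thesis
      using head_slice_in_tens[OF etens_in_tens[OF u v] v'] u by (simp add: tens_def sc_def)
  qed
qed

lemma tail_slice_etens: "u' \<in> words d a \<Longrightarrow> tail_slice (etens a u v) u' = sc (u u') v"
  by (auto simp: tail_slice_def etens_def sc_def words_def)

lemma head_slice_Rop:
  assumes x: "x \<in> tens d (a + b)" and v: "v \<in> words d b" and i: "Suc i < a"
  shows "head_slice (Rop d R i x) v = Rop d R i (head_slice x v)"
proof
  fix u
  show "head_slice (Rop d R i x) v u = Rop d R i (head_slice x v) u"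
  proof (cases "u \<in> words d a")
    case True
    thus ?thesis
      using v i by (simp add: head_slice_def Rop_def words_def nth_append list_update_append)
  next
    case False
    thus ?thesis
      using head_slice_in_tens[OF Rop_in_tens[OF x] v, of R i] Rop_in_tens[OF head_slice_in_tens[OF x v], of R i]
      by (simp add: tens_def)
  qed
qed

lemma tail_slice_Rop: "u \<in> words d a \<Longrightarrow> tail_slice (Rop d R (a + i) x) u = Rop d R i (tail_slice x u)"
  by (auto simp: tail_slice_def Rop_def words_def nth_append list_update_append Suc_diff_le
      simp flip: add_Suc_right)

lemma Rop_etens_left:
  fixes u v :: "nat list \<Rightarrow> 'k::field"
  assumes u: "u \<in> tens d a" and v: "v \<in> tens d b" and i: "Suc i < a"
  shows "Rop d R i (etens a u v) = etens a (Rop d R i u) v"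
proof (rule tens_ext_head)
  interpret Rop: Vector_Spaces.linear sc sc "Rop d R i" by (rule linear_map_Rop)
  show "Rop d R i (etens a u v) \<in> tens d (a + b)" "etens a (Rop d R i u) v \<in> tens d (a + b)"
    using u v by (auto intro: Rop_in_tens etens_in_tens)
  fix v' assume v': "v' \<in> words d b"
  show "head_slice (Rop d R i (etens a u v)) v' = head_slice (etens a (Rop d R i u) v) v'"
    by (simp only: head_slice_Rop[OF etens_in_tens[OF u v] v' i] head_slice_etens[OF u v' v]
        head_slice_etens[OF Rop_in_tens[OF u] v' v] Rop.scale)
qed

lemma Rop_etens_right:
  fixes u v :: "nat list \<Rightarrow> 'k::field"
  assumes u: "u \<in> tens d a" and v: "v \<in> tens d b"
  shows "Rop d R (a + i) (etens a u v) = etens a u (Rop d R i v)"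
proof (rule tens_ext_tail)
  interpret Rop: Vector_Spaces.linear sc sc "Rop d R i" by (rule linear_map_Rop)
  show "Rop d R (a + i) (etens a u v) \<in> tens d (a + b)" "etens a u (Rop d R i v) \<in> tens d (a + b)"
    using u v by (auto intro: Rop_in_tens etens_in_tens)
  fix u' assume "u' \<in> words d a"
  thus "tail_slice (Rop d R (a + i) (etens a u v)) u' = tail_slice (etens a u (Rop d R i v)) u'"
    by (simp add: tail_slice_Rop tail_slice_etens Rop.scale)
qed

lemma head_slice_expand:
  fixes x :: "nat list \<Rightarrow> 'k::field"
  assumes x: "x \<in> tens d (a + b)"
  shows "x = (\<Sum>v\<in>words d b. etens a (head_slice x v) (delta v))" (is "_ = ?sum")
proof (rule tens_ext_head[OF x])
  interpret slice: Vector_Spaces.linear sc sc "\<lambda>x. head_slice x v" for v :: "nat list"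
    by (rule linear_map_head_slice)
  note slice = head_slice_in_tens[OF x] and delta = delta_in_tens
  show "?sum \<in> tens d (a + b)"
    by (intro fs.subspace_sum subspace_tens etens_in_tens slice delta)
  fix v' assume v': "v' \<in> words d b"
  have "head_slice ?sum v' = (\<Sum>v\<in>words d b. sc (delta v v') (head_slice x v))"
    unfolding slice.sum by (rule sum.cong[OF refl]) (rule head_slice_etens[OF slice v' delta])
  also have "\<dots> = (\<Sum>v\<in>words d b. if v = v' then head_slice x v else 0)"
    by (rule sum.cong) (auto simp: delta_def)
  finally show "head_slice x v' = head_slice ?sum v'"
    using v' finite_words by simp
qed

lemma tensor_sp_tens_iff:
  fixes U :: "(nat list \<Rightarrow> 'k::field) set"
  assumes U: "fs.subspace U" "U \<subseteq> tens d a"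
  shows "x \<in> tensor_sp a U (tens d b) \<longleftrightarrow> x \<in> tens d (a + b) \<and> (\<forall>v\<in>words d b. head_slice x v \<in> U)"
proof
  interpret slice: Vector_Spaces.linear sc sc "\<lambda>x. head_slice x v" for v :: "nat list"
    by (rule linear_map_head_slice)
  have "fs.subspace (tens d (a + b) \<inter> (\<Inter>v\<in>words d b. {x. head_slice x v \<in> U}))"
    by (intro fs.subspace_inter fs.subspace_Int subspace_tens slice.subspace_linear_preimage U(1))
  moreover have "etens a u v \<in> tens d (a + b) \<inter> (\<Inter>v\<in>words d b. {x. head_slice x v \<in> U})"
    if "u \<in> U" "v \<in> tens d b" for u v
    using that U(2) fs.subspace_scale[OF U(1)] by (auto simp: head_slice_etens intro: etens_in_tens)
  ultimately have "tensor_sp a U (tens d b) \<subseteq> tens d (a + b) \<inter> (\<Inter>v\<in>words d b. {x. head_slice x v \<in> U})"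
    by (rule tensor_sp_minimal)
  thus "x \<in> tensor_sp a U (tens d b) \<Longrightarrow> x \<in> tens d (a + b) \<and> (\<forall>v\<in>words d b. head_slice x v \<in> U)"
    by blast
next
  assume x: "x \<in> tens d (a + b) \<and> (\<forall>v\<in>words d b. head_slice x v \<in> U)"
  have "(\<Sum>v\<in>words d b. etens a (head_slice x v) (delta v)) \<in> tensor_sp a U (tens d b)"
    using x by (intro fs.subspace_sum subspace_tensor_sp etens_in_tensor_sp delta_in_tens) auto
  thus "x \<in> tensor_sp a U (tens d b)"
    using head_slice_expand[of x d a b] x by simp
qed

lemma tensor_sp_tens: "tensor_sp a (tens d a) (tens d b) = tens d (a + b)"
  using tensor_sp_tens_iff[OF subspace_tens order_refl] head_slice_in_tens by blast

section \<open>The Koszul complex of a Hecke symmetry\<close>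

lemma subspace_relations_Rop: "fs.subspace P \<Longrightarrow> fs.subspace (relations k (Rop d R) q i P)"
  by (rule operator_module.subspace_relations[OF operator_module_tens])

lemma relations_Rop_subset: "relations k (Rop d R) q i (tens d n) \<subseteq> tens d n"
  unfolding relations_def
  by (auto split: kind.split intro!: fs.subspace_diff fs.subspace_scale subspace_tens Rop_in_tens)

lemma linear_map_Rop_minus_scale: "linear_map (\<lambda>x. Rop d R i x - sc q x)"
  by (rule operator_module.linear_map_minus_scale[OF operator_module_tens])

lemma tensor_sp_relations_left:
  fixes q :: "'k::field"
  assumes i: "Suc i < a"
  shows "tensor_sp a (relations k (Rop d R) q i (tens d a)) (tens d b) = relations k (Rop d R) q i (tens d (a + b))"
proof (cases k)
  case Sym
  have "(\<lambda>x. Rop d R i x - sc q x) ` tensor_sp a (tens d a) (tens d b)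
      = tensor_sp a ((\<lambda>x. Rop d R i x - sc q x) ` tens d a) (tens d b)"
    using i by (intro image_tensor_sp_left linear_map_Rop_minus_scale) (simp add: Rop_etens_left etens_diff_scale)
  thus ?thesis
    using Sym by (simp add: relations_def tensor_sp_tens)
next
  case Skew
  have slices: "(\<forall>v\<in>words d b. Rop d R i (head_slice x v) = sc q (head_slice x v)) \<longleftrightarrow> Rop d R i x = sc q x"
    if x: "x \<in> tens d (a + b)" for x
  proof -
    have scale: "head_slice (sc q x) v = sc q (head_slice x v)" for v
      by (simp add: head_slice_def sc_def)
    have "(\<forall>v\<in>words d b. head_slice (Rop d R i x) v = head_slice (sc q x) v) \<longleftrightarrow> Rop d R i x = sc q x"
      using tens_ext_head[OF Rop_in_tens[OF x] fs.subspace_scale[OF subspace_tens x]] by metis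
    thus ?thesis
      by (simp add: head_slice_Rop[OF x _ i] scale cong: ball_cong)
  qed
  have "x \<in> tensor_sp a (relations k (Rop d R) q i (tens d a)) (tens d b) \<longleftrightarrow>
      x \<in> relations k (Rop d R) q i (tens d (a + b))" for x
    unfolding tensor_sp_tens_iff[OF subspace_relations_Rop[OF subspace_tens] relations_Rop_subset]
    using slices[of x] Skew head_slice_in_tens[of x d a b] by (auto simp: relations_def)
  thus ?thesis
    by blast
qed

lemma tensor_sp_relations_right:
  fixes W :: "(nat list \<Rightarrow> 'k::field) set"
  assumes W: "fs.subspace W" "W \<subseteq> tens d a"
  shows "tensor_sp a W (relations k (Rop d R) q i (tens d b))
    = relations k (Rop d R) q (a + i) (tensor_sp a W (tens d b))"
proof (cases k)
  case Sym
  have "(\<lambda>x. Rop d R (a + i) x - sc q x) ` tensor_sp a W (tens d b)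
      = tensor_sp a W ((\<lambda>x. Rop d R i x - sc q x) ` tens d b)"
    by (intro image_tensor_sp_right linear_map_Rop_minus_scale)
      (use W(2) in \<open>auto simp: Rop_etens_right etens_diff_scale\<close>)
  thus ?thesis
    using Sym by (simp add: relations_def)
next
  case Skew
  have "tensor_sp a W {v \<in> tens d b. Rop d R i v - sc q v = 0}
      = {x \<in> tensor_sp a W (tens d b). Rop d R (a + i) x - sc q x = 0}"
    by (intro tensor_sp_kernel_right W subspace_tens linear_map_Rop_minus_scale)
      (use W(2) in \<open>auto simp: Rop_etens_right etens_diff_scale\<close>)
  thus ?thesis
    using Skew by (simp add: relations_def)
qed

definition quadratic_relations ::
  "kind \<Rightarrow> nat \<Rightarrow> 'k::field \<Rightarrow> (nat \<Rightarrow> nat \<Rightarrow> nat \<Rightarrow> nat \<Rightarrow> 'k) \<Rightarrow> (nat list \<Rightarrow> 'k) set" where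
  "quadratic_relations k d q R = (case k of Sym \<Rightarrow> IS d q R | Skew \<Rightarrow> IL d q R)"

lemma quadratic_relations_eq: "quadratic_relations k d q R = relations k (Rop d R) q 0 (tens d 2)"
proof -
  have "(\<lambda>w. Rop d R 0 f w - q * f w) = Rop d R 0 f - sc q f" for f
    by (simp add: fun_eq_iff sc_def)
  thus ?thesis
    unfolding quadratic_relations_def relations_def IS_def IL_def by (auto split: kind.split)
qed

lemma emb_quadratic_relations:
  assumes "i + (2 + j) = n"
  shows "emb d (quadratic_relations k d q R) i j = relations k (Rop d R) q i (tens d n)"
proof -
  have "emb d (quadratic_relations k d q R) i j = tensor_sp i (tens d i) (relations k (Rop d R) q 0 (tens d (2 + j)))"
    unfolding emb_def quadratic_relations_eq by (subst tensor_sp_relations_left) simp_all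
  also have "\<dots> = relations k (Rop d R) q (i + 0) (tensor_sp i (tens d i) (tens d (2 + j)))"
    by (rule tensor_sp_relations_right[OF subspace_tens order_refl])
  finally show ?thesis
    using assms by (simp add: tensor_sp_tens)
qed

lemma Jsp_quadratic_relations:
  "Jsp d (quadratic_relations k d q R) m = relation_span k (Rop d R) q (tens d m) m 0"
proof (cases "m < 2")
  case True
  hence no_position: "{i. 0 \<le> i \<and> Suc i < m} = {}"
    by auto
  show ?thesis
    unfolding relation_span_def no_position using True by (simp add: Jsp_def)
next
  case False
  have "(\<Union>i\<in>{..m - 2}. emb d (quadratic_relations k d q R) i (m - 2 - i))
      = (\<Union>i\<in>{i. 0 \<le> i \<and> Suc i < m}. relations k (Rop d R) q i (tens d m))"
    using False by (intro SUP_cong emb_quadratic_relations) auto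
  thus ?thesis
    using False by (simp add: Jsp_def relation_span_def joint_relations_le_1)
qed

lemma Wsp_quadratic_relations:
  "Wsp d (quadratic_relations k d q R) n = joint_relations k (Rop d R) q (tens d n) n"
proof (cases "n < 2")
  case True
  thus ?thesis
    by (auto simp: Wsp_def joint_relations_def)
next
  case False
  have "(\<Inter>i\<in>{..n - 2}. emb d (quadratic_relations k d q R) i (n - 2 - i))
      = (\<Inter>i\<in>{i. Suc i < n}. relations k (Rop d R) q i (tens d n))"
    using False by (intro INF_cong emb_quadratic_relations) auto
  moreover have "0 \<in> {i. Suc i < n}"
    using False by simp
  ultimately show ?thesis
    using False relations_Rop_subset[of k d R q 0 n] unfolding Wsp_def joint_relations_def by auto
qed

lemma subspace_Wsp: "fs.subspace (Wsp d (quadratic_relations k d q R) n)"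
  unfolding Wsp_quadratic_relations
  by (rule operator_module.subspace_joint_relations[OF operator_module_tens])

lemma Wsp_subset: "Wsp d (quadratic_relations k d q R) n \<subseteq> tens d n"
  unfolding Wsp_quadratic_relations by (rule joint_relations_subset)

lemma subspace_Jsp: "fs.subspace (Jsp d (quadratic_relations k d q R) m)"
  unfolding Jsp_quadratic_relations by (rule subspace_relation_span)

lemma Jsp_subset: "Jsp d (quadratic_relations k d q R) m \<subseteq> tens d m"
  unfolding Jsp_quadratic_relations
  by (rule operator_module.relation_span_subset[OF operator_module_tens])

lemma Ccx_quadratic_relations:
  "Ccx d (quadratic_relations k d q R) n m = joint_relations k (Rop d R) q (tens d (n + m)) n"
proof -
  have slices: "x \<in> relations k (Rop d R) q i (tens d (n + m)) \<longleftrightarrow>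
      (\<forall>v\<in>words d m. head_slice x v \<in> relations k (Rop d R) q i (tens d n))"
    if "x \<in> tens d (n + m)" "Suc i < n" for x i
    using tensor_sp_tens_iff[of "relations k (Rop d R) q i (tens d n)" d n x m,
        OF subspace_relations_Rop[OF subspace_tens] relations_Rop_subset]
      tensor_sp_relations_left[OF that(2), of k d R q m] that(1) by blast
  have "x \<in> Ccx d (quadratic_relations k d q R) n m \<longleftrightarrow>
      x \<in> joint_relations k (Rop d R) q (tens d (n + m)) n" for x
    unfolding Ccx_def tensor_sp_tens_iff[OF subspace_Wsp Wsp_subset]
    unfolding Wsp_quadratic_relations joint_relations_def
    using slices[of x] head_slice_in_tens by auto
  thus ?thesis
    by blast
qed

lemma Zcx_quadratic_relations:
  "Zcx d (quadratic_relations k d q R) n m = relation_span k (Rop d R) q (tens d (n + m)) (n + m) n"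
proof -
  let ?W = "Wsp d (quadratic_relations k d q R) n"
  have "Zcx d (quadratic_relations k d q R) n m
      = fs.span (\<Union>i\<in>{i. Suc i < m}. tensor_sp n ?W (relations k (Rop d R) q i (tens d m)))"
    unfolding Zcx_def Jsp_quadratic_relations relation_span_def tensor_sp_span_right tensor_sp_UN
    by (simp add: joint_relations_le_1)
  also have "(\<Union>i\<in>{i. Suc i < m}. tensor_sp n ?W (relations k (Rop d R) q i (tens d m)))
      = (\<Union>i\<in>{i. Suc i < m}. relations k (Rop d R) q (n + i) (Ccx d (quadratic_relations k d q R) n m))"
    by (simp add: tensor_sp_relations_right[OF subspace_Wsp Wsp_subset] Ccx_def)
  also have "\<dots> = (\<Union>i\<in>(+) n ` {i. Suc i < m}. relations k (Rop d R) q i (Ccx d (quadratic_relations k d q R) n m))"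
    by simp
  also have "(+) n ` {i. Suc i < m} = {i. n \<le> i \<and> Suc i < n + m}"
  proof (intro equalityI subsetI)
    fix i assume "i \<in> {i. n \<le> i \<and> Suc i < n + m}"
    thus "i \<in> (+) n ` {i. Suc i < m}"
      by (intro image_eqI[of _ _ "i - n"]) auto
  qed auto
  finally show ?thesis
    unfolding Ccx_quadratic_relations relation_span_def .
qed

lemma koszul_quadratic_relations:
  assumes ex: "\<And>N. N > 0 \<Longrightarrow> koszul_exact k (Rop d R) q (tens d N) N"
  shows "koszul d (quadratic_relations k d q R)"
  unfolding koszul_def Ccx_quadratic_relations Zcx_quadratic_relations
proof (intro conjI allI impI ballI)
  let ?J = "\<lambda>N. joint_relations k (Rop d R) q (tens d N)" and ?Z = "\<lambda>N. relation_span k (Rop d R) q (tens d N) N"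
  fix n m x assume n: "1 \<le> n" and x: "x \<in> ?J (n + m) n" "x \<in> ?Z (n - 1 + Suc m) (n - 1)"
  obtain j where j: "n = Suc j"
    using n by (cases n) auto
  have exact: "x \<in> (if Suc j = n + m then {0} else ?J (n + m) (Suc (Suc j)) + ?Z (n + m) (Suc j))"
    using ex[of "n + m", unfolded koszul_exact_def, rule_format, of j] x by (auto simp: j)
  show "if m = 0 then x \<in> ?Z (n + 0) n else \<exists>y\<in>?J (Suc n + (m - 1)) (Suc n). x - y \<in> ?Z (n + m) n"
  proof (cases "m = 0")
    case True
    thus ?thesis
      using exact fs.subspace_0[OF subspace_relation_span] by (simp add: j)
  next
    case False
    hence "x \<in> ?J (n + m) (Suc n) + ?Z (n + m) n"
      using exact by (simp add: j)
    then obtain y z where "y \<in> ?J (n + m) (Suc n)" "z \<in> ?Z (n + m) n" "x = y + z"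
      by (rule set_plus_elim)
    thus ?thesis
      using False by (intro iffD2[OF if_not_P] bexI[of _ y]) simp_all
  qed
next
  let ?J = "\<lambda>N. joint_relations k (Rop d R) q (tens d N)" and ?Z = "\<lambda>N. relation_span k (Rop d R) q (tens d N) N"
  fix m x assume m: "1 \<le> m" and x: "x \<in> ?J (0 + m) 0"
  hence "x \<in> ?J (1 + (m - 1)) 1"
    by (simp add: joint_relations_le_1)
  moreover have "x - x \<in> ?Z (0 + m) 0"
    by (simp only: diff_self fs.subspace_0[OF subspace_relation_span])
  ultimately show "\<exists>y\<in>?J (1 + (m - 1)) 1. x - y \<in> ?Z (0 + m) 0"
    by blast
qed

section \<open>Hilbert series\<close>

lemma Abs_fps_mult_alternating_eq_1:
  fixes a b :: "nat \<Rightarrow> 'r::comm_ring_1"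
  assumes initial: "a 0 = 1" "b 0 = 1"
    and convolution: "\<And>N. N > 0 \<Longrightarrow> (\<Sum>n\<le>N. (-1) ^ n * (a n * b (N - n))) = 0"
  shows "Abs_fps a * Abs_fps (\<lambda>n. (-1) ^ n * b n) = 1"
proof (rule fps_ext)
  fix N
  have "fps_nth (Abs_fps a * Abs_fps (\<lambda>n. (-1) ^ n * b n)) N = (\<Sum>n\<le>N. a n * ((-1) ^ (N - n) * b (N - n)))"
    by (simp add: fps_mult_nth atLeast0AtMost)
  also have "\<dots> = (\<Sum>n\<le>N. (-1) ^ N * ((-1) ^ n * (a n * b (N - n))))"
  proof (rule sum.cong[OF refl])
    fix n assume "n \<in> {..N}"
    hence "(-1 :: 'r) ^ N = (-1) ^ (N - n) * (-1) ^ n"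
      by (simp flip: power_add)
    thus "a n * ((-1) ^ (N - n) * b (N - n)) = (-1) ^ N * ((-1) ^ n * (a n * b (N - n)))"
      by (simp add: algebra_simps flip: power_mult_distrib)
  qed
  also have "\<dots> = (-1) ^ N * (\<Sum>n\<le>N. (-1) ^ n * (a n * b (N - n)))"
    by (rule sum_distrib_left[symmetric])
  also have "\<dots> = fps_nth 1 N"
    using initial convolution[of N] by (cases "N = 0") auto
  finally show "fps_nth (Abs_fps a * Abs_fps (\<lambda>n. (-1) ^ n * b n)) N = fps_nth 1 N" .
qed

lemma hdim_0: "hdim d I 0 = 1"
proof -
  have "(tens d 0 :: (nat list \<Rightarrow> 'a) set) = fs.span (delta ` words d 0)"
    unfolding tens_eq_supp_in by (rule span_delta[OF finite_words, symmetric])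
  also have "words d 0 = {[]}"
    by (auto simp: words_def)
  finally have "fs.dim (tens d 0 :: (nat list \<Rightarrow> 'a) set) = fs.dim (fs.span {delta [] :: nat list \<Rightarrow> 'a})"
    by simp
  also have "\<dots> = 1"
  proof (rule fs.dim_span_singleton)
    show "delta [] \<noteq> (0 :: nat list \<Rightarrow> 'a)"
      by (auto simp: fun_eq_iff delta_def)
  qed
  finally show ?thesis
    by (simp add: hdim_def Jsp_def)
qed

lemma hdim_quadratic_relations:
  fixes q :: "'k::field"
  shows "fs.dim (Jsp d (quadratic_relations k d q R) n) + hdim d (quadratic_relations k d q R) n
    = fs.dim (tens d n :: (nat list \<Rightarrow> 'k) set)"
  unfolding hdim_def using fs.fin_dim_dim_mono[OF Jsp_subset subspace_tens fin_dim_tens, of d k q R n] by simp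

lemma hdim_Sym_eq_dim_Wsp_Skew:
  assumes balanced: "\<And>N. N > 0 \<Longrightarrow> koszul_balanced N (Rop d R) q (tens d N)"
  shows "hdim d (quadratic_relations Sym d q R) n = fs.dim (Wsp d (quadratic_relations Skew d q R) n)"
proof (cases "n = 0")
  case True
  thus ?thesis
    using hdim_0[of d "quadratic_relations Sym d q R"] by (simp add: hdim_def Wsp_def Jsp_def)
next
  case False
  thus ?thesis
    using balanced[of n] hdim_quadratic_relations[of d Sym q R n]
    by (simp add: koszul_balanced_def Wsp_quadratic_relations Jsp_quadratic_relations)
qed

lemma dim_Koszul_component:
  fixes k :: kind and d :: nat and q :: "'k::field" and R :: "nat \<Rightarrow> nat \<Rightarrow> nat \<Rightarrow> nat \<Rightarrow> 'k"
  defines "I \<equiv> quadratic_relations k d q R"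
  shows "int (fs.dim (joint_relations k (Rop d R) q (tens d (n + m)) n))
      - int (fs.dim (relation_span k (Rop d R) q (tens d (n + m)) (n + m) n))
    = int (fs.dim (Wsp d I n)) * int (hdim d I m)"
proof -
  note W = subspace_Wsp[of d k q R n] Wsp_subset[of d k q R n]
  have "fs.dim (joint_relations k (Rop d R) q (tens d (n + m)) n)
      = fs.dim (Wsp d I n) * fs.dim (tens d m :: (nat list \<Rightarrow> 'k) set)"
    unfolding Ccx_quadratic_relations[symmetric] Ccx_def I_def
    by (rule dim_tensor_sp[OF W subspace_tens order_refl])
  moreover have "fs.dim (relation_span k (Rop d R) q (tens d (n + m)) (n + m) n)
      = fs.dim (Wsp d I n) * fs.dim (Jsp d I m)"
    unfolding Zcx_quadratic_relations[symmetric] Zcx_def I_def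
    by (rule dim_tensor_sp[OF W subspace_Jsp Jsp_subset])
  ultimately show ?thesis
    unfolding I_def hdim_quadratic_relations[of d k q R m, symmetric] by (simp add: algebra_simps)
qed

lemma hdim_convolution_eq_0:
  assumes balanced: "\<And>N. N > 0 \<Longrightarrow> koszul_balanced N (Rop d R) q (tens d N)" and N: "N > 0"
  shows "(\<Sum>n\<le>N. (-1) ^ n * (int (hdim d (quadratic_relations Sym d q R) n)
      * int (hdim d (quadratic_relations Skew d q R) (N - n)))) = 0"
proof -
  have "(\<Sum>n\<le>N. (-1) ^ n * (int (hdim d (quadratic_relations Sym d q R) n)
        * int (hdim d (quadratic_relations Skew d q R) (N - n))))
      = (\<Sum>n\<le>N. (-1) ^ n * (int (fs.dim (joint_relations Skew (Rop d R) q (tens d N) n))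
        - int (fs.dim (relation_span Skew (Rop d R) q (tens d N) N n))))"
  proof (rule sum.cong[OF refl])
    fix n assume "n \<in> {..N}"
    hence N_eq: "n + (N - n) = N"
      by simp
    show "(-1) ^ n * (int (hdim d (quadratic_relations Sym d q R) n)
          * int (hdim d (quadratic_relations Skew d q R) (N - n)))
        = (-1) ^ n * (int (fs.dim (joint_relations Skew (Rop d R) q (tens d N) n))
          - int (fs.dim (relation_span Skew (Rop d R) q (tens d N) N n)))"
      using dim_Koszul_component[of Skew d R q n "N - n"] hdim_Sym_eq_dim_Wsp_Skew[of d R q n, OF balanced]
      unfolding N_eq by simp
  qed
  also have "\<dots> = 0"
    using balanced[OF N] unfolding koszul_balanced_def
    by (intro operator_module.euler_characteristic_eq_0[OF operator_module_tens fin_dim_tens N]) blast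
  finally show ?thesis .
qed

theorem theorem3p1:
  fixes d :: nat and q :: "'k::field" and R :: "nat \<Rightarrow> nat \<Rightarrow> nat \<Rightarrow> nat \<Rightarrow> 'k"
  assumes "hecke_symmetry d q R"
    and "one_dim_source_cond d q R"
  shows "koszul d (IS d q R) \<and> koszul d (IL d q R)
    \<and> (Abs_fps (\<lambda>n. of_nat (hdim d (IS d q R) n))
        * Abs_fps (\<lambda>n. (-1) ^ n * of_nat (hdim d (IL d q R) n)) :: int fps) = 1"
proof -
  have "q \<noteq> 0"
    using assms(1) by (simp add: hecke_symmetry_def)
  hence balanced: "koszul_balanced N (Rop d R) q (tens d N)" if "N > 0" for N
    using assms(2) that by (rule koszul_balanced_tens)
  have "koszul d (quadratic_relations k d q R)" for k
    using balanced by (intro koszul_quadratic_relations) (simp add: koszul_balanced_def)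
  from this[of Sym] this[of Skew] show ?thesis
    using Abs_fps_mult_alternating_eq_1[OF _ _ hdim_convolution_eq_0[OF balanced]]
    by (simp add: quadratic_relations_def hdim_0)
qed

end
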